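(* Let $\Phi\in L^\infty(\mathbb{M}_n)$ be such that $\Phi$ and $\Phi^*$ are of bounded type, and suppose $$\Phi=\Phi_1\theta^{*},$$ where $\theta$ is a scalar inner function, $\Phi_1\in H^\infty(\mathbb{M}_n)$, and $\theta I_n$ and $\Phi_1$ are right coprime. If $T_\Phi$ and $T_\Phi^2$ are hyponormal, then $T_\Phi$ is either normal or analytic.
   Context: $\mathbb{T}$ is the unit circle, $L^\infty(\mathbb{M}_n)=L^\infty(\mathbb{T})\otimes\mathbb{M}_n$, $H^\infty(\mathbb{M}_n)=H^\infty\otimes\mathbb{M}_n$, $H^2(\mathbb{C}^n)$ is the $\mathbb{C}^n$-valued Hardy space, and $P$ is the orthogonal projection of $L^2(\mathbb{C}^n)$ onto $H^2(\mathbb{C}^n)$. The block Toeplitz operator is $T_\Phi f=P(\Phi f)$ on $H^2(\mathbb{C}^n)$. $T_\Phi$ is analytic if $\Phi\in H^\infty(\mathbb{M}_n)$. An operator $A$ is normal if $A^*A-AA^*=0$ and hyponormal if $A^*A-AA^*\ge 0$. A scalar function $\varphi\in L^\infty$ is of bounded type if $\varphi=\psi_1/\psi_2$ a.e. on $\mathbb{T}$ for some $\psi_1,\psi_2\in H^\infty$; a matrix function is of bounded type if all its entries are. $\Phi^*(z)=\Phi(z)^*$ on $\mathbb{T}$. A scalar inner function is $\theta\in H^\infty$ with $|\theta|=1$ a.e. on $\mathbb{T}$; $\theta^*=\overline\theta$. For $F\in H^\infty(\mathbb{M}_n)$, the inner part $F_i$ is the (possibly rectangular) inner function with $\overline{F\mathcal{P}_n}=F_iH^2(\mathbb{C}^m)$,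 where $\mathcal{P}_n$ is the set of $\mathbb{C}^n$-valued polynomials. $F,G$ are left coprime if $\overline{F\mathcal{P}_n}\vee\overline{G\mathcal{P}_n}=H^2(\mathbb{C}^n)$ (closed linear span), i.e. their inner parts have only constant unitary common left inner divisors. With $\widetilde F(z)=F(\overline z)^*$, $F,G$ are right coprime if $\widetilde F,\widetilde G$ are left coprime. *)

theory Defs
  imports "HOL-Analysis.Analysis"
begin

text \<open>
  Normalized arc length on the unit circle, viewed as a Borel measure on the complex plane that is
  concentrated on the circle. Elements of \<open>L\<^sup>p\<close> are represented by Borel functions on the plane;
  two functions represent the same element iff they agree almost everywhere for this measure, so
  values off the circle are irrelevant.
\<close>

definition circle :: "complex measure" where
  "circle = distr (uniform_measure lborel {0..2*pi}) borel cis"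

definition fourier_coeff :: "(complex \<Rightarrow> complex) \<Rightarrow> int \<Rightarrow> complex" where
  "fourier_coeff f k = (LINT z|circle. f z * z powi (- k))"

definition Linf :: "(complex \<Rightarrow> complex) set" where
  "Linf = {f \<in> borel_measurable circle. \<exists>C. AE z in circle. norm (f z) \<le> C}"

definition Hinf :: "(complex \<Rightarrow> complex) set" where
  "Hinf = {f \<in> Linf. \<forall>k<0. fourier_coeff f k = 0}"

definition Linf_mat :: "(complex \<Rightarrow> complex^'n^'n) set" where
  "Linf_mat = {F. \<forall>i j. (\<lambda>z. F z $ i $ j) \<in> Linf}"

definition Hinf_mat :: "(complex \<Rightarrow> complex^'n^'n) set" where
  "Hinf_mat = {F. \<forall>i j. (\<lambda>z. F z $ i $ j) \<in> Hinf}"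

definition L2 :: "(complex \<Rightarrow> complex^'n) set" where
  "L2 = {f \<in> borel_measurable circle. integrable circle (\<lambda>z. (norm (f z))\<^sup>2)}"

definition L2_inner :: "(complex \<Rightarrow> complex^'n) \<Rightarrow> (complex \<Rightarrow> complex^'n) \<Rightarrow> complex" where
  "L2_inner f g = (LINT z|circle. (\<Sum>i\<in>UNIV. f z $ i * cnj (g z $ i)))"

definition L2_norm :: "(complex \<Rightarrow> complex^'n) \<Rightarrow> real" where
  "L2_norm f = sqrt (LINT z|circle. (norm (f z))\<^sup>2)"

definition H2 :: "(complex \<Rightarrow> complex^'n) set" where
  "H2 = {f \<in> L2. \<forall>i. \<forall>k<0. fourier_coeff (\<lambda>z. f z $ i) k = 0}"

text \<open>
  Orthogonal projection of \<open>L2\<close> onto \<open>H2\<close>. The value is determined up to equality almost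
  everywhere, and the choice picks one representative.
\<close>

definition proj_H2 :: "(complex \<Rightarrow> complex^'n) \<Rightarrow> (complex \<Rightarrow> complex^'n)" where
  "proj_H2 f = (SOME g. g \<in> H2 \<and> (\<forall>h\<in>H2. L2_inner (\<lambda>z. f z - g z) h = 0))"

definition toeplitz ::
    "(complex \<Rightarrow> complex^'n^'n) \<Rightarrow> (complex \<Rightarrow> complex^'n) \<Rightarrow> (complex \<Rightarrow> complex^'n)" where
  "toeplitz \<Phi> f = proj_H2 (\<lambda>z. \<Phi> z *v f z)"

text \<open>
  Hilbert space adjoint of an operator on \<open>H2\<close>, again with one representative chosen.
\<close>

definition H2_adjoint ::
    "((complex \<Rightarrow> complex^'n) \<Rightarrow> (complex \<Rightarrow> complex^'n)) \<Rightarrow>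
     (complex \<Rightarrow> complex^'n) \<Rightarrow> (complex \<Rightarrow> complex^'n)" where
  "H2_adjoint A g = (SOME h. h \<in> H2 \<and> (\<forall>f\<in>H2. L2_inner (A f) g = L2_inner f h))"

definition self_commutator ::
    "((complex \<Rightarrow> complex^'n) \<Rightarrow> (complex \<Rightarrow> complex^'n)) \<Rightarrow>
     (complex \<Rightarrow> complex^'n) \<Rightarrow> (complex \<Rightarrow> complex^'n)" where
  "self_commutator A f = (\<lambda>z. H2_adjoint A (A f) z - A (H2_adjoint A f) z)"

definition H2_normal :: "((complex \<Rightarrow> complex^'n) \<Rightarrow> (complex \<Rightarrow> complex^'n)) \<Rightarrow> bool" where
  "H2_normal A \<longleftrightarrow> (\<forall>f\<in>H2. AE z in circle. self_commutator A f z = 0)"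

definition H2_hyponormal :: "((complex \<Rightarrow> complex^'n) \<Rightarrow> (complex \<Rightarrow> complex^'n)) \<Rightarrow> bool" where
  "H2_hyponormal A \<longleftrightarrow> (\<forall>f\<in>H2. L2_inner (self_commutator A f) f \<in> \<real>\<^sub>\<ge>\<^sub>0)"

definition bounded_type :: "(complex \<Rightarrow> complex) \<Rightarrow> bool" where
  "bounded_type \<phi> \<longleftrightarrow>
     (\<exists>\<psi>1\<in>Hinf. \<exists>\<psi>2\<in>Hinf. AE z in circle. \<psi>2 z \<noteq> 0 \<and> \<phi> z = \<psi>1 z / \<psi>2 z)"

definition bounded_type_mat :: "(complex \<Rightarrow> complex^'n^'n) \<Rightarrow> bool" where
  "bounded_type_mat F \<longleftrightarrow> (\<forall>i j. bounded_type (\<lambda>z. F z $ i $ j))"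

definition inner_function :: "(complex \<Rightarrow> complex) \<Rightarrow> bool" where
  "inner_function \<theta> \<longleftrightarrow> \<theta> \<in> Hinf \<and> (AE z in circle. norm (\<theta> z) = 1)"

definition conj_transpose :: "complex^'n^'n \<Rightarrow> complex^'n^'n" where
  "conj_transpose A = (\<chi> i j. cnj (A $ j $ i))"

definition vec_polys :: "(complex \<Rightarrow> complex^'n) set" where
  "vec_polys = range (\<lambda>(p :: 'n \<Rightarrow> complex poly) z. \<chi> i. poly (p i) z)"

definition L2_closure :: "(complex \<Rightarrow> complex^'n) set \<Rightarrow> (complex \<Rightarrow> complex^'n) set" where
  "L2_closure S = {f \<in> L2. \<forall>e>0. \<exists>g\<in>S \<inter> L2. L2_norm (\<lambda>z. f z - g z) < e}"

definition closed_span :: "(complex \<Rightarrow> complex^'n) set \<Rightarrow> (complex \<Rightarrow> complex^'n) set" where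
  "closed_span S =
     L2_closure {\<lambda>z. \<Sum>g\<in>B. c g *s g z | B c. finite B \<and> B \<subseteq> S}"

definition range_closure :: "(complex \<Rightarrow> complex^'n^'n) \<Rightarrow> (complex \<Rightarrow> complex^'n) set" where
  "range_closure F = L2_closure ((\<lambda>p z. F z *v p z) ` vec_polys)"

definition left_coprime :: "(complex \<Rightarrow> complex^'n^'n) \<Rightarrow> (complex \<Rightarrow> complex^'n^'n) \<Rightarrow> bool" where
  "left_coprime F G \<longleftrightarrow> closed_span (range_closure F \<union> range_closure G) = H2"

definition tilde :: "(complex \<Rightarrow> complex^'n^'n) \<Rightarrow> (complex \<Rightarrow> complex^'n^'n)" where
  "tilde F = (\<lambda>z. conj_transpose (F (cnj z)))"

definition right_coprime :: "(complex \<Rightarrow> complex^'n^'n) \<Rightarrow> (complex \<Rightarrow> complex^'n^'n) \<Rightarrow> bool" where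
  "right_coprime F G \<longleftrightarrow> left_coprime (tilde F) (tilde G)"

end

theory Submission
  imports Defs
begin

text \<open>
  Write \<open>T\<close> for the Toeplitz operator of \<open>\<Phi>\<close>, \<open>T'\<close> for its adjoint and \<open>\<Psi>\<close> for the pointwise adjoint
  of \<open>\<Phi>\<close>. Hyponormality makes \<open>\<Phi>\<close> pointwise normal and, by coprimeness, every \<open>f\<close> in \<open>H2\<close> with
  \<open>\<Psi> f\<close> in \<open>H2\<close> is divisible by \<open>\<theta>\<close> in \<open>H2\<close>. If moreover \<open>\<Psi> \<Psi> f\<close> is in \<open>H2\<close>, then the form of the
  self-commutator of \<open>T\<^sup>2\<close> vanishes at \<open>f\<close>, so hyponormality of \<open>T\<^sup>2\<close> puts \<open>g = \<Phi> \<Psi> f\<close> in the kernel of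
  the self-commutator of \<open>T\<close>. Comparing this for \<open>g\<close> and \<open>z g\<close> shows that the Fourier coefficients of
  index \<open>-1\<close> of \<open>\<Phi> q\<close> and \<open>\<Phi> g\<close> have the same inner product as those of \<open>\<Psi> q\<close> and \<open>\<Psi> g\<close>, for
  every \<open>q\<close> in \<open>H2\<close>.

  If the coefficients of index \<open>-1\<close> of the functions \<open>\<Psi> g\<close> exhaust \<open>\<complex>\<^sup>n\<close>, a constant unitary matrix carries the
  Hankel part of \<open>\<Phi>\<close> to that of \<open>\<Psi>\<close>, and \<open>T\<close> is normal. Otherwise some constant row \<open>p \<noteq> 0\<close>
  annihilates them, so \<open>p \<Psi> g\<close> is analytic for all such \<open>g\<close>. With \<open>b\<close> the determinant of \<open>\<omega> \<Psi>\<close> up to sign,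
  where \<open>\<omega>\<close> is a common denominator of \<open>\<Psi>\<close>, this forces \<open>b\<^sup>2 r\<^sup>m\<close> to be analytic for all \<open>m\<close> and
  every entry \<open>r\<close> of \<open>p \<Phi>\<close>; hence \<open>p \<Phi>\<close> itself is analytic. Since injectivity of a square matrix on
  a module implies that of its transpose, coprimeness then makes the conjugate of \<open>\<theta>\<close> analytic,
  and with it \<open>\<Phi>\<close>.
\<close>

subsection \<open>Fourier coefficients on the unit circle\<close>

text \<open>\<open>F\<close> is designed so that \<open>T\<close>, \<open>T'\<close> and their
  squares act on its members as plain multiplications; pointwise normality of \<Phi> then equates
  the norms of the two squares at f, which is why the form vanishes there. To make \<open>F\<close>
  large, \<open>ct\<close> has to be inverted twice within analytic functions: hence the square of
  b, while bounded type provides the denominator \<omega>. That b is not zero almost everywhere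
  follows from coprimeness, unless the conjugate of \<theta> is already analytic.

  Analyticity of b^2 r alone would say little, since zeros of b may cancel poles of r. With b^2
  fixed and all powers of r allowed this cannot happen: \<open>Hinf\<close> is completely integrally
  closed. The powers arise by feedback: analyticity of b^2 r^m produces a new member of
  \<open>F\<close>, whose annihilation gives b^2 r^(m+1).

  The last step reads \<open>\<Phi>\<^sub>1\<close> modulo \<theta>: coprimeness makes it injective
  on columns, while p is a row that it kills. The Faddeev-LeVerrier recursion passes from columns to
  rows.\<close>

lemma sets_circle [simp, measurable_cong]: "sets circle = sets borel"
  by (simp add: circle_def)

lemma space_circle [simp]: "space circle = UNIV"
  by (simp add: circle_def)

lemma cis_measurable [measurable]: "cis \<in> borel_measurable borel"
  by (intro borel_measurable_continuous_onI continuous_intros)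

lemma emeasure_circle_UNIV: "emeasure circle UNIV = 1"
proof -
  have "emeasure circle UNIV = emeasure (uniform_measure lborel {0..2*pi}) UNIV"
    unfolding circle_def by (subst emeasure_distr) auto
  also have "\<dots> = 1"
    by (subst emeasure_uniform_measure) (auto simp: ennreal_divide_self)
  finally show ?thesis .
qed

interpretation circle: finite_measure circle
  by standard (simp add: emeasure_circle_UNIV)

lemma measure_circle_UNIV [simp]: "measure circle UNIV = 1"
  by (simp add: measure_def emeasure_circle_UNIV)

lemma AE_circle_norm: "AE z in circle. norm z = 1"
  unfolding circle_def by (subst AE_distr_iff) auto

lemma uniform_measure_interval:
  "uniform_measure lborel {0..2*pi} =
     density lborel (\<lambda>t. ennreal (indicator {0..2*pi} t / (2 * pi)))"
  unfolding uniform_measure_def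
  by (intro density_cong) (auto simp: indicator_def divide_ennreal ennreal_1[symmetric] simp del: ennreal_1)

lemma integral_circle:
  fixes f :: "complex \<Rightarrow> 'a::{banach, second_countable_topology}"
  assumes [measurable]: "f \<in> borel_measurable borel"
  shows "(LINT z|circle. f z) =
    (LINT t|lborel. (indicator {0..2*pi} t / (2 * pi)) *\<^sub>R f (cis t))"
  unfolding circle_def
  by (subst integral_distr) (auto simp: uniform_measure_interval integral_density)

lemma powi_measurable [measurable]: "(\<lambda>z::complex. z powi k) \<in> borel_measurable borel"
  by (cases "k \<ge> 0") (auto simp: power_int_def)

lemma has_vector_derivative_cis_mult:
  "((\<lambda>t. cis (c * t)) has_vector_derivative of_real c * (\<i> * cis (c * t))) (at t within S)"
proof -
  have "((\<lambda>z. exp (\<i> * (of_real c * z))) has_field_derivative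
      exp (\<i> * (of_real c * of_real t)) * (\<i> * of_real c)) (at (of_real t))"
    by (auto intro!: derivative_eq_intros)
  from has_vector_derivative_real_field[OF this] show ?thesis
    by (simp add: cis_conv_exp mult_ac has_vector_derivative_at_within)
qed

lemma integral_circle_powi: "(LINT z|circle. z powi k) = (if k = 0 then 1 else 0)"
proof (cases "k = 0")
  case True
  then show ?thesis by simp
next
  case False
  let ?F = "\<lambda>t. cis (of_int k * t) / (\<i> * of_int k)"
  have "(LINT z|circle. z powi k) =
      (LINT t|lborel. indicator {0..2*pi} t *\<^sub>R (cis (of_int k * t) / (2 * pi)))"
    by (subst integral_circle) (auto simp: cis_power_int scaleR_conv_of_real mult_ac intro!: Bochner_Integration.integral_cong)
  also have "\<dots> = (LINT t|lborel. indicator {0..2*pi} t *\<^sub>R cis (of_int k * t)) / (2 * pi)"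
    by (subst Bochner_Integration.integral_divide_zero[symmetric])
      (simp add: scaleR_conv_of_real)
  also have "(LINT t|lborel. indicator {0..2*pi} t *\<^sub>R cis (of_int k * t)) = ?F (2*pi) - ?F 0"
  proof (intro integral_FTC_atLeastAtMost continuous_intros)
    fix t :: real
    have "((\<lambda>t. cis (of_int k * t) / (\<i> * of_int k)) has_vector_derivative
        (of_real (of_int k) * (\<i> * cis (of_int k * t))) / (\<i> * of_int k)) (at t within {0..2*pi})"
      by (intro has_vector_derivative_divide has_vector_derivative_cis_mult)
    then show "(?F has_vector_derivative cis (of_int k * t)) (at t within {0..2*pi})"
      using False by simp
  qed auto
  also have "\<dots> = 0"
    using cis_multiple_2pi[of "of_int k"] by (simp add: mult_ac)
  finally show ?thesis using False by simp
qed

text \<open>The substitution of \<open>2 * pi - t\<close> for \<open>t\<close> maps the interval to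
  itself and conjugates \<open>cis t\<close>. The invariance later undoes the conjugated argument in
  \<open>tilde\<close>.\<close>

lemma distr_circle_cnj: "distr circle borel cnj = circle"
proof (rule measure_eqI)
  fix A assume "A \<in> sets (distr circle borel cnj)"
  then have A [measurable]: "A \<in> sets borel" by simp
  have [measurable]: "cnj \<in> borel_measurable borel"
    by (intro borel_measurable_continuous_onI continuous_intros)
  have *: "emeasure circle B = (\<integral>\<^sup>+t. indicator B (cis t) * indicator {0..2*pi} t \<partial>lborel) / ennreal (2*pi)"
    if [measurable]: "B \<in> sets borel" for B
  proof -
    have "emeasure circle B = (\<integral>\<^sup>+z. indicator B z \<partial>circle)" by simp
    also have "\<dots> = (\<integral>\<^sup>+t. indicator B (cis t) \<partial>uniform_measure lborel {0..2*pi})"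
      unfolding circle_def by (subst nn_integral_distr) auto
    also have "\<dots> = (\<integral>\<^sup>+t. indicator B (cis t) * indicator {0..2*pi} t \<partial>lborel) / ennreal (2*pi)"
      by (subst nn_integral_uniform_measure) auto
    finally show ?thesis .
  qed
  have "emeasure (distr circle borel cnj) A = emeasure circle (cnj -` A)"
    by (subst emeasure_distr) auto
  also have "\<dots> = (\<integral>\<^sup>+t. indicator (cnj -` A) (cis t) * indicator {0..2*pi} t \<partial>lborel) / ennreal (2*pi)"
    by (rule *) (use measurable_sets[of cnj borel borel A] in auto)
  also have "(\<integral>\<^sup>+t. indicator (cnj -` A) (cis t) * indicator {0..2*pi} t \<partial>lborel) =
      (\<integral>\<^sup>+t. indicator A (cis (-t)) * indicator {0..2*pi} t \<partial>lborel)"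
    by (intro nn_integral_cong) (auto simp: indicator_def cis_cnj)
  also have "\<dots> = (\<integral>\<^sup>+t. indicator A (cis (-(2*pi + (-1) * t))) * indicator {0..2*pi} (2*pi + (-1)*t) \<partial>lborel)"
    by (subst nn_integral_real_affine[where c="-1" and t="2*pi"]) auto
  also have "\<dots> = (\<integral>\<^sup>+t. indicator A (cis t) * indicator {0..2*pi} t \<partial>lborel)"
  proof (intro nn_integral_cong)
    fix t
    have "cis (-(2*pi + (-1) * t)) = cis t"
      by (simp add: cis.ctr cos_diff sin_diff)
    then show "indicator A (cis (-(2*pi + (-1) * t))) * indicator {0..2*pi} (2*pi + (-1)*t) =
        (indicator A (cis t) * indicator {0..2*pi} t :: ennreal)"
      by (auto simp: indicator_def)
  qed
  finally show "emeasure (distr circle borel cnj) A = emeasure circle A"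
    by (simp add: *)
qed auto

section \<open>Integrable functions are determined by their Fourier coefficients\<close>

lemma AE_circle_norm_powi: "AE z in circle. norm (z powi k) = 1"
  using AE_circle_norm by eventually_elim (simp add: norm_power_int)

lemma integrable_circle_mult_powi:
  fixes f :: "complex \<Rightarrow> complex"
  assumes "integrable circle f"
  shows "integrable circle (\<lambda>z. f z * z powi k)"
proof (rule Bochner_Integration.integrable_bound[OF assms])
  show "AE x in circle. norm (f x * x powi k) \<le> norm (f x)"
    using AE_circle_norm_powi[of k] by eventually_elim (simp add: norm_mult)
qed (use assms in measurable)

text \<open>Integrability is included because the Bochner integral of a non-integrable function is
  0, so the coefficient condition could hold vacuously.\<close>

definition null_coeffs :: "(complex \<Rightarrow> complex) \<Rightarrow> bool" where
  "null_coeffs f \<longleftrightarrow> integrable circle f \<and> (\<forall>k. (LINT z|circle. f z * z powi k) = 0)"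

lemma null_coeffs_powi:
  assumes "null_coeffs f"
  shows "null_coeffs (\<lambda>z. f z * z powi j)"
  unfolding null_coeffs_def
proof (intro conjI allI)
  have fi: "integrable circle f" and f0: "\<And>k. (LINT z|circle. f z * z powi k) = 0"
    using assms by (simp_all add: null_coeffs_def)
  have [measurable]: "f \<in> borel_measurable borel" using fi by auto
  show "integrable circle (\<lambda>z. f z * z powi j)"
    by (rule integrable_circle_mult_powi[OF fi])
  fix k
  have "(LINT z|circle. f z * z powi j * z powi k) = (LINT z|circle. f z * z powi (j + k))"
  proof (rule integral_cong_AE)
    show "AE z in circle. f z * z powi j * z powi k = f z * z powi (j + k)"
      using AE_circle_norm
    proof eventually_elim
      case (elim z)
      then have "z \<noteq> 0" by auto
      then show ?case by (simp add: power_int_add)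
    qed
  qed measurable
  then show "(LINT z|circle. f z * z powi j * z powi k) = 0"
    using f0 by simp
qed

lemma null_coeffs_add: "null_coeffs f \<Longrightarrow> null_coeffs g \<Longrightarrow> null_coeffs (\<lambda>z. f z + g z)"
  unfolding null_coeffs_def
  by (auto simp: ring_distribs integrable_circle_mult_powi)

lemma null_coeffs_cmult: "null_coeffs f \<Longrightarrow> null_coeffs (\<lambda>z. c * f z)"
  unfolding null_coeffs_def by (auto simp: mult.assoc)

lemma null_coeffs_cong_AE:
  assumes "null_coeffs f" "AE z in circle. f z = g z" "g \<in> borel_measurable borel"
  shows "null_coeffs g"
proof -
  have [measurable]: "f \<in> borel_measurable borel" "g \<in> borel_measurable borel"
    using assms by (auto simp: null_coeffs_def)
  have "(LINT z|circle. g z * z powi k) = (LINT z|circle. f z * z powi k)" for k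
    by (rule integral_cong_AE) (use assms(2) in \<open>auto elim: AE_mp\<close>)
  moreover have "integrable circle g"
    using assms integrable_cong_AE[of f circle g] by (auto simp: null_coeffs_def)
  ultimately show ?thesis using assms by (simp add: null_coeffs_def)
qed

text \<open>On the circle the inverse of z is its conjugate, so a real linear form is a combination
  of z and its inverse, and multiplication by it merely mixes integer powers.\<close>

lemma null_coeffs_real_polynomial:
  assumes "real_polynomial_function q"
  shows "null_coeffs f \<Longrightarrow> null_coeffs (\<lambda>z. f z * of_real (q z))"
  using assms
\<comment> \<open>In the product case the hypothesis for the second factor is applied to
  \<open>f\<close> times the first, hence the generalization over \<open>f\<close>.\<close>
proof (induction q arbitrary: f rule: real_polynomial_function.induct)
  case (linear q)
  let ?a = "complex_of_real (q 1)" and ?b = "complex_of_real (q \<i>)"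
  have fm [measurable]: "f \<in> borel_measurable borel" using linear by (auto simp: null_coeffs_def)
  have qm [measurable]: "q \<in> borel_measurable borel"
    using linear(1) by (intro borel_measurable_continuous_onI linear_continuous_on)
  have q: "of_real (q z) = ((?a - \<i> * ?b) * z + (?a + \<i> * ?b) * cnj z) / 2" for z
  proof -
    have "q z = q (Re z *\<^sub>R 1 + Im z *\<^sub>R \<i>)"
      by (rule arg_cong[of _ _ q]) (simp add: complex_eq_iff)
    also have "\<dots> = Re z * q 1 + Im z * q \<i>"
      using linear(1) by (simp add: linear_add linear_scale bounded_linear.linear)
    finally show ?thesis by (simp add: complex_eq_iff algebra_simps)
  qed
  have aux: "c / 2 * (v * x) + d / 2 * (v * y) = v * ((c * x + d * y) / 2)" for c d v x y :: complex
    by (simp add: field_simps)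
  have "null_coeffs (\<lambda>z. ((?a - \<i> * ?b) / 2) * (f z * z powi 1) + ((?a + \<i> * ?b) / 2) * (f z * z powi (-1)))"
    using linear by (intro null_coeffs_add null_coeffs_cmult null_coeffs_powi)
  then show ?case
  proof (rule null_coeffs_cong_AE)
    show "AE z in circle. ((?a - \<i> * ?b) / 2) * (f z * z powi 1) + ((?a + \<i> * ?b) / 2) * (f z * z powi (-1))
      = f z * of_real (q z)"
      using AE_circle_norm
    proof eventually_elim
      case (elim z)
      then have "z * cnj z = 1" by (simp add: complex_norm_square[symmetric])
      then have "inverse z = cnj z" by (metis inverse_unique)
      then have cnj: "z powi (-1) = cnj z" by (simp add: power_int_minus)
      show ?case by (subst q[of z], unfold cnj power_int_1_right) (rule aux)
    qed
    show "(\<lambda>z. f z * of_real (q z)) \<in> borel_measurable borel"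
      by measurable
  qed
next
  case (const c)
  have "(\<lambda>z. f z * complex_of_real c) = (\<lambda>z. complex_of_real c * f z)"
    by (simp add: mult.commute)
  then show ?case using null_coeffs_cmult[OF const, of "of_real c"] by metis
next
  case (add p q)
  have "null_coeffs (\<lambda>z. f z * of_real (p z) + f z * of_real (q z))"
    by (rule null_coeffs_add[OF add.IH(1)[OF add.prems] add.IH(2)[OF add.prems]])
  then show ?case by (simp add: distrib_left)
next
  case (mult p q)
  show ?case
    using mult.IH(2)[OF mult.IH(1)[OF mult.prems]] by (simp add: mult.assoc)
qed

lemma zero_if_le_epsilon_mult:
  fixes x c :: real
  assumes small: "\<And>e. e > 0 \<Longrightarrow> x \<le> e * c" and "0 \<le> c" "0 \<le> x"
  shows "x = 0"
proof (rule ccontr)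
  assume "x \<noteq> 0"
  then have "x > 0" using assms by simp
  then have "x \<le> x / (2 * (c + 1)) * c"
    using \<open>0 \<le> c\<close> by (intro small) auto
  also have "\<dots> < x"
    using \<open>0 < x\<close> \<open>0 \<le> c\<close> by (simp add: field_simps add_nonneg_pos)
  finally show False by simp
qed

text \<open>Stone-Weierstrass on the unit circle gives polynomials with error below
  \<open>e\<close>. The integral against a polynomial vanishes, so what remains is at most
  \<open>e\<close> times the L1 norm of \<open>f\<close>.\<close>

lemma null_coeffs_continuous:
  assumes f: "null_coeffs f" and q: "continuous_on UNIV (q :: complex \<Rightarrow> real)"
  shows "(LINT z|circle. f z * of_real (q z)) = 0"
proof -
  have fi: "integrable circle f" using f by (simp add: null_coeffs_def)
  have qm [measurable]: "q \<in> borel_measurable borel" using q by (rule borel_measurable_continuous_onI)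
  have fm [measurable]: "f \<in> borel_measurable borel" using fi by auto
  have "compact (q ` sphere 0 1)"
    using q by (intro compact_continuous_image) (auto intro: continuous_on_subset)
  then obtain C where "\<forall>x\<in>q ` sphere 0 1. norm x \<le> C"
    using compact_imp_bounded[of "q ` sphere 0 1"] by (meson bounded_iff)
  then have C: "AE z in circle. \<bar>q z\<bar> \<le> C"
    using AE_circle_norm by (auto elim!: eventually_mono)
  have fq: "integrable circle (\<lambda>z. f z * of_real (q z))"
  proof (rule Bochner_Integration.integrable_bound)
    show "integrable circle (\<lambda>z. norm (f z) * C)" using fi by simp
    show "AE z in circle. norm (f z * of_real (q z)) \<le> norm (norm (f z) * C)"
      using C by eventually_elim (simp add: norm_mult abs_mult mult_left_mono)
  qed measurable
  have "norm (LINT z|circle. f z * of_real (q z)) \<le> e * (LINT z|circle. norm (f z))" if "e > 0" for e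
  proof -
    obtain p where p: "real_polynomial_function p" "\<And>z. z \<in> sphere 0 1 \<Longrightarrow> \<bar>q z - p z\<bar> < e"
      using Stone_Weierstrass_real_polynomial_function[of "sphere (0::complex) 1" q e] q \<open>e > 0\<close>
      by (metis compact_sphere continuous_on_subset subset_UNIV)
    have "null_coeffs (\<lambda>z. f z * of_real (p z))"
      using null_coeffs_real_polynomial[OF p(1) f] .
    then have fp: "integrable circle (\<lambda>z. f z * of_real (p z))" and
      "(LINT z|circle. f z * of_real (p z) * z powi 0) = 0"
      unfolding null_coeffs_def by blast+
    then have fp0: "(LINT z|circle. f z * of_real (p z)) = 0"
      by simp
    have "(LINT z|circle. f z * of_real (q z)) = (LINT z|circle. f z * of_real (q z) - f z * of_real (p z))"
      using fq fp fp0 by simp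
    also have "norm \<dots> \<le> (LINT z|circle. norm (f z * of_real (q z) - f z * of_real (p z)))"
      by (rule integral_norm_bound)
    also have "\<dots> \<le> (LINT z|circle. e * norm (f z))"
    proof (rule integral_mono_AE)
      show "AE z in circle. norm (f z * of_real (q z) - f z * of_real (p z)) \<le> e * norm (f z)"
        using AE_circle_norm
      proof eventually_elim
        case (elim z)
        then have "\<bar>q z - p z\<bar> \<le> e" using p(2)[of z] by simp
        then show ?case
          by (simp flip: of_real_diff right_diff_distrib add: norm_mult mult.commute[of e] mult_left_mono)
      qed
    qed (use fi fq fp in auto)
    finally show ?thesis by simp
  qed
  then have "norm (LINT z|circle. f z * of_real (q z)) = 0"
    by (intro zero_if_le_epsilon_mult) auto
  then show ?thesis by simp
qed

text \<open>The indicator of a closed set is the pointwise limit of the continuous functions max(0,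
  1 - n dist(z, A)).\<close>

lemma null_coeffs_closed:
  assumes f: "null_coeffs f" and A: "closed A"
  shows "(LINT z|circle. indicator A z * f z) = 0"
\<comment> \<open>\<open>infdist\<close> to the empty set is 0 by convention, so the approximants
  below would be constantly 1.\<close>
proof (cases "A = {}")
  case False
  define q :: "nat \<Rightarrow> complex \<Rightarrow> real" where "q n z = max 0 (1 - real n * infdist z A)" for n z
  have fi: "integrable circle f" using f by (simp add: null_coeffs_def)
  have Am [measurable]: "A \<in> sets borel" using A by auto
  have qc: "continuous_on UNIV (q n)" for n
    unfolding q_def by (intro continuous_intros)
  then have qm [measurable]: "q n \<in> borel_measurable borel" for n by (rule borel_measurable_continuous_onI)
  have fm [measurable]: "f \<in> borel_measurable borel" using fi by auto
  have "(\<lambda>n. LINT z|circle. f z * of_real (q n z)) \<longlonglongrightarrow> (LINT z|circle. indicator A z * f z)"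
  proof (rule integral_dominated_convergence[where w = "\<lambda>z. norm (f z)"])
    show "AE z in circle. (\<lambda>n. f z * of_real (q n z)) \<longlonglongrightarrow> indicator A z * f z"
    proof (intro AE_I2)
      fix z
      show "(\<lambda>n. f z * of_real (q n z)) \<longlonglongrightarrow> indicator A z * f z"
      proof (cases "z \<in> A")
        case True
        then show ?thesis by (simp add: q_def)
      next
        case z: False
        then have pos: "infdist z A > 0"
          using in_closed_iff_infdist_zero[OF A False] infdist_nonneg[of z A] by force
        obtain N where N: "1 / infdist z A < real N" using reals_Archimedean2 by blast
        have "eventually (\<lambda>n. q n z = 0) sequentially"
          using eventually_ge_at_top[of N]
        proof eventually_elim
          case (elim n)
          then have "1 / infdist z A < real n" using N by linarith
          then show ?case using pos by (simp add: q_def field_simps max_def)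
        qed
        then have "eventually (\<lambda>n. f z * of_real (q n z) = 0) sequentially"
          by eventually_elim simp
        then show ?thesis using z by (simp add: tendsto_eventually)
      qed
    qed
    show "AE z in circle. norm (f z * of_real (q n z)) \<le> norm (f z)" for n
    proof (intro AE_I2)
      fix z
      have "\<bar>q n z\<bar> \<le> 1" using infdist_nonneg[of z A] by (auto simp: q_def)
      then show "norm (f z * of_real (q n z)) \<le> norm (f z)"
        by (simp add: norm_mult mult_left_le)
    qed
  qed (use fi in auto)
  then show ?thesis
    using null_coeffs_continuous[OF f qc] by (simp add: LIMSEQ_const_iff)
qed auto

lemma integrable_circle_indicator:
  fixes f :: "complex \<Rightarrow> complex"
  assumes "integrable circle f" "A \<in> sets borel"
  shows "integrable circle (\<lambda>z. indicator A z * f z)"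
proof -
  have "(\<lambda>z. indicator A z * f z) = (\<lambda>z. indicator A z *\<^sub>R f z)"
    by (auto simp: indicator_def)
  then show ?thesis using integrable_mult_indicator[of A circle f] assms by simp
qed

text \<open>Dynkin's argument: closed sets form an intersection-stable generator of the Borel sets,
  and vanishing passes to complements and to disjoint unions.\<close>

lemma null_coeffs_set:
  assumes f: "null_coeffs f" and A: "A \<in> sets borel"
  shows "(LINT z|circle. indicator A z * f z) = 0"
proof -
  have fi: "integrable circle f" using f by (simp add: null_coeffs_def)
  have int: "integrable circle (\<lambda>z. indicator B z * f z)" if "B \<in> sets borel" for B
    using that by (intro integrable_circle_indicator fi)
  have gen: "sets (borel :: complex measure) = sigma_sets UNIV (Collect closed)"
    by (simp add: borel_eq_closed)
  have stab: "Int_stable (Collect closed :: complex set set)"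
    by (auto simp: Int_stable_def)
  have sub: "Collect closed \<subseteq> Pow (UNIV :: complex set)" by simp
  have "A \<in> sigma_sets UNIV (Collect closed)" using A gen by simp
  from stab sub this show ?thesis
  proof (induction rule: sigma_sets_induct_disjoint)
    case (basic B) then show ?case using null_coeffs_closed[OF f] by simp
  next
    case empty then show ?case by simp
  next
    case (compl B)
    have B: "B \<in> sets borel" using compl gen by simp
    have "(LINT z|circle. f z * of_real ((\<lambda>_. 1) z)) = 0"
      by (rule null_coeffs_continuous[OF f]) auto
    then have 1: "(LINT z|circle. f z) = 0" by simp
    have "(LINT z|circle. indicator (UNIV - B) z * f z) = (LINT z|circle. f z - indicator B z * f z)"
      by (intro Bochner_Integration.integral_cong) (auto simp: indicator_def)
    also have "\<dots> = 0" using compl int[OF B] fi 1 by simp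
    finally show ?case .
  next
    case (union B)
    have B: "B i \<in> sets borel" for i using union gen by auto
    have "(\<lambda>n. LINT z|circle. indicator (\<Union>i<n. B i) z * f z) \<longlonglongrightarrow> (LINT z|circle. indicator (\<Union>i. B i) z * f z)"
    proof (rule integral_dominated_convergence[where w = "\<lambda>z. norm (f z)"])
      show "AE z in circle. (\<lambda>n. indicator (\<Union>i<n. B i) z * f z) \<longlonglongrightarrow> indicator (\<Union>i. B i) z * f z"
      proof (intro AE_I2 tendsto_eventually)
        fix z
        show "\<forall>\<^sub>F n in sequentially. indicator (\<Union>i<n. B i) z * f z = indicator (\<Union>i. B i) z * f z"
        proof (cases "z \<in> (\<Union>i. B i)")
          case True
          then obtain i where "z \<in> B i" by auto
          then show ?thesis
            by (intro eventually_mono[OF eventually_gt_at_top[of i]]) (auto simp: indicator_def split: if_splits)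
        qed (auto simp: indicator_def)
      qed
    qed (use fi B in \<open>auto simp: indicator_def\<close>)
    moreover have "(LINT z|circle. indicator (\<Union>i<n. B i) z * f z) = 0" for n
    proof -
      have "(LINT z|circle. indicator (\<Union>i<n. B i) z * f z) = (LINT z|circle. (\<Sum>i<n. indicator (B i) z * f z))"
      proof (intro Bochner_Integration.integral_cong)
        fix z
        show "indicator (\<Union>i<n. B i) z * f z = (\<Sum>i<n. indicator (B i) z * f z)"
          using union(1) by (subst indicator_UN_disjoint) (auto simp: disjoint_family_on_def sum_distrib_right)
      qed simp
      also have "\<dots> = (\<Sum>i<n. LINT z|circle. indicator (B i) z * f z)"
        by (rule Bochner_Integration.integral_sum) (use int B in auto)
      finally show ?thesis using union by simp
    qed
    ultimately show ?case by (simp add: LIMSEQ_const_iff)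
  qed
qed

lemma AE_zero_if_set_integrals_zero:
  fixes u :: "complex \<Rightarrow> real"
  assumes u: "integrable circle u" and z: "\<And>A. A \<in> sets borel \<Longrightarrow> (LINT z|circle. indicator A z * u z) = 0"
  shows "AE z in circle. u z = 0"
proof -
  have [measurable]: "u \<in> borel_measurable borel" using u by auto
  have half: "AE z in circle. v z \<le> 0"
    if v: "integrable circle v" and vz: "\<And>A. A \<in> sets borel \<Longrightarrow> (LINT z|circle. indicator A z * v z) = 0"
    for v :: "complex \<Rightarrow> real"
  proof -
    have [measurable]: "v \<in> borel_measurable borel" using v by auto
    let ?A = "{z. v z > 0}"
    have A: "?A \<in> sets borel" by measurable
    have "integrable circle (\<lambda>z. indicator ?A z * v z)"
      using integrable_mult_indicator[OF _ v, of ?A] A by simp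
    moreover have "AE z in circle. 0 \<le> indicator ?A z * v z"
      by (auto simp: indicator_def)
    ultimately have "AE z in circle. indicator ?A z * v z = 0"
      using vz[OF A] integral_nonneg_eq_0_iff_AE by blast
    then show ?thesis by eventually_elim (auto simp: indicator_def split: if_splits)
  qed
  have "AE z in circle. u z \<le> 0" using half[OF u z] .
  moreover have "AE z in circle. - u z \<le> 0"
    by (rule half) (use u z in auto)
  ultimately show ?thesis by eventually_elim auto
qed

lemma fourier_unique_L1:
  assumes "null_coeffs f"
  shows "AE z in circle. f z = 0"
proof -
  have fi: "integrable circle f" using assms by (simp add: null_coeffs_def)
  have int: "integrable circle (\<lambda>z. indicator A z * f z)" if "A \<in> sets borel" for A
    using that by (intro integrable_circle_indicator fi)
  have "AE z in circle. Re (f z) = 0"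
  proof (rule AE_zero_if_set_integrals_zero)
    fix A :: "complex set" assume A: "A \<in> sets borel"
    have "(LINT z|circle. indicator A z * Re (f z)) = (LINT z|circle. Re (indicator A z * f z))"
      by (intro Bochner_Integration.integral_cong) (auto simp: indicator_def)
    also have "\<dots> = Re (LINT z|circle. indicator A z * f z)"
      by (rule integral_Re[OF int[OF A]])
    finally show "(LINT z|circle. indicator A z * Re (f z)) = 0"
      using null_coeffs_set[OF assms A] by simp
  qed (use fi in simp)
  moreover have "AE z in circle. Im (f z) = 0"
  proof (rule AE_zero_if_set_integrals_zero)
    fix A :: "complex set" assume A: "A \<in> sets borel"
    have "(LINT z|circle. indicator A z * Im (f z)) = (LINT z|circle. Im (indicator A z * f z))"
      by (intro Bochner_Integration.integral_cong) (auto simp: indicator_def)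
    also have "\<dots> = Im (LINT z|circle. indicator A z * f z)"
      by (rule integral_Im[OF int[OF A]])
    finally show "(LINT z|circle. indicator A z * Im (f z)) = 0"
      using null_coeffs_set[OF assms A] by simp
  qed (use fi in simp)
  ultimately show ?thesis by eventually_elim (simp add: complex_eq_iff)
qed

subsection \<open>The Hilbert space \<open>L2\<close>\<close>

lemma borel_measurable_circle [simp]: "borel_measurable circle = borel_measurable borel"
  by (rule measurable_cong_sets) auto

definition cip :: "complex^'n \<Rightarrow> complex^'n \<Rightarrow> complex" where
  "cip v w = (\<Sum>i\<in>UNIV. v $ i * cnj (w $ i))"

lemma L2_inner_cip: "L2_inner f g = (LINT z|circle. cip (f z) (g z))"
  by (simp add: L2_inner_def cip_def)

lemma norm_vec_sq: "(norm (v :: complex^'n))\<^sup>2 = (\<Sum>i\<in>UNIV. (norm (v $ i))\<^sup>2)"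
  by (simp add: norm_vec_def L2_set_def sum_nonneg)

lemma cip_self: "cip v v = of_real ((norm v)\<^sup>2)"
  by (simp add: cip_def norm_vec_sq complex_norm_square del: of_real_power)

lemma cip_add_left: "cip (u + v) w = cip u w + cip v w"
  by (simp add: cip_def distrib_right sum.distrib)
lemma cip_add_right: "cip u (v + w) = cip u v + cip u w"
  by (simp add: cip_def distrib_left sum.distrib)
lemma cip_diff_left: "cip (u - v) w = cip u w - cip v w"
  by (simp add: cip_def left_diff_distrib sum_subtractf)
lemma cip_diff_right: "cip u (v - w) = cip u v - cip u w"
  by (simp add: cip_def right_diff_distrib sum_subtractf)
lemma cip_scale_left: "cip (c *s u) w = c * cip u w"
  by (simp add: cip_def sum_distrib_left mult_ac)
lemma cip_scale_right: "cip u (c *s w) = cnj c * cip u w"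
  by (simp add: cip_def sum_distrib_left mult_ac)
lemma cip_cnj: "cnj (cip u v) = cip v u"
  by (simp add: cip_def mult_ac)
lemma cip_zero [simp]: "cip 0 v = 0" "cip v 0 = 0"
  by (simp_all add: cip_def)

lemmas cip_simps = cip_add_left cip_add_right cip_diff_left cip_diff_right cip_scale_left cip_scale_right

lemma cip_matrix_left: "cip (A *v u) w = cip u (conj_transpose A *v w)"
proof -
  have "cip (A *v u) w = (\<Sum>i\<in>UNIV. \<Sum>j\<in>UNIV. A $ i $ j * u $ j * cnj (w $ i))"
    by (simp add: cip_def matrix_vector_mult_def sum_distrib_right)
  also have "\<dots> = (\<Sum>j\<in>UNIV. \<Sum>i\<in>UNIV. A $ i $ j * u $ j * cnj (w $ i))"
    by (rule sum.swap)
  also have "\<dots> = cip u (conj_transpose A *v w)"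
    by (simp add: cip_def matrix_vector_mult_def conj_transpose_def sum_distrib_left mult_ac)
  finally show ?thesis .
qed

lemma conj_transpose_conj_transpose [simp]: "conj_transpose (conj_transpose A) = A"
  by (simp add: conj_transpose_def vec_eq_iff)

text \<open>The arithmetic-geometric mean inequality in each component. The right-hand side is
  integrable for square integrable arguments, which yields integrability of pairings.\<close>

lemma norm_cip_le: "norm (cip v w) \<le> ((norm v)\<^sup>2 + (norm w)\<^sup>2) / 2"
proof -
  have "norm (cip v w) \<le> (\<Sum>i\<in>UNIV. norm (v $ i) * norm (w $ i))"
    unfolding cip_def by (rule order.trans[OF norm_sum]) (simp add: norm_mult)
  also have "\<dots> \<le> (\<Sum>i\<in>UNIV. ((norm (v $ i))\<^sup>2 + (norm (w $ i))\<^sup>2) / 2)"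
  proof (rule sum_mono)
    fix i
    show "norm (v $ i) * norm (w $ i) \<le> ((norm (v $ i))\<^sup>2 + (norm (w $ i))\<^sup>2) / 2"
      using sum_squares_bound[of "norm (v $ i)" "norm (w $ i)"] by simp
  qed
  also have "\<dots> = ((norm v)\<^sup>2 + (norm w)\<^sup>2) / 2"
    by (simp add: norm_vec_sq sum.distrib sum_divide_distrib[symmetric])
  finally show ?thesis .
qed

lemma norm_add_scale_sq:
  "(norm (v + c *s w))\<^sup>2 = (norm v)\<^sup>2 + 2 * Re (c * cip w v) + (norm c)\<^sup>2 * (norm (w::complex^'n))\<^sup>2"
proof -
  have "complex_of_real ((norm (v + c *s w))\<^sup>2) = cip (v + c *s w) (v + c *s w)"
    by (simp only: cip_self)
  also have "\<dots> = cip v v + (c * cip w v + cnj (c * cip w v)) + c * cnj c * cip w w"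
    by (simp add: cip_simps cip_cnj algebra_simps)
  also have "\<dots> = complex_of_real ((norm v)\<^sup>2 + 2 * Re (c * cip w v) + (norm c)\<^sup>2 * (norm w)\<^sup>2)"
    by (simp only: cip_self complex_add_cnj complex_norm_square of_real_add of_real_mult of_real_numeral)
  finally show ?thesis by (simp only: of_real_eq_iff)
qed

lemma measurable_vec_iff:
  "(f :: complex \<Rightarrow> complex^'n) \<in> borel_measurable M \<longleftrightarrow> (\<forall>i. (\<lambda>z. f z $ i) \<in> borel_measurable M)"
proof safe
  fix i assume [measurable]: "f \<in> borel_measurable M"
  have "(\<lambda>v::complex^'n. v $ i) \<in> borel_measurable borel"
    by (intro borel_measurable_continuous_onI continuous_intros)
  from measurable_compose[OF _ this, of f M] show "(\<lambda>z. f z $ i) \<in> borel_measurable M" by simp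
next
  assume a: "\<forall>i. (\<lambda>z. f z $ i) \<in> borel_measurable M"
  have "(\<lambda>c::complex. axis i c :: complex^'n) \<in> borel_measurable borel" for i
    unfolding axis_def
  proof (intro borel_measurable_continuous_onI continuous_on_vec_lambda)
    fix j show "continuous_on UNIV (\<lambda>c::complex. if j = i then c else 0)"
      by (cases "j = i") auto
  qed
  then have "(\<lambda>z. \<Sum>i\<in>UNIV. axis i (f z $ i) :: complex^'n) \<in> borel_measurable M"
    using a by (intro borel_measurable_sum) (auto intro: measurable_compose)
  moreover have "(\<Sum>i\<in>UNIV. axis i (f z $ i)) = f z" for z
    by (simp add: vec_eq_iff axis_def if_distrib cong: if_cong)
  ultimately show "f \<in> borel_measurable M" by simp
qed

lemma measurable_vec_nth [measurable (raw)]: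
  "(f :: complex \<Rightarrow> complex^'n) \<in> borel_measurable M \<Longrightarrow> (\<lambda>z. f z $ i) \<in> borel_measurable M"
  using measurable_vec_iff by blast

lemma measurable_vector_smult [measurable (raw)]:
  fixes c :: "complex \<Rightarrow> complex" and f :: "complex \<Rightarrow> complex^'n"
  shows "c \<in> borel_measurable M \<Longrightarrow> f \<in> borel_measurable M \<Longrightarrow> (\<lambda>z. c z *s f z) \<in> borel_measurable M"
  unfolding measurable_vec_iff by (auto intro!: borel_measurable_times)

lemma measurable_cnj [measurable (raw)]:
  "f \<in> borel_measurable M \<Longrightarrow> (\<lambda>z. cnj (f z)) \<in> borel_measurable M"
  by (rule measurable_compose[of f M borel]) (auto intro!: borel_measurable_continuous_onI continuous_intros)

lemma measurable_cip [measurable (raw)]: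
  fixes f g :: "complex \<Rightarrow> complex^'n"
  shows "f \<in> borel_measurable M \<Longrightarrow> g \<in> borel_measurable M \<Longrightarrow> (\<lambda>z. cip (f z) (g z)) \<in> borel_measurable M"
  unfolding cip_def
  by (auto simp: measurable_vec_iff intro!: borel_measurable_sum borel_measurable_times measurable_cnj)

abbreviation L2_sq :: "(complex \<Rightarrow> complex^'n) \<Rightarrow> real" where
  "L2_sq f \<equiv> (LINT z|circle. (norm (f z))\<^sup>2)"

lemma L2_norm_sq: "(L2_norm f)\<^sup>2 = L2_sq f"
  by (simp add: L2_norm_def)

lemma L2_norm_nonneg [simp]: "L2_norm f \<ge> 0"
  by (simp add: L2_norm_def)

lemma L2_inner_self: "L2_inner f f = of_real (L2_sq f)"
  by (simp only: L2_inner_cip cip_self integral_complex_of_real)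

lemma L2_measurable: "f \<in> L2 \<Longrightarrow> f \<in> borel_measurable borel"
  by (simp add: L2_def)

lemma L2_integrable_sq: "f \<in> L2 \<Longrightarrow> integrable circle (\<lambda>z. (norm (f z))\<^sup>2)"
  by (simp add: L2_def)

lemma L2I_bound:
  fixes f :: "complex \<Rightarrow> complex^'n"
  assumes "f \<in> borel_measurable borel" "integrable circle h" "AE z in circle. (norm (f z))\<^sup>2 \<le> h z"
  shows "f \<in> L2"
proof -
  have [measurable]: "f \<in> borel_measurable borel" by fact
  have "integrable circle (\<lambda>z. (norm (f z))\<^sup>2)"
  proof (rule Bochner_Integration.integrable_bound[OF assms(2)])
    show "AE z in circle. norm ((norm (f z))\<^sup>2) \<le> norm (h z)"
      using assms(3) by eventually_elim auto
  qed measurable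
  then show ?thesis by (simp add: L2_def)
qed

lemma L2_cong_AE:
  "f \<in> L2 \<Longrightarrow> g \<in> borel_measurable borel \<Longrightarrow> AE z in circle. f z = g z \<Longrightarrow> g \<in> L2"
  by (rule L2I_bound[OF _ L2_integrable_sq]) auto

lemma L2_add: 
  assumes "f \<in> L2" "g \<in> L2" shows "(\<lambda>z. f z + g z) \<in> L2"
proof (rule L2I_bound)
  show "integrable circle (\<lambda>z. 2 * (norm (f z))\<^sup>2 + 2 * (norm (g z))\<^sup>2)"
    using assms by (auto simp: L2_integrable_sq)
  have "(norm (u + v))\<^sup>2 \<le> 2 * (norm u)\<^sup>2 + 2 * (norm v)\<^sup>2" for u v :: "complex^'a"
  proof -
    have "(norm (u + v))\<^sup>2 \<le> (norm u + norm v)\<^sup>2"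
      by (intro power_mono norm_triangle_ineq) auto
    also have "\<dots> \<le> 2 * (norm u)\<^sup>2 + 2 * (norm v)\<^sup>2"
      using sum_squares_bound[of "norm u" "norm v"] by (simp add: power2_sum)
    finally show ?thesis .
  qed
  then show "AE z in circle. (norm (f z + g z))\<^sup>2 \<le> 2 * (norm (f z))\<^sup>2 + 2 * (norm (g z))\<^sup>2"
    by simp
qed (intro borel_measurable_add L2_measurable assms)

lemma L2_zero [simp]: "(\<lambda>z. 0) \<in> L2"
  by (simp add: L2_def)

lemma norm_vector_smult: "norm (c *s (v :: complex^'n)) = norm c * norm v"
proof -
  have "(norm (c *s v))\<^sup>2 = (norm c * norm v)\<^sup>2"
    by (simp add: norm_vec_sq norm_mult power_mult_distrib sum_distrib_left)
  then show ?thesis by (simp add: power2_eq_iff_nonneg)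
qed

lemma L2_scale: "f \<in> L2 \<Longrightarrow> (\<lambda>z. c *s f z) \<in> L2"
  by (rule L2I_bound[where h = "\<lambda>z. (norm c)\<^sup>2 * (norm (f z))\<^sup>2"])
    (auto simp: L2_integrable_sq norm_vector_smult power_mult_distrib
      intro: measurable_vector_smult L2_measurable)

lemma L2_diff:
  assumes "f \<in> L2" "g \<in> L2" shows "(\<lambda>z. f z - g z) \<in> L2"
  using L2_add[OF assms(1) L2_scale[OF assms(2), of "-1"]] by (simp flip: vector_sneg_minus1)

lemma L2_sum: "finite A \<Longrightarrow> (\<And>i. i \<in> A \<Longrightarrow> f i \<in> L2) \<Longrightarrow> (\<lambda>z. \<Sum>i\<in>A. f i z) \<in> L2"
  by (induction A rule: finite_induct) (auto intro: L2_add)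

lemma L2_cip_integrable:
  assumes "f \<in> L2" "g \<in> L2" shows "integrable circle (\<lambda>z. cip (f z) (g z))"
proof (rule Bochner_Integration.integrable_bound)
  show "integrable circle (\<lambda>z. ((norm (f z))\<^sup>2 + (norm (g z))\<^sup>2) / 2)"
    using assms by (auto simp: L2_integrable_sq)
  show "AE z in circle. norm (cip (f z) (g z)) \<le> norm (((norm (f z))\<^sup>2 + (norm (g z))\<^sup>2) / 2)"
    using norm_cip_le by (auto intro: order.trans)
qed (use assms L2_measurable in measurable)

lemma L2_inner_add_left: "f \<in> L2 \<Longrightarrow> g \<in> L2 \<Longrightarrow> h \<in> L2 \<Longrightarrow>
  L2_inner (\<lambda>z. f z + g z) h = L2_inner f h + L2_inner g h"
  by (simp add: L2_inner_cip cip_add_left L2_cip_integrable)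
lemma L2_inner_diff_left: "f \<in> L2 \<Longrightarrow> g \<in> L2 \<Longrightarrow> h \<in> L2 \<Longrightarrow>
  L2_inner (\<lambda>z. f z - g z) h = L2_inner f h - L2_inner g h"
  by (simp add: L2_inner_cip cip_diff_left L2_cip_integrable)
lemma L2_inner_diff_right: "f \<in> L2 \<Longrightarrow> g \<in> L2 \<Longrightarrow> h \<in> L2 \<Longrightarrow>
  L2_inner h (\<lambda>z. f z - g z) = L2_inner h f - L2_inner h g"
  by (simp add: L2_inner_cip cip_diff_right L2_cip_integrable)
lemma L2_inner_scale_left: "f \<in> L2 \<Longrightarrow> h \<in> L2 \<Longrightarrow> L2_inner (\<lambda>z. c *s f z) h = c * L2_inner f h"
  by (simp add: L2_inner_cip cip_scale_left)
lemma L2_inner_cnj: "cnj (L2_inner f g) = L2_inner g f"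
  unfolding L2_inner_cip Bochner_Integration.integral_cnj[symmetric] by (simp add: cip_cnj)

lemma L2_inner_cong_AE:
  assumes "f \<in> L2" "f' \<in> L2" "g \<in> L2" "g' \<in> L2"
    "AE z in circle. f z = f' z" "AE z in circle. g z = g' z"
  shows "L2_inner f g = L2_inner f' g'"
  unfolding L2_inner_cip
proof (rule integral_cong_AE)
  show "AE z in circle. cip (f z) (g z) = cip (f' z) (g' z)"
    using assms(5,6) by eventually_elim simp
qed (use assms L2_measurable in measurable)

lemma L2_sq_expand:
  assumes "f \<in> L2" "g \<in> L2"
  shows "L2_sq (\<lambda>z. f z + c *s g z) = L2_sq f + 2 * Re (c * L2_inner g f) + (norm c)\<^sup>2 * L2_sq g"
proof -
  have i: "integrable circle (\<lambda>z. c * cip (g z) (f z))"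
    using assms by (simp add: L2_cip_integrable)
  have "(LINT z|circle. Re (c * cip (g z) (f z))) = Re (c * L2_inner g f)"
    unfolding L2_inner_cip using i by (subst integral_Re) auto
  moreover have "integrable circle (\<lambda>z. Re (c * cip (g z) (f z)))"
    by (rule integrable_Re[OF i])
  ultimately show ?thesis
    using assms unfolding norm_add_scale_sq
    by (simp add: L2_integrable_sq del: times_complex.sel)
qed

text \<open>The discriminant argument, stated once for three uses: Cauchy-Schwarz, orthogonality in
  the projection theorem, and kernels of positive forms, where \<open>A\<close> is 0.\<close>

lemma complex_quadratic_nonneg_imp:
  assumes "\<And>t::complex. 0 \<le> A + 2 * Re (t * c) + (norm t)\<^sup>2 * B" "B \<ge> 0"
  shows "(norm c)\<^sup>2 \<le> A * B"
proof -
  \<comment> \<open>The choice of \<open>t\<close> as \<open>- s\<close> times the conjugate of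
    \<open>c\<close> makes the linear term real.\<close>
  have s: "0 \<le> A - 2 * s * (norm c)\<^sup>2 + s\<^sup>2 * (norm c)\<^sup>2 * B" for s :: real
  proof -
    have "- of_real s * cnj c * c = of_real (- s * (norm c)\<^sup>2)"
      unfolding of_real_mult complex_norm_square by simp
    then have "Re (- of_real s * cnj c * c) = - s * (norm c)\<^sup>2"
      by (simp only: Re_complex_of_real)
    moreover have "(norm (- of_real s * cnj c))\<^sup>2 = s\<^sup>2 * (norm c)\<^sup>2"
      by (simp add: norm_mult power_mult_distrib)
    ultimately show ?thesis using assms(1)[of "- of_real s * cnj c"] by simp
  qed
  show ?thesis
  proof (cases "B = 0")
    case True
    have "(norm c)\<^sup>2 = 0"
    proof (rule ccontr)
      assume "(norm c)\<^sup>2 \<noteq> 0"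
      \<comment> \<open>With \<open>B = 0\<close> the expression is affine in \<open>s\<close>; this
        value of \<open>s\<close> makes it -1.\<close>
      then show False using s[of "(A + 1) / (2 * (norm c)\<^sup>2)"] True by simp
    qed
    then show ?thesis using True by simp
  next
    case False
    then have "B > 0" using assms by simp
    then have "0 \<le> A - (norm c)\<^sup>2 / B"
      using s[of "1 / B"] by (simp add: power2_eq_square field_simps)
    then show ?thesis using \<open>B > 0\<close> by (simp add: field_simps)
  qed
qed

lemma L2_Cauchy_Schwarz_sq:
  assumes "f \<in> L2" "g \<in> L2" shows "(norm (L2_inner f g))\<^sup>2 \<le> L2_sq f * L2_sq g"
proof -
  have "(norm (L2_inner g f))\<^sup>2 \<le> L2_sq f * L2_sq g"
  proof (rule complex_quadratic_nonneg_imp)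
    fix t
    show "0 \<le> L2_sq f + 2 * Re (t * L2_inner g f) + (norm t)\<^sup>2 * L2_sq g"
      unfolding L2_sq_expand[OF assms, symmetric] by simp
  qed simp
  moreover have "norm (L2_inner g f) = norm (L2_inner f g)"
    by (metis L2_inner_cnj complex_mod_cnj)
  ultimately show ?thesis by simp
qed

lemma L2_zero_iff:
  assumes "f \<in> L2" shows "L2_sq f = 0 \<longleftrightarrow> (AE z in circle. f z = 0)"
  using integral_nonneg_eq_0_iff_AE[OF L2_integrable_sq[OF assms]] by simp

section \<open>Completeness and orthogonal projections\<close>

lemma L2_parallelogram:
  assumes "f \<in> L2" "g \<in> L2"
  shows "L2_sq (\<lambda>z. f z - g z) = 2 * L2_sq f + 2 * L2_sq g - 4 * L2_sq (\<lambda>z. (1/2) *s (f z + g z))"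
proof -
  have 1: "L2_sq (\<lambda>z. f z + 1 *s g z) = L2_sq f + 2 * Re (1 * L2_inner g f) + (norm (1::complex))\<^sup>2 * L2_sq g"
    by (rule L2_sq_expand[OF assms])
  have 2: "L2_sq (\<lambda>z. f z + (-1) *s g z) = L2_sq f + 2 * Re (-1 * L2_inner g f) + (norm (-1::complex))\<^sup>2 * L2_sq g"
    by (rule L2_sq_expand[OF assms])
  have 3: "L2_sq (\<lambda>z. (1/2) *s (f z + g z)) = L2_sq (\<lambda>z. f z + g z) / 4"
    by (simp add: norm_vector_smult power_mult_distrib power_divide del: vector_add_ldistrib)
  have "f z + (-1) *s g z = f z - g z" for z
    by (simp add: vec_eq_iff)
  then show ?thesis using 1 2 3 by simp
qed

text \<open>The geometric rate is assumed instead of a general Cauchy condition: it makes the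
  integrals of successive increments summable, so the sequence converges almost everywhere, and
  Fatou's lemma returns the same rate for the limit.\<close>

lemma L2_complete:
  fixes x :: "nat \<Rightarrow> complex \<Rightarrow> complex^'n"
  assumes x: "\<And>n. x n \<in> L2" and cauchy: "\<And>m n. m \<le> n \<Longrightarrow> L2_sq (\<lambda>z. x m z - x n z) \<le> C * (1/4) ^ m"
  obtains f where "f \<in> L2" "\<And>m. L2_sq (\<lambda>z. x m z - f z) \<le> C * (1/4) ^ m"
proof -
  have xm [measurable]: "x n \<in> borel_measurable borel" for n using x by (simp add: L2_measurable)
  have "L2_sq (\<lambda>z. x 0 z - x 0 z) \<le> C * (1/4) ^ 0" by (rule cauchy) simp
  then have C: "C \<ge> 0" by simp
  let ?d = "\<lambda>n z. norm (x (Suc n) z - x n z)"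
  have dint: "integrable circle (\<lambda>z. 2 ^ n * (?d n z)\<^sup>2 + (1/2) ^ n)" for n
    using L2_integrable_sq[OF L2_diff[OF x x]] by simp
  \<comment> \<open>From 2^n (d - 2^-n)^2 >= 0; the weight 2^n is chosen so that both terms have
    integrals of order 2^-n.\<close>
  have dle: "?d n z \<le> 2 ^ n * (?d n z)\<^sup>2 + (1/2) ^ n" for n z
  proof -
    have "2 * ?d n z \<le> 2 ^ n * (?d n z)\<^sup>2 + (1/2) ^ n"
    proof -
      have "0 \<le> 2 ^ n * (?d n z - (1/2) ^ n)\<^sup>2" by simp
      also have "\<dots> = 2 ^ n * (?d n z)\<^sup>2 - 2 * ?d n z * (2 ^ n * (1/2) ^ n) + (2 ^ n * (1/2) ^ n) * (1/2) ^ n"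
        by (simp add: power2_eq_square algebra_simps)
      also have "(2::real) ^ n * (1/2) ^ n = 1" by (simp flip: power_mult_distrib)
      finally show ?thesis by simp
    qed
    moreover have "0 \<le> ?d n z" by simp
    ultimately show ?thesis by linarith
  qed
  have "(\<integral>\<^sup>+z. ennreal (?d n z) \<partial>circle) \<le> ennreal ((C + 1) * (1/2) ^ n)" for n
  proof -
    have "(\<integral>\<^sup>+z. ennreal (?d n z) \<partial>circle) \<le> (\<integral>\<^sup>+z. ennreal (2 ^ n * (?d n z)\<^sup>2 + (1/2) ^ n) \<partial>circle)"
      by (intro nn_integral_mono ennreal_leI dle)
    also have "\<dots> = ennreal (LINT z|circle. 2 ^ n * (?d n z)\<^sup>2 + (1/2) ^ n)"
      by (rule nn_integral_eq_integral[OF dint]) auto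
    also have "(LINT z|circle. 2 ^ n * (?d n z)\<^sup>2 + (1/2) ^ n) = 2 ^ n * L2_sq (\<lambda>z. x n z - x (Suc n) z) + (1/2) ^ n"
      using L2_integrable_sq[OF L2_diff[OF x x]] by (simp add: norm_minus_commute)
    also have "\<dots> \<le> 2 ^ n * (C * (1/4) ^ n) + (1/2) ^ n"
      by (intro add_mono mult_left_mono cauchy) auto
    also have "2 ^ n * (C * (1/4) ^ n) + (1/2) ^ n = (C + 1) * (1/2) ^ n"
      by (simp add: algebra_simps flip: power_mult_distrib)
    finally show ?thesis by (simp add: ennreal_leI)
  qed
  note nn = this
  have "(\<integral>\<^sup>+z. (\<Sum>n. ennreal (?d n z)) \<partial>circle) = (\<Sum>n. \<integral>\<^sup>+z. ennreal (?d n z) \<partial>circle)"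
    by (rule nn_integral_suminf) measurable
  also have "\<dots> \<le> (\<Sum>n. ennreal ((C + 1) * (1/2) ^ n))"
    by (intro suminf_le nn) auto
  also have "\<dots> = ennreal (\<Sum>n. (C + 1) * (1/2) ^ n)"
    using C by (intro suminf_ennreal2) (auto intro!: summable_mult summable_geometric)
  also have "\<dots> < \<infinity>" by simp
  finally have "AE z in circle. (\<Sum>n. ennreal (?d n z)) \<noteq> \<infinity>"
    by (intro nn_integral_PInf_AE) auto
  then have conv: "AE z in circle. convergent (\<lambda>n. x n z)"
  proof eventually_elim
    case (elim z)
    then have "summable (\<lambda>n. ?d n z)"
      by (intro summable_suminf_not_top) auto
    then have "summable (\<lambda>n. x (Suc n) z - x n z)" by (rule summable_norm_cancel)
    then have "convergent (\<lambda>n. \<Sum>k<n. x (Suc k) z - x k z)"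
      by (simp add: summable_iff_convergent)
    moreover have "(\<lambda>n. \<Sum>k<n. x (Suc k) z - x k z) = (\<lambda>n. x n z - x 0 z)"
      by (intro ext sum_lessThan_telescope)
    ultimately have "convergent (\<lambda>n. x n z - x 0 z)" by simp
    then have "convergent (\<lambda>n. (x n z - x 0 z) + x 0 z)"
      by (intro convergent_add convergent_const)
    then show ?case by simp
  qed
  define f where "f z = lim (\<lambda>n. x n z)" for z
  have fm [measurable]: "f \<in> borel_measurable borel"
    unfolding f_def by (rule borel_measurable_lim_metric) measurable
  have sqm: "(\<lambda>z. ennreal ((norm (x m z - x n z))\<^sup>2)) \<in> borel_measurable circle" for m n
    by (intro measurable_compose[OF _ measurable_ennreal] borel_measurable_power borel_measurable_norm
        borel_measurable_diff) simp_all
  have fatou: "(\<integral>\<^sup>+z. ennreal ((norm (x m z - f z))\<^sup>2) \<partial>circle) \<le> ennreal (C * (1/4) ^ m)" for m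
  proof -
    have "(\<integral>\<^sup>+z. ennreal ((norm (x m z - f z))\<^sup>2) \<partial>circle) =
        (\<integral>\<^sup>+z. liminf (\<lambda>n. ennreal ((norm (x m z - x n z))\<^sup>2)) \<partial>circle)"
    proof (rule nn_integral_cong_AE)
      show "AE z in circle. ennreal ((norm (x m z - f z))\<^sup>2) = liminf (\<lambda>n. ennreal ((norm (x m z - x n z))\<^sup>2))"
        using conv
      proof eventually_elim
        case (elim z)
        then have "(\<lambda>n. x n z) \<longlonglongrightarrow> f z" unfolding f_def by (simp add: convergent_LIMSEQ_iff)
        then have "(\<lambda>n. ennreal ((norm (x m z - x n z))\<^sup>2)) \<longlonglongrightarrow> ennreal ((norm (x m z - f z))\<^sup>2)"
          by (intro tendsto_intros)
        then show ?case by (rule lim_imp_Liminf[OF trivial_limit_sequentially, symmetric])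
      qed
    qed
    also have "\<dots> \<le> liminf (\<lambda>n. \<integral>\<^sup>+z. ennreal ((norm (x m z - x n z))\<^sup>2) \<partial>circle)"
      by (rule nn_integral_liminf) (rule sqm)
    also have "\<dots> \<le> liminf (\<lambda>n. ennreal (C * (1/4) ^ m))"
    proof (rule Liminf_mono)
      show "\<forall>\<^sub>F n in sequentially. (\<integral>\<^sup>+z. ennreal ((norm (x m z - x n z))\<^sup>2) \<partial>circle) \<le> ennreal (C * (1/4) ^ m)"
        using eventually_ge_at_top[of m]
      proof eventually_elim
        case (elim n)
        have "(\<integral>\<^sup>+z. ennreal ((norm (x m z - x n z))\<^sup>2) \<partial>circle) = ennreal (L2_sq (\<lambda>z. x m z - x n z))"
          by (rule nn_integral_eq_integral[OF L2_integrable_sq[OF L2_diff[OF x x]]]) auto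
        then show ?case using cauchy[OF elim] by (simp add: ennreal_leI)
      qed
    qed
    finally show ?thesis by (simp add: Liminf_const)
  qed
  have int: "integrable circle (\<lambda>z. (norm (x m z - f z))\<^sup>2)" for m
    by (rule integrableI_bounded) (use fatou[of m] in \<open>auto intro: le_less_trans\<close>)
  have "(\<lambda>z. x 0 z - f z) \<in> L2"
    using int[of 0] by (simp add: L2_def)
  from L2_diff[OF x[of 0] this] have "f \<in> L2" by simp
  moreover have "L2_sq (\<lambda>z. x m z - f z) \<le> C * (1/4) ^ m" for m
  proof -
    have "ennreal (L2_sq (\<lambda>z. x m z - f z)) \<le> ennreal (C * (1/4) ^ m)"
      using fatou[of m] by (subst nn_integral_eq_integral[OF int, symmetric]) auto
    then show ?thesis using C by (simp add: ennreal_le_iff)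
  qed
  ultimately show ?thesis using that by blast
qed

text \<open>Closedness is sequential and in squared norm. Since constant sequences count, membership
  is insensitive to measurable changes on null sets (\<open>L2_subspace_cong_AE\<close>).\<close>

definition L2_subspace :: "(complex \<Rightarrow> complex^'n) set \<Rightarrow> bool" where
  "L2_subspace K \<longleftrightarrow> K \<subseteq> L2 \<and> (\<lambda>z. 0) \<in> K \<and>
    (\<forall>f\<in>K. \<forall>g\<in>K. \<forall>c. (\<lambda>z. f z + c *s g z) \<in> K) \<and>
    (\<forall>x f. (\<forall>n. x n \<in> K) \<longrightarrow> f \<in> L2 \<longrightarrow> (\<lambda>n. L2_sq (\<lambda>z. x n z - f z)) \<longlonglongrightarrow> 0 \<longrightarrow> f \<in> K)"

lemma L2_subspaceI:
  assumes "\<And>f. f \<in> K \<Longrightarrow> f \<in> L2" "(\<lambda>z. 0) \<in> K"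
    "\<And>f g c. f \<in> K \<Longrightarrow> g \<in> K \<Longrightarrow> (\<lambda>z. f z + c *s g z) \<in> K"
    "\<And>x f. (\<And>n. x n \<in> K) \<Longrightarrow> f \<in> L2 \<Longrightarrow> (\<lambda>n. L2_sq (\<lambda>z. x n z - f z)) \<longlonglongrightarrow> 0 \<Longrightarrow> f \<in> K"
  shows "L2_subspace K"
  using assms unfolding L2_subspace_def by blast

lemma L2_subspaceD:
  assumes "L2_subspace K"
  shows "f \<in> K \<Longrightarrow> f \<in> L2" "(\<lambda>z. 0) \<in> K"
    "f \<in> K \<Longrightarrow> g \<in> K \<Longrightarrow> (\<lambda>z. f z + c *s g z) \<in> K"
    "(\<And>n. x n \<in> K) \<Longrightarrow> f \<in> L2 \<Longrightarrow> (\<lambda>n. L2_sq (\<lambda>z. x n z - f z)) \<longlonglongrightarrow> 0 \<Longrightarrow> f \<in> K"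
  using assms unfolding L2_subspace_def by blast+

lemma L2_subspace_add: "L2_subspace K \<Longrightarrow> f \<in> K \<Longrightarrow> g \<in> K \<Longrightarrow> (\<lambda>z. f z + g z) \<in> K"
  using L2_subspaceD(3)[of K f g 1] by simp

lemma L2_subspace_scale: "L2_subspace K \<Longrightarrow> g \<in> K \<Longrightarrow> (\<lambda>z. c *s g z) \<in> K"
  using L2_subspaceD(3)[of K "\<lambda>z. 0" g c] L2_subspaceD(2)[of K] by simp

lemma L2_subspace_diff: "L2_subspace K \<Longrightarrow> f \<in> K \<Longrightarrow> g \<in> K \<Longrightarrow> (\<lambda>z. f z - g z) \<in> K"
  using L2_subspaceD(3)[of K f g "-1"] by (simp flip: vector_sneg_minus1)

lemma L2_subspace_cong_AE:
  assumes "L2_subspace K" "f \<in> K" "AE z in circle. f z = g z" "g \<in> borel_measurable borel"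
  shows "g \<in> K"
proof (rule L2_subspaceD(4)[OF assms(1), of "\<lambda>n. f"])
  have f: "f \<in> L2" using assms L2_subspaceD by blast
  show g: "g \<in> L2" by (rule L2_cong_AE[OF f assms(4) assms(3)])
  have "L2_sq (\<lambda>z. f z - g z) = 0"
    using assms(3) by (subst L2_zero_iff[OF L2_diff[OF f g]]) auto
  then show "(\<lambda>n. L2_sq (\<lambda>z. f z - g z)) \<longlonglongrightarrow> 0" by simp
qed (use assms in auto)

text \<open>A minimizing sequence whose excess over the infimum \<open>d\<close> is below 4^-n is
  Cauchy at the rate required by \<open>L2_complete\<close>, by the parallelogram law.\<close>

lemma L2_projection:
  assumes K: "L2_subspace K" and f: "f \<in> L2"
  obtains x where "x \<in> K" "\<And>y. y \<in> K \<Longrightarrow> L2_inner (\<lambda>z. f z - x z) y = 0"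
proof -
  define q where "q y = L2_sq (\<lambda>z. f z - y z)" for y
  define d where "d = Inf (q ` K)"
  have KL: "y \<in> L2" if "y \<in> K" for y using that K L2_subspaceD by blast
  have bdd: "bdd_below (q ` K)" by (rule bdd_belowI[of _ 0]) (auto simp: q_def)
  have dle: "d \<le> q y" if "y \<in> K" for y unfolding d_def using that bdd by (intro cINF_lower)
  have "\<exists>y\<in>K. q y < d + (1/4) ^ n" for n
  proof -
    have "K \<noteq> {}" using L2_subspaceD(2)[OF K] by auto
    moreover have "d < d + (1/4) ^ n" by simp
    ultimately show ?thesis using cInf_lessD[of "q ` K" "d + (1/4) ^ n"] unfolding d_def by auto
  qed
  then obtain x where xK: "\<And>n. x n \<in> K" and xq: "\<And>n. q (x n) < d + (1/4) ^ n"
    by metis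
  have cauchy: "L2_sq (\<lambda>z. x m z - x n z) \<le> 4 * (1/4) ^ m" if "m \<le> n" for m n
  proof -
    have "L2_sq (\<lambda>z. x m z - x n z) = L2_sq (\<lambda>z. (f z - x n z) - (f z - x m z))"
      by simp
    also have "\<dots> = 2 * q (x n) + 2 * q (x m) - 4 * L2_sq (\<lambda>z. (1/2) *s ((f z - x n z) + (f z - x m z)))"
      unfolding q_def by (rule L2_parallelogram) (intro L2_diff f KL xK)+
    also have "(\<lambda>z. (1/2) *s ((f z - x n z) + (f z - x m z))) = (\<lambda>z. f z - (1/2) *s (x n z + x m z))"
      by (simp add: fun_eq_iff vec_eq_iff field_simps)
    also have "L2_sq \<dots> = q (\<lambda>z. (1/2) *s (x n z + x m z))"
      by (simp add: q_def)
    \<comment> \<open>The midpoint of \<open>x n\<close> and \<open>x m\<close> lies in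
      \<open>K\<close>, so its value of \<open>q\<close> is at least \<open>d\<close>.\<close>
    also have "2 * q (x n) + 2 * q (x m) - 4 * q (\<lambda>z. (1/2) *s (x n z + x m z)) \<le>
        2 * (d + (1/4) ^ n) + 2 * (d + (1/4) ^ m) - 4 * d"
    proof -
      have "2 * a + 2 * b - 4 * u \<le> 2 * (d + A) + 2 * (d + B) - 4 * d"
        if "d \<le> u" "a < d + A" "b < d + B" for a b u A B :: real
        using that by argo
      then show ?thesis
        by (this) (intro dle L2_subspace_scale[OF K] L2_subspace_add[OF K] xK xq)+
    qed
    also have "\<dots> \<le> 4 * (1/4) ^ m"
      using power_decreasing[OF that, of "1/4::real"] by simp
    finally show ?thesis .
  qed
  obtain g where gL: "g \<in> L2" and g: "\<And>m. L2_sq (\<lambda>z. x m z - g z) \<le> 4 * (1/4) ^ m"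
    by (rule L2_complete[OF KL[OF xK] cauchy]) (assumption, rule that)
  have geo: "(\<lambda>m. B * (1/4) ^ m) \<longlonglongrightarrow> 0" for B :: real
    by (intro tendsto_mult_right_zero LIMSEQ_power_zero) auto
  have "g \<in> K"
  proof (rule L2_subspaceD(4)[OF K xK gL])
    show "(\<lambda>n. L2_sq (\<lambda>z. x n z - g z)) \<longlonglongrightarrow> 0"
      by (rule tendsto_sandwich[OF _ _ tendsto_const geo[of 4]]) (use g in auto)
  qed
  moreover have "L2_inner (\<lambda>z. f z - g z) y = 0" if y: "y \<in> K" for y
  proof -
    \<comment> \<open>The factor 10 is 2 * 1 + 2 * 4, from splitting \<open>f - g\<close> at
      \<open>x n\<close>: near-minimality bounds the first part, the rate of convergence the
      second.\<close>
    have bound: "(norm (L2_inner (\<lambda>z. f z - g z) y))\<^sup>2 \<le> (10 * L2_sq y) * (1/4) ^ n" for n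
    proof -
      have fx: "(\<lambda>z. f z - x n z) \<in> L2" and xg: "(\<lambda>z. x n z - g z) \<in> L2"
        by (intro L2_diff f KL xK gL)+
      have "(norm (L2_inner y (\<lambda>z. f z - x n z)))\<^sup>2 \<le> (1/4) ^ n * L2_sq y"
      proof (rule complex_quadratic_nonneg_imp)
        fix t
        \<comment> \<open>Comparing \<open>x n\<close> with its perturbation along \<open>y\<close>
          gives a nonnegative quadratic in \<open>t\<close> whose constant term is 4^-n.\<close>
        have "d \<le> q (\<lambda>z. x n z + (-t) *s y z)"
          by (intro dle L2_subspaceD(3)[OF K] xK y)
        also have "\<dots> = L2_sq (\<lambda>z. (f z - x n z) + t *s y z)"
          unfolding q_def by (intro arg_cong[where f = L2_sq]) (simp add: fun_eq_iff vec_eq_iff)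
        also have "\<dots> = q (x n) + 2 * Re (t * L2_inner y (\<lambda>z. f z - x n z)) + (norm t)\<^sup>2 * L2_sq y"
          unfolding q_def by (rule L2_sq_expand[OF fx KL[OF y]])
        finally show "0 \<le> (1/4) ^ n + 2 * Re (t * L2_inner y (\<lambda>z. f z - x n z)) + (norm t)\<^sup>2 * L2_sq y"
          using xq[of n] by linarith
      qed simp
      moreover have "norm (L2_inner y (\<lambda>z. f z - x n z)) = norm (L2_inner (\<lambda>z. f z - x n z) y)"
        by (metis L2_inner_cnj complex_mod_cnj)
      ultimately have a: "(norm (L2_inner (\<lambda>z. f z - x n z) y))\<^sup>2 \<le> (1/4) ^ n * L2_sq y" by simp
      have "(norm (L2_inner (\<lambda>z. x n z - g z) y))\<^sup>2 \<le> L2_sq (\<lambda>z. x n z - g z) * L2_sq y"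
        by (rule L2_Cauchy_Schwarz_sq[OF xg KL[OF y]])
      also have "\<dots> \<le> 4 * (1/4) ^ n * L2_sq y"
        by (intro mult_right_mono g) simp
      finally have b: "(norm (L2_inner (\<lambda>z. x n z - g z) y))\<^sup>2 \<le> 4 * (1/4) ^ n * L2_sq y" .
      have "L2_inner (\<lambda>z. f z - g z) y = L2_inner (\<lambda>z. (f z - x n z) + (x n z - g z)) y" by simp
      also have "\<dots> = L2_inner (\<lambda>z. f z - x n z) y + L2_inner (\<lambda>z. x n z - g z) y"
        by (rule L2_inner_add_left[OF fx xg KL[OF y]])
      finally have "(norm (L2_inner (\<lambda>z. f z - g z) y))\<^sup>2 \<le>
          (norm (L2_inner (\<lambda>z. f z - x n z) y) + norm (L2_inner (\<lambda>z. x n z - g z) y))\<^sup>2"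
        by (simp add: norm_triangle_ineq power_mono)
      also have "\<dots> \<le> 2 * (norm (L2_inner (\<lambda>z. f z - x n z) y))\<^sup>2 + 2 * (norm (L2_inner (\<lambda>z. x n z - g z) y))\<^sup>2"
        using sum_squares_bound[of "norm (L2_inner (\<lambda>z. f z - x n z) y)" "norm (L2_inner (\<lambda>z. x n z - g z) y)"]
        by (simp add: power2_sum)
      also have "\<dots> \<le> 2 * ((1/4) ^ n * L2_sq y) + 2 * (4 * (1/4) ^ n * L2_sq y)"
        by (intro add_mono mult_left_mono a b) simp_all
      also have "\<dots> = (10 * L2_sq y) * (1/4) ^ n" by simp
      finally show ?thesis .
    qed
    have "(norm (L2_inner (\<lambda>z. f z - g z) y))\<^sup>2 \<le> 0"
      by (rule LIMSEQ_le_const[OF geo[of "10 * L2_sq y"]]) (use bound in auto)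
    then show ?thesis by simp
  qed
  ultimately show ?thesis using that by blast
qed

subsection \<open>Hardy spaces\<close>

lemma LinfD:
  assumes "\<phi> \<in> Linf"
  shows "\<phi> \<in> borel_measurable borel" "\<exists>C\<ge>0. AE z in circle. norm (\<phi> z) \<le> C"
proof -
  obtain C where C: "AE z in circle. norm (\<phi> z) \<le> C" using assms by (auto simp: Linf_def)
  have "AE z in circle. norm (\<phi> z) \<le> max 0 C" using C by eventually_elim auto
  then show "\<exists>C\<ge>0. AE z in circle. norm (\<phi> z) \<le> C" by (intro exI[of _ "max 0 C"]) auto
qed (use assms in \<open>simp add: Linf_def\<close>)

lemma LinfI: "\<phi> \<in> borel_measurable borel \<Longrightarrow> AE z in circle. norm (\<phi> z) \<le> C \<Longrightarrow> \<phi> \<in> Linf"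
  by (auto simp: Linf_def)

lemma Linf_const [simp]: "(\<lambda>z. c) \<in> Linf"
  by (rule LinfI[of _ "norm c"]) auto

lemma Linf_add: assumes "f \<in> Linf" "g \<in> Linf" shows "(\<lambda>z. f z + g z) \<in> Linf"
proof -
  obtain C D where C: "AE z in circle. norm (f z) \<le> C" and D: "AE z in circle. norm (g z) \<le> D"
    using assms LinfD(2) by blast
  show ?thesis
  proof (rule LinfI[of _ "C + D"])
    show "AE z in circle. norm (f z + g z) \<le> C + D"
      using C D by eventually_elim (rule norm_triangle_mono)
  qed (use assms LinfD(1) in auto)
qed

lemma Linf_mult: assumes "f \<in> Linf" "g \<in> Linf" shows "(\<lambda>z. f z * g z) \<in> Linf"
proof -
  obtain C D where C: "AE z in circle. norm (f z) \<le> C" and D: "AE z in circle. norm (g z) \<le> D"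
    and "C \<ge> 0"
    using assms LinfD(2) by blast
  show ?thesis
  proof (rule LinfI[of _ "C * D"])
    show "AE z in circle. norm (f z * g z) \<le> C * D"
      using C D by eventually_elim (simp add: norm_mult mult_mono \<open>C \<ge> 0\<close>)
  qed (use assms LinfD(1) in auto)
qed

lemma Linf_cnj: "f \<in> Linf \<Longrightarrow> (\<lambda>z. cnj (f z)) \<in> Linf"
  unfolding Linf_def by (auto intro: measurable_cnj)

lemma Linf_sum: "finite A \<Longrightarrow> (\<And>i. i \<in> A \<Longrightarrow> f i \<in> Linf) \<Longrightarrow> (\<lambda>z. \<Sum>i\<in>A. f i z) \<in> Linf"
  by (induction A rule: finite_induct) (auto intro: Linf_add)

lemma Linf_cong_AE:
  assumes "f \<in> Linf" "AE z in circle. f z = g z" "g \<in> borel_measurable borel"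
  shows "g \<in> Linf"
proof -
  obtain C where "AE z in circle. norm (f z) \<le> C" using LinfD(2)[OF assms(1)] by blast
  with assms(2) have "AE z in circle. norm (g z) \<le> C" by eventually_elim simp
  then show ?thesis using assms(3) by (intro LinfI)
qed

lemma Linf_powi: "(\<lambda>z. z powi k) \<in> Linf"
  by (rule LinfI[of _ 1]) (use AE_circle_norm_powi[of k] in \<open>auto elim: eventually_mono\<close>)

lemma Linf_power: "(\<lambda>z. z ^ k) \<in> Linf"
  using Linf_powi[of "int k"] by simp

lemma L2_Linf_mult_bound:
  assumes "\<phi> \<in> Linf"
  obtains C where "\<And>f :: complex \<Rightarrow> complex^'n. f \<in> L2 \<Longrightarrow> (\<lambda>z. \<phi> z *s f z) \<in> L2 \<and> L2_sq (\<lambda>z. \<phi> z *s f z) \<le> C * L2_sq f"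
proof -
  obtain C where C: "C \<ge> 0" "AE z in circle. norm (\<phi> z) \<le> C" using LinfD(2)[OF assms] by blast
  have ae: "AE z in circle. (norm (\<phi> z *s f z))\<^sup>2 \<le> C\<^sup>2 * (norm (f z))\<^sup>2" for f :: "complex \<Rightarrow> complex^'n"
    using C(2) by eventually_elim (auto simp: norm_vector_smult power_mult_distrib intro!: mult_right_mono power_mono)
  have L: "(\<lambda>z. \<phi> z *s f z) \<in> L2" if f: "f \<in> L2" for f :: "complex \<Rightarrow> complex^'n"
    by (rule L2I_bound[OF measurable_vector_smult _ ae])
      (use LinfD(1)[OF assms] f in \<open>simp_all add: L2_measurable L2_integrable_sq\<close>)
  have "L2_sq (\<lambda>z. \<phi> z *s f z) \<le> C\<^sup>2 * L2_sq f" if f: "f \<in> L2" for f :: "complex \<Rightarrow> complex^'n"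
  proof -
    have "L2_sq (\<lambda>z. \<phi> z *s f z) \<le> (LINT z|circle. C\<^sup>2 * (norm (f z))\<^sup>2)"
      by (rule integral_mono_AE[OF _ _ ae]) (use L[OF f] f in \<open>simp_all add: L2_integrable_sq\<close>)
    then show ?thesis by simp
  qed
  with L that show ?thesis by blast
qed

lemma L2_Linf_mult: "\<phi> \<in> Linf \<Longrightarrow> f \<in> L2 \<Longrightarrow> (\<lambda>z. \<phi> z *s f z) \<in> L2"
  using L2_Linf_mult_bound by metis

lemma norm_axis_complex: "norm (axis i c :: complex^'n) = norm c"
proof -
  have "(norm (axis i c :: complex^'n))\<^sup>2 = (\<Sum>k\<in>UNIV. if k = i then (norm c)\<^sup>2 else 0)"
    unfolding norm_vec_sq by (intro sum.cong) (simp_all add: axis_def)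
  then show ?thesis by (simp add: power2_eq_iff_nonneg)
qed

lemma L2_component:
  fixes f :: "complex \<Rightarrow> complex^'n" and i :: "'m::finite"
  shows "f \<in> L2 \<Longrightarrow> (\<lambda>z. axis i (f z $ j)) \<in> L2"
proof (rule L2I_bound[OF _ L2_integrable_sq])
  assume f: "f \<in> L2"
  show "(\<lambda>z. axis i (f z $ j)) \<in> borel_measurable borel"
    using measurable_vec_nth[OF L2_measurable[OF f], of j]
    by (subst measurable_vec_iff) (auto simp: axis_def)
  show "AE z in circle. (norm (axis i (f z $ j) :: complex^'m))\<^sup>2 \<le> (norm (f z))\<^sup>2"
    by (simp add: norm_axis_complex Finite_Cartesian_Product.norm_nth_le power_mono)
qed

lemma L2_from_components:
  assumes "\<And>i. (\<lambda>z. axis i (f z $ i)) \<in> L2" shows "f \<in> L2"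
proof -
  have "(\<lambda>z. \<Sum>i\<in>UNIV. axis i (f z $ i)) \<in> L2"
    by (intro L2_sum assms) auto
  moreover have "(\<Sum>i\<in>UNIV. axis i (f z $ i)) = f z" for z
    by (simp add: vec_eq_iff axis_def if_distrib cong: if_cong)
  ultimately show ?thesis by simp
qed

lemma Linf_axis_L2: "\<phi> \<in> Linf \<Longrightarrow> (\<lambda>z. axis i (\<phi> z)) \<in> L2"
proof -
  assume "\<phi> \<in> Linf"
  then have "(\<lambda>z. \<phi> z *s axis i 1) \<in> L2"
    by (rule L2_Linf_mult) (simp add: L2_def)
  moreover have "\<phi> z *s axis i 1 = axis i (\<phi> z)" for z by (simp add: vec_eq_iff axis_def)
  ultimately show ?thesis by simp
qed

lemma L2_Linf_vec: "(\<And>i. (\<lambda>z. f z $ i) \<in> Linf) \<Longrightarrow> f \<in> L2"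
  by (rule L2_from_components) (rule Linf_axis_L2)

lemma matrix_vector_mult_axis_sum:
  "A *v v = (\<Sum>i\<in>UNIV. \<Sum>j\<in>UNIV. A $ i $ j *s axis i (v $ j))"
  by (simp add: vec_eq_iff matrix_vector_mult_def axis_def if_distrib sum.delta cong: if_cong)
    (simp add: sum.swap[of _ UNIV UNIV] if_distrib sum.delta cong: if_cong)

lemma L2_Linf_mat_mult:
  assumes "\<Phi> \<in> Linf_mat" "f \<in> L2" shows "(\<lambda>z. \<Phi> z *v f z) \<in> L2"
proof -
  have "(\<lambda>z. \<Sum>i\<in>UNIV. \<Sum>j\<in>UNIV. \<Phi> z $ i $ j *s axis i (f z $ j)) \<in> L2"
    using assms by (intro L2_sum L2_Linf_mult L2_component) (auto simp: Linf_mat_def)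
  then show ?thesis by (simp add: matrix_vector_mult_axis_sum)
qed

lemma L2_component_integrable: assumes "f \<in> L2" shows "integrable circle (\<lambda>z. f z $ i)"
proof -
  have "integrable circle (\<lambda>z. cip (f z) (axis i 1))"
    by (rule L2_cip_integrable[OF assms]) (simp add: L2_def)
  moreover have "cip v (axis i 1) = v $ i" for v by (simp add: cip_def axis_def if_distrib cong: if_cong)
  ultimately show ?thesis by simp
qed

lemma fourier_coeff_cong_AE:
  assumes "AE z in circle. f z = g z" "f \<in> borel_measurable borel" "g \<in> borel_measurable borel"
  shows "fourier_coeff f k = fourier_coeff g k"
  unfolding fourier_coeff_def
  by (rule integral_cong_AE) (use assms in auto)

lemma fourier_coeff_shift:
  assumes [measurable]: "f \<in> borel_measurable borel"
  shows "fourier_coeff (\<lambda>z. z powi j * f z) k = fourier_coeff f (k - j)"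
  unfolding fourier_coeff_def
proof (rule integral_cong_AE)
  show "AE z in circle. z powi j * f z * z powi - k = f z * z powi - (k - j)"
    using AE_circle_norm
  proof eventually_elim
    case (elim z)
    then have "z \<noteq> 0" by auto
    then show ?case by (simp add: power_int_diff power_int_minus field_simps)
  qed
qed measurable

lemma cnj_powi_circle: "norm z = 1 \<Longrightarrow> cnj z powi k = z powi (-k)"
proof -
  assume n: "norm z = 1"
  then have "z * cnj z = 1" by (simp flip: complex_norm_square)
  then have "cnj z = inverse z" by (metis inverse_unique)
  then show ?thesis by (simp add: power_int_minus power_int_inverse)
qed

lemma fourier_coeff_cnj:
  assumes [measurable]: "f \<in> borel_measurable borel"
  shows "fourier_coeff (\<lambda>z. cnj (f z)) k = cnj (fourier_coeff f (-k))"
proof -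
  have "(LINT z|circle. cnj (f z) * z powi - k) = (LINT z|circle. cnj (f z * z powi - (-k)))"
  proof (rule integral_cong_AE)
    show "AE z in circle. cnj (f z) * z powi - k = cnj (f z * z powi - (-k))"
      using AE_circle_norm by eventually_elim (simp add: cnj_powi_circle)
  qed measurable
  then show ?thesis unfolding fourier_coeff_def Bochner_Integration.integral_cnj .
qed

definition fbasis :: "int \<Rightarrow> 'n \<Rightarrow> complex \<Rightarrow> complex^'n" where
  "fbasis k i z = axis i (z powi k)"

lemma fbasis_L2 [simp]: "fbasis k i \<in> L2"
  unfolding fbasis_def by (rule Linf_axis_L2[OF Linf_powi])

lemma fourier_coeff_inner:
  assumes f: "f \<in> L2"
  shows "fourier_coeff (\<lambda>z. f z $ i) k = L2_inner f (fbasis k i)"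
  unfolding fourier_coeff_def L2_inner_cip
proof (rule integral_cong_AE)
  show "AE z in circle. f z $ i * z powi - k = cip (f z) (fbasis k i z)"
    using AE_circle_norm
    by eventually_elim (simp add: cip_def fbasis_def axis_def if_distrib cnj_powi_circle cong: if_cong)
qed (use L2_measurable[OF f] L2_measurable[OF fbasis_L2] in measurable)

lemma fourier_coeff_fbasis:
  "fourier_coeff (\<lambda>z. fbasis j i' z $ i) k = (if i = i' \<and> j = k then 1 else 0)"
proof (cases "i = i'")
  case True
  then have "fourier_coeff (\<lambda>z. fbasis j i' z $ i) k = fourier_coeff (\<lambda>z. z powi j * 1) k"
    by (simp add: fbasis_def axis_def)
  also have "\<dots> = fourier_coeff (\<lambda>z. 1) (k - j)"
    by (rule fourier_coeff_shift) simp
  finally show ?thesis using True by (simp add: fourier_coeff_def integral_circle_powi)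
qed (simp add: fourier_coeff_def fbasis_def axis_def)

lemma fourier_unique:
  assumes f: "f \<in> L2" and z: "\<And>i k. fourier_coeff (\<lambda>z. f z $ i) k = 0"
  shows "AE z in circle. f z = 0"
proof -
  have "AE z in circle. f z $ i = 0" for i
  proof (rule fourier_unique_L1)
    have "(LINT z|circle. f z $ i * z powi k) = 0" for k
      using z[of i "-k"] by (simp add: fourier_coeff_def)
    then show "null_coeffs (\<lambda>z. f z $ i)"
      using L2_component_integrable[OF f] by (simp add: null_coeffs_def)
  qed
  then have "AE z in circle. \<forall>i\<in>UNIV. f z $ i = 0"
    by (intro AE_finite_allI) auto
  then show ?thesis by eventually_elim (simp add: vec_eq_iff)
qed

lemma tendsto_L2_inner:
  assumes "\<And>n. x n \<in> L2" "f \<in> L2" "g \<in> L2" "(\<lambda>n. L2_sq (\<lambda>z. x n z - f z)) \<longlonglongrightarrow> 0"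
  shows "(\<lambda>n. L2_inner (x n) g) \<longlonglongrightarrow> L2_inner f g"
proof -
  have "(\<lambda>n. (norm (L2_inner (x n) g - L2_inner f g))\<^sup>2) \<longlonglongrightarrow> 0"
  proof (rule tendsto_sandwich[OF _ _ tendsto_const])
    show "\<forall>\<^sub>F n in sequentially. (norm (L2_inner (x n) g - L2_inner f g))\<^sup>2 \<le> L2_sq (\<lambda>z. x n z - f z) * L2_sq g"
      using L2_Cauchy_Schwarz_sq[OF L2_diff[OF assms(1,2)] assms(3)] assms
      by (simp add: L2_inner_diff_left)
    show "(\<lambda>n. L2_sq (\<lambda>z. x n z - f z) * L2_sq g) \<longlonglongrightarrow> 0"
      by (intro tendsto_mult_left_zero assms)
  qed auto
  then have "(\<lambda>n. sqrt ((norm (L2_inner (x n) g - L2_inner f g))\<^sup>2)) \<longlonglongrightarrow> sqrt 0"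
    by (rule tendsto_real_sqrt)
  then have "(\<lambda>n. norm (L2_inner (x n) g - L2_inner f g)) \<longlonglongrightarrow> 0" by simp
  then have "(\<lambda>n. L2_inner (x n) g - L2_inner f g) \<longlonglongrightarrow> 0"
    by (rule tendsto_norm_zero_cancel)
  then show ?thesis by (simp add: LIM_zero_iff)
qed

lemma L2_inner_zero_left [simp]: "L2_inner (\<lambda>z. 0) g = 0"
  by (simp add: L2_inner_cip)

lemma L2_inner_lin_left: "f \<in> L2 \<Longrightarrow> g \<in> L2 \<Longrightarrow> h \<in> L2 \<Longrightarrow>
  L2_inner (\<lambda>z. f z + c *s g z) h = L2_inner f h + c * L2_inner g h"
  by (simp add: L2_inner_add_left L2_scale L2_inner_scale_left)

lemma L2_subspace_orthogonal:
  assumes "S \<subseteq> L2"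
  shows "L2_subspace {f \<in> L2. \<forall>g\<in>S. L2_inner f g = 0}"
proof (rule L2_subspaceI)
  fix x f
  assume x: "\<And>n::nat. x n \<in> {f \<in> L2. \<forall>g\<in>S. L2_inner f g = 0}" and f: "f \<in> L2"
    and l: "(\<lambda>n. L2_sq (\<lambda>z. x n z - f z)) \<longlonglongrightarrow> 0"
  have "L2_inner f g = 0" if "g \<in> S" for g
  proof -
    have "(\<lambda>n. L2_inner (x n) g) \<longlonglongrightarrow> L2_inner f g"
      using x f l that assms by (intro tendsto_L2_inner) auto
    moreover have "(\<lambda>n. L2_inner (x n) g) = (\<lambda>n. 0)" using x that by auto
    ultimately show ?thesis by (simp add: LIMSEQ_const_iff)
  qed
  then show "f \<in> {f \<in> L2. \<forall>g\<in>S. L2_inner f g = 0}" using f by simp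
next
  fix f g c
  assume f: "f \<in> {f \<in> L2. \<forall>g\<in>S. L2_inner f g = 0}" and g: "g \<in> {f \<in> L2. \<forall>g\<in>S. L2_inner f g = 0}"
  have "L2_inner (\<lambda>z. f z + c *s g z) h = 0" if h: "h \<in> S" for h
  proof -
    have "L2_inner (\<lambda>z. f z + c *s g z) h = L2_inner f h + c * L2_inner g h"
      by (rule L2_inner_lin_left) (use f g h assms in blast)+
    then show ?thesis using f g h by simp
  qed
  moreover have "(\<lambda>z. f z + c *s g z) \<in> L2"
    by (intro L2_add L2_scale) (use f g in blast)+
  ultimately show "(\<lambda>z. f z + c *s g z) \<in> {f \<in> L2. \<forall>g\<in>S. L2_inner f g = 0}" by blast
next
  show "(\<lambda>z. 0) \<in> {f \<in> L2. \<forall>g\<in>S. L2_inner f g = 0}" by simp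
  show "f \<in> L2" if "f \<in> {f \<in> L2. \<forall>g\<in>S. L2_inner f g = 0}" for f using that by blast
qed

lemma L2_subspace_INT:
  assumes "A \<noteq> {}" and K: "\<And>a. a \<in> A \<Longrightarrow> L2_subspace (K a)"
  shows "L2_subspace (\<Inter>a\<in>A. K a)"
proof (rule L2_subspaceI)
  show "(\<lambda>z. 0) \<in> (\<Inter>a\<in>A. K a)"
    by (rule INT_I) (rule L2_subspaceD(2)[OF K])
next
  fix f assume "f \<in> (\<Inter>a\<in>A. K a)"
  moreover obtain a where "a \<in> A" using \<open>A \<noteq> {}\<close> by blast
  ultimately show "f \<in> L2" by (intro L2_subspaceD(1)[OF K[OF \<open>a \<in> A\<close>]]) simp
next
  fix f g c assume f: "f \<in> (\<Inter>a\<in>A. K a)" and g: "g \<in> (\<Inter>a\<in>A. K a)"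
  show "(\<lambda>z. f z + c *s g z) \<in> (\<Inter>a\<in>A. K a)"
  proof (rule INT_I)
    fix a assume "a \<in> A"
    then show "(\<lambda>z. f z + c *s g z) \<in> K a"
      by (intro L2_subspaceD(3)[OF K]) (use f g in simp_all)
  qed
next
  fix x f
  assume x: "\<And>n. x n \<in> (\<Inter>a\<in>A. K a)" and f: "f \<in> L2" "(\<lambda>n. L2_sq (\<lambda>z. x n z - f z)) \<longlonglongrightarrow> 0"
  show "f \<in> (\<Inter>a\<in>A. K a)"
  proof (rule INT_I)
    fix a assume "a \<in> A"
    have "x n \<in> K a" for n using x[of n] \<open>a \<in> A\<close> by simp
    then show "f \<in> K a"
      by (rule L2_subspaceD(4)[OF K[OF \<open>a \<in> A\<close>] _ f])
  qed
qed

lemma L2_subspace_preimage: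
  assumes K: "L2_subspace (K :: (complex \<Rightarrow> complex^'n) set)" and \<phi>: "\<phi> \<in> Linf"
  shows "L2_subspace {f \<in> L2. (\<lambda>z. \<phi> z *s f z) \<in> K}"
proof (rule L2_subspaceI)
  show "(\<lambda>z. 0) \<in> {f \<in> L2. (\<lambda>z. \<phi> z *s f z) \<in> K}" using L2_subspaceD(2)[OF K] by simp
  fix f g :: "complex \<Rightarrow> complex^'n" and c
  assume fg: "f \<in> {f \<in> L2. (\<lambda>z. \<phi> z *s f z) \<in> K}" "g \<in> {f \<in> L2. (\<lambda>z. \<phi> z *s f z) \<in> K}"
  then have "(\<lambda>z. \<phi> z *s f z + c *s (\<phi> z *s g z)) \<in> K" by (intro L2_subspaceD(3)[OF K]) auto
  then show "(\<lambda>z. f z + c *s g z) \<in> {f \<in> L2. (\<lambda>z. \<phi> z *s f z) \<in> K}"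
    using fg by (auto simp: mult.commute intro!: L2_add L2_scale)
next
  fix x and f :: "complex \<Rightarrow> complex^'n"
  assume x: "\<And>n::nat. x n \<in> {f \<in> L2. (\<lambda>z. \<phi> z *s f z) \<in> K}" and f: "f \<in> L2"
    and l: "(\<lambda>n. L2_sq (\<lambda>z. x n z - f z)) \<longlonglongrightarrow> 0"
  obtain C where C: "\<And>f :: complex \<Rightarrow> complex^'n. f \<in> L2 \<Longrightarrow> (\<lambda>z. \<phi> z *s f z) \<in> L2 \<and> L2_sq (\<lambda>z. \<phi> z *s f z) \<le> C * L2_sq f"
    using L2_Linf_mult_bound[OF \<phi>] by blast
  have xL: "x n \<in> L2" and xK: "(\<lambda>z. \<phi> z *s x n z) \<in> K" for n using x[of n] by simp_all
  have "(\<lambda>z. \<phi> z *s f z) \<in> K"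
  proof (rule L2_subspaceD(4)[OF K xK])
    show "(\<lambda>z. \<phi> z *s f z) \<in> L2" using C[OF f] by simp
    show "(\<lambda>n. L2_sq (\<lambda>z. \<phi> z *s x n z - \<phi> z *s f z)) \<longlonglongrightarrow> 0"
    proof (rule tendsto_sandwich[OF _ _ tendsto_const])
      show "(\<lambda>n. C * L2_sq (\<lambda>z. x n z - f z)) \<longlonglongrightarrow> 0" by (rule tendsto_mult_right_zero[OF l])
      show "\<forall>\<^sub>F n in sequentially. L2_sq (\<lambda>z. \<phi> z *s x n z - \<phi> z *s f z) \<le> C * L2_sq (\<lambda>z. x n z - f z)"
        using C[OF L2_diff[OF xL f]] by (simp add: vector_ssub_ldistrib)
    qed simp
  qed
  then show "f \<in> {f \<in> L2. (\<lambda>z. \<phi> z *s f z) \<in> K}" using f by simp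
qed simp

text \<open>Written as an annihilator, \<open>H2\<close> inherits closedness from
  \<open>L2_subspace_orthogonal\<close>.\<close>

lemma H2_eq_orthogonal: "H2 = {f \<in> L2. \<forall>g\<in>{fbasis k i | k i. k < 0}. L2_inner f g = 0}"
proof -
  have "(\<forall>i. \<forall>k<0. fourier_coeff (\<lambda>z. f z $ i) k = 0) \<longleftrightarrow>
      (\<forall>g\<in>{fbasis k i | k i. k < 0}. L2_inner f g = 0)" if "f \<in> L2" for f :: "complex \<Rightarrow> complex^'a"
    unfolding fourier_coeff_inner[OF that] by blast
  then show ?thesis unfolding H2_def by blast
qed

lemma L2_subspace_H2: "L2_subspace H2"
  unfolding H2_eq_orthogonal by (rule L2_subspace_orthogonal) auto

lemma H2_L2: "f \<in> H2 \<Longrightarrow> f \<in> L2"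
  by (simp add: H2_def)

lemmas H2_add = L2_subspace_add[OF L2_subspace_H2]
  and H2_scale = L2_subspace_scale[OF L2_subspace_H2]
  and H2_diff = L2_subspace_diff[OF L2_subspace_H2]
  and H2_zero = L2_subspaceD(2)[OF L2_subspace_H2]
  and H2_cong_AE = L2_subspace_cong_AE[OF L2_subspace_H2]

lemma H2_sum: "finite A \<Longrightarrow> (\<And>i. i \<in> A \<Longrightarrow> f i \<in> H2) \<Longrightarrow> (\<lambda>z. \<Sum>i\<in>A. f i z) \<in> H2"
  by (induction A rule: finite_induct) (auto intro: H2_add H2_zero)

lemma fbasis_H2: "k \<ge> 0 \<Longrightarrow> fbasis k i \<in> H2"
  by (auto simp: H2_def fourier_coeff_fbasis)

lemma fourier_coeff_vec_diff:
  assumes f: "f \<in> L2" and g: "g \<in> L2"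
  shows "fourier_coeff (\<lambda>z. (f z - g z) $ i) k =
    fourier_coeff (\<lambda>z. f z $ i) k - fourier_coeff (\<lambda>z. g z $ i) k"
  unfolding fourier_coeff_inner[OF f] fourier_coeff_inner[OF g] fourier_coeff_inner[OF L2_diff[OF f g]]
  by (rule L2_inner_diff_left[OF f g]) simp

text \<open>A fragment of Parseval's identity without series. Project \<open>f\<close> onto the
  functions orthogonal to \<open>g\<close> and to all basis vectors missing from \<open>f\<close>.
  The projection has the coefficients of \<open>f\<close>: the missing ones vanish, and the
  remaining basis vectors lie in the subspace itself. So \<open>f\<close> equals its projection,
  which is orthogonal to \<open>g\<close>.\<close>

lemma L2_inner_disjoint_coeffs:
  assumes f: "f \<in> L2" and g: "g \<in> L2"
    and disj: "\<And>i k. fourier_coeff (\<lambda>z. f z $ i) k = 0 \<or> fourier_coeff (\<lambda>z. g z $ i) k = 0"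
  shows "L2_inner f g = 0"
proof -
  let ?S = "insert g {fbasis k i | k i. fourier_coeff (\<lambda>z. f z $ i) k = 0}"
  define K where "K = {x \<in> L2. \<forall>y\<in>?S. L2_inner x y = 0}"
  have K: "L2_subspace K"
    unfolding K_def using g by (intro L2_subspace_orthogonal) auto
  obtain x where x: "x \<in> K" and orth: "\<And>y. y \<in> K \<Longrightarrow> L2_inner (\<lambda>z. f z - x z) y = 0"
    by (rule L2_projection[OF K f]) (rule that)
  have xL: "x \<in> L2" using x by (simp add: K_def)
  have "AE z in circle. f z - x z = 0"
  proof (rule fourier_unique[OF L2_diff[OF f xL]])
    fix i k
    show "fourier_coeff (\<lambda>z. (f z - x z) $ i) k = 0"
    proof (cases "fourier_coeff (\<lambda>z. f z $ i) k = 0")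
      case True
      then have "fbasis k i \<in> ?S" by blast
      then have "L2_inner x (fbasis k i) = 0" using x unfolding K_def by blast
      then have "fourier_coeff (\<lambda>z. x z $ i) k = 0" by (simp only: fourier_coeff_inner[OF xL])
      then show ?thesis using True by (simp only: fourier_coeff_vec_diff[OF f xL]) simp
    next
      case False
      then have gk: "fourier_coeff (\<lambda>z. g z $ i) k = 0" using disj by blast
      have "fbasis k i \<in> K"
        unfolding K_def
      proof (intro CollectI conjI ballI)
        fix y assume "y \<in> ?S"
        then consider "y = g" | j i' where "y = fbasis j i'" "fourier_coeff (\<lambda>z. f z $ i') j = 0" by blast
        then show "L2_inner (fbasis k i) y = 0"
        proof cases
          case 1
          have "L2_inner g (fbasis k i) = 0" using gk by (simp only: fourier_coeff_inner[OF g])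
          then show ?thesis using 1 by (metis L2_inner_cnj complex_cnj_zero)
        next
          case 2
          then have "\<not> (i' = i \<and> k = j)" using False by blast
          then have "fourier_coeff (\<lambda>z. fbasis k i z $ i') j = 0"
            by (simp only: fourier_coeff_fbasis if_False)
          then show ?thesis unfolding 2 fourier_coeff_inner[OF fbasis_L2] .
        qed
      qed simp
      then show ?thesis
        unfolding fourier_coeff_inner[OF L2_diff[OF f xL]] by (rule orth)
    qed
  qed
  then have ae: "AE z in circle. f z = x z" by eventually_elim simp
  have "L2_inner f g = L2_inner x g"
    by (rule L2_inner_cong_AE[OF f xL g g ae]) simp
  also have "\<dots> = 0" using x by (simp add: K_def)
  finally show ?thesis .
qed

lemma HinfD: "\<phi> \<in> Hinf \<Longrightarrow> \<phi> \<in> Linf" "\<phi> \<in> Hinf \<Longrightarrow> k < 0 \<Longrightarrow> fourier_coeff \<phi> k = 0"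
  by (auto simp: Hinf_def)

lemma Hinf_measurable: "\<phi> \<in> Hinf \<Longrightarrow> \<phi> \<in> borel_measurable borel"
  by (simp add: HinfD LinfD)

lemma fourier_coeff_axis:
  "fourier_coeff (\<lambda>z. axis j (\<phi> z) $ i) k = (if i = j then fourier_coeff \<phi> k else 0)"
  by (cases "i = j") (simp_all add: axis_def fourier_coeff_def)

text \<open>Embedding a scalar function as one component transfers closure properties from
  \<open>H2\<close> to \<open>Hinf\<close>, usually in dimension 1.\<close>

lemma Hinf_axis_iff: "\<phi> \<in> Hinf \<longleftrightarrow> \<phi> \<in> Linf \<and> (\<lambda>z. axis i (\<phi> z)) \<in> H2"
  by (auto simp: Hinf_def H2_def fourier_coeff_axis Linf_axis_L2)

lemma Hinf_axis_H2: "\<phi> \<in> Hinf \<Longrightarrow> (\<lambda>z. axis i (\<phi> z)) \<in> H2"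
  using Hinf_axis_iff by blast

text \<open>For k < 0 the k-th coefficient of a component of the product is a pairing of z^(-k)
  times that component of \<open>f\<close>, with coefficients at positive indices, and the conjugate
  of \<phi>, with coefficients at nonpositive ones.\<close>

theorem H2_Hinf_mult:
  fixes f :: "complex \<Rightarrow> complex^'n"
  assumes \<phi>: "\<phi> \<in> Hinf" and f: "f \<in> H2"
  shows "(\<lambda>z. \<phi> z *s f z) \<in> H2"
proof -
  have \<phi>L: "\<phi> \<in> Linf" and fL: "f \<in> L2" using \<phi> f by (simp_all add: HinfD H2_L2)
  have [measurable]: "\<phi> \<in> borel_measurable borel" "f \<in> borel_measurable borel"
    using \<phi>L fL by (simp_all add: LinfD L2_measurable)
  have "fourier_coeff (\<lambda>z. (\<phi> z *s f z) $ i) k = 0" if k: "k < 0" for i k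
  proof -
    let ?h = "\<lambda>z. z powi (-k) *s axis i (f z $ i) :: complex^'n" and ?g = "\<lambda>z. axis i (cnj (\<phi> z)) :: complex^'n"
    have h: "?h \<in> L2" by (intro L2_Linf_mult L2_component fL Linf_powi)
    have g: "?g \<in> L2" by (intro Linf_axis_L2 Linf_cnj \<phi>L)
    have "fourier_coeff (\<lambda>z. (\<phi> z *s f z) $ i) k = L2_inner ?h ?g"
      unfolding fourier_coeff_def L2_inner_cip
      by (intro Bochner_Integration.integral_cong)
        (simp_all add: cip_def axis_def if_distrib mult_ac cong: if_cong)
    also have "\<dots> = 0"
    proof (rule L2_inner_disjoint_coeffs[OF h g])
      fix j m
      have "fourier_coeff (\<lambda>z. ?h z $ j) m = (if j = i then fourier_coeff (\<lambda>z. z powi (-k) * f z $ i) m else 0)"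
        by (cases "j = i") (simp_all add: axis_def fourier_coeff_def)
      also have "fourier_coeff (\<lambda>z. z powi (-k) * f z $ i) m = fourier_coeff (\<lambda>z. f z $ i) (m + k)"
        using fourier_coeff_shift[of "\<lambda>z. f z $ i" "-k" m] by simp
      finally have 1: "fourier_coeff (\<lambda>z. ?h z $ j) m = 0" if "m \<le> 0"
        using f k that by (simp add: H2_def)
      have "fourier_coeff (\<lambda>z. ?g z $ j) m = (if j = i then cnj (fourier_coeff \<phi> (-m)) else 0)"
        by (simp add: fourier_coeff_axis fourier_coeff_cnj)
      then have 2: "fourier_coeff (\<lambda>z. ?g z $ j) m = 0" if "m > 0"
        using \<phi> that by (simp add: HinfD)
      show "fourier_coeff (\<lambda>z. ?h z $ j) m = 0 \<or> fourier_coeff (\<lambda>z. ?g z $ j) m = 0"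
        using 1 2 by (cases "m \<le> 0") auto
    qed
    finally show ?thesis .
  qed
  then show ?thesis using L2_Linf_mult[OF \<phi>L fL] by (simp add: H2_def)
qed

lemma Hinf_mult:
  assumes "\<phi> \<in> Hinf" "\<psi> \<in> Hinf" shows "(\<lambda>z. \<phi> z * \<psi> z) \<in> Hinf"
proof -
  have "(\<lambda>z. \<phi> z *s (axis 1 (\<psi> z) :: complex^1)) \<in> H2"
    by (intro H2_Hinf_mult Hinf_axis_H2 assms)
  moreover have "\<phi> z *s axis 1 (\<psi> z) = (axis 1 (\<phi> z * \<psi> z) :: complex^1)" for z
    by (simp add: vec_eq_iff axis_def)
  ultimately show ?thesis
    using assms by (simp add: Hinf_axis_iff[where i = "1::1"] Linf_mult)
qed

lemma Hinf_const [simp]: "(\<lambda>z. c) \<in> Hinf"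
  using integral_circle_powi by (auto simp: Hinf_def fourier_coeff_def)

lemma Hinf_add:
  assumes "\<phi> \<in> Hinf" "\<psi> \<in> Hinf" shows "(\<lambda>z. \<phi> z + \<psi> z) \<in> Hinf"
proof -
  have "(\<lambda>z. axis 1 (\<phi> z) + axis 1 (\<psi> z) :: complex^1) \<in> H2"
    by (intro H2_add Hinf_axis_H2 assms)
  moreover have "axis 1 (\<phi> z) + axis 1 (\<psi> z) = (axis 1 (\<phi> z + \<psi> z) :: complex^1)" for z
    by (simp add: vec_eq_iff axis_def)
  ultimately show ?thesis
    using assms by (simp add: Hinf_axis_iff[where i = "1::1"] Linf_add)
qed

lemma Hinf_sum: "finite A \<Longrightarrow> (\<And>i. i \<in> A \<Longrightarrow> f i \<in> Hinf) \<Longrightarrow> (\<lambda>z. \<Sum>i\<in>A. f i z) \<in> Hinf"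
  by (induction A rule: finite_induct) (auto intro: Hinf_add)

lemma Hinf_prod: "finite A \<Longrightarrow> (\<And>i. i \<in> A \<Longrightarrow> f i \<in> Hinf) \<Longrightarrow> (\<lambda>z. \<Prod>i\<in>A. f i z) \<in> Hinf"
  by (induction A rule: finite_induct) (auto intro: Hinf_mult)

lemma Hinf_power: "\<phi> \<in> Hinf \<Longrightarrow> (\<lambda>z. \<phi> z ^ k) \<in> Hinf"
  by (induction k) (auto intro: Hinf_mult)

lemma Hinf_ident: "(\<lambda>z. z) \<in> Hinf"
proof -
  have "(\<lambda>z. axis 1 z :: complex^1) \<in> H2"
    using fbasis_H2[of 1 "1::1"] by (simp add: fbasis_def[abs_def])
  then show ?thesis using Linf_power[of 1] Hinf_axis_iff[where i = "1::1"] by simp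
qed

lemma Hinf_cong_AE:
  assumes "f \<in> Hinf" "AE z in circle. f z = g z" "g \<in> borel_measurable borel"
  shows "g \<in> Hinf"
proof -
  have "fourier_coeff g k = fourier_coeff f k" for k
    using assms by (intro fourier_coeff_cong_AE[symmetric]) (auto simp: Hinf_measurable)
  then show ?thesis using assms Linf_cong_AE by (auto simp: Hinf_def)
qed

lemma Hinf_component_iff:
  assumes "\<And>i. (\<lambda>z. f z $ i) \<in> Linf"
  shows "f \<in> H2 \<longleftrightarrow> (\<forall>i. (\<lambda>z. f z $ i) \<in> Hinf)"
  using assms L2_Linf_vec[of f] by (auto simp: H2_def Hinf_def)

lemma H2_shift: "f \<in> H2 \<Longrightarrow> (\<lambda>z. z ^ k *s f z) \<in> H2"
  by (intro H2_Hinf_mult Hinf_power Hinf_ident)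

lemma H2_component: "f \<in> H2 \<Longrightarrow> (\<lambda>z. axis i (f z $ j)) \<in> H2"
  by (auto simp: H2_def fourier_coeff_axis L2_component)

lemma H2_Hinf_mat_mult:
  assumes "\<Phi> \<in> Hinf_mat" "f \<in> H2" shows "(\<lambda>z. \<Phi> z *v f z) \<in> H2"
proof -
  have "(\<lambda>z. \<Sum>i\<in>UNIV. \<Sum>j\<in>UNIV. \<Phi> z $ i $ j *s axis i (f z $ j)) \<in> H2"
    using assms by (intro H2_sum H2_Hinf_mult H2_component) (auto simp: Hinf_mat_def)
  then show ?thesis by (simp add: matrix_vector_mult_axis_sum)
qed

lemma proj_H2:
  assumes "f \<in> L2"
  shows proj_H2_in: "proj_H2 f \<in> H2"
    and proj_H2_orth: "h \<in> H2 \<Longrightarrow> L2_inner (\<lambda>z. f z - proj_H2 f z) h = 0"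
proof -
  have "\<exists>g. g \<in> H2 \<and> (\<forall>h\<in>H2. L2_inner (\<lambda>z. f z - g z) h = 0)"
    using L2_projection[OF L2_subspace_H2 assms] by metis
  from someI_ex[OF this, folded proj_H2_def]
  show "proj_H2 f \<in> H2" "h \<in> H2 \<Longrightarrow> L2_inner (\<lambda>z. f z - proj_H2 f z) h = 0" by auto
qed

subsection \<open>The Faddeev--LeVerrier recursion\<close>

definition replace_row :: "'n \<Rightarrow> 'a^'n \<Rightarrow> 'a^'n^'n \<Rightarrow> 'a^'n^'n::finite" where
  "replace_row i v M = (\<chi> k. if k = i then v else M $ k)"

definition adjugate :: "'a::comm_ring_1^'n^'n \<Rightarrow> 'a^'n^'n::finite" where
  "adjugate M = (\<chi> j i. det (replace_row i (axis j 1) M))"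

text \<open>Linearity of the determinant in row \<open>i\<close>; for \<open>v\<close> equal to that
  row of \<open>M\<close> it is Laplace's expansion.\<close>

lemma det_replace_row:
  fixes M :: "'a::comm_ring_1^'n^'n::finite"
  shows "det (replace_row i v M) = (\<Sum>j\<in>UNIV. v $ j * adjugate M $ j $ i)"
proof -
  have "v = (\<Sum>j\<in>UNIV. v $ j *s axis j 1)"
    by (simp add: vec_eq_iff axis_def if_distrib cong: if_cong)
  then have "det (replace_row i v M) =
      det (\<chi> k. if k = i then (\<Sum>j\<in>UNIV. v $ j *s axis j 1) else M $ k)"
    unfolding replace_row_def by (rule arg_cong)
  also have "\<dots> = (\<Sum>j\<in>UNIV. v $ j * det (\<chi> k. if k = i then axis j 1 else M $ k))"
    by (simp add: det_linear_row_sum[where a="\<lambda>_ j. v $ j *s axis j 1" and k=i and c="($) M"] det_row_mul)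
  finally show ?thesis by (simp add: adjugate_def replace_row_def)
qed

text \<open>Entry (l, i) is the determinant of \<open>M\<close> with row i replaced by row l, which
  has two equal rows unless l = i.\<close>

lemma mult_adjugate:
  fixes M :: "'a::comm_ring_1^'n^'n::finite"
  shows "M ** adjugate M = mat (det M)"
proof -
  have "(M ** adjugate M) $ l $ i = mat (det M) $ l $ i" for l i
  proof -
    have "(M ** adjugate M) $ l $ i = det (replace_row i (M $ l) M)"
      by (simp add: det_replace_row matrix_matrix_mult_def)
    also have "\<dots> = mat (det M) $ l $ i"
    proof (cases "l = i")
      case True
      then have "replace_row i (M $ l) M = M" by (simp add: replace_row_def vec_eq_iff)
      then show ?thesis using True by (simp add: mat_def)
    next
      case False
      then have "det (replace_row i (M $ l) M) = 0"
        by (intro det_identical_rows[of l i]) (auto simp: replace_row_def row_def)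
      then show ?thesis using False by (simp add: mat_def)
    qed
    finally show ?thesis .
  qed
  then show ?thesis by (simp add: vec_eq_iff)
qed

text \<open>The product rule in Leibniz's formula. Combined with \<open>det_replace_row\<close> it
  becomes Jacobi's formula for the derivative of a determinant.\<close>

lemma pderiv_det:
  fixes M :: "'a::idom poly^'n^'n::finite"
  shows "pderiv (det M) = (\<Sum>i\<in>UNIV. det (replace_row i (\<chi> j. pderiv (M $ i $ j)) M))"
proof -
  let ?P = "{p::'n\<Rightarrow>'n. p permutes UNIV}"
  let ?D = "\<lambda>i. \<chi> j. pderiv (M $ i $ j)"
  have prod: "(\<Prod>k\<in>UNIV. replace_row i (?D i) M $ k $ p k) =
      (\<Prod>k\<in>UNIV - {i}. M $ k $ p k) * pderiv (M $ i $ p i)" for i p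
    by (subst prod.remove[of _ i]) (auto simp: replace_row_def intro!: prod.cong)
  have "pderiv (det M) = (\<Sum>p\<in>?P. of_int (sign p) * pderiv (\<Prod>k\<in>UNIV. M $ k $ p k))"
    unfolding det_def by (simp add: higher_pderiv_sum[of 1, simplified] pderiv_mult of_int_poly pderiv_smult)
  also have "\<dots> = (\<Sum>p\<in>?P. \<Sum>i\<in>UNIV. of_int (sign p) * (\<Prod>k\<in>UNIV. replace_row i (?D i) M $ k $ p k))"
    by (simp add: prod pderiv_prod sum_distrib_left)
  also have "\<dots> = (\<Sum>i\<in>UNIV. det (replace_row i (?D i) M))"
    unfolding det_def by (rule sum.swap)
  finally show ?thesis .
qed

text \<open>\<open>fl_coeff A\<close> and \<open>fl_mat A\<close> are the coefficients, as polynomials in \<open>s\<close>, of the determinant and the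
  adjugate of \<open>1 - s A\<close>.\<close>

definition pencil :: "'a::idom^'n^'n \<Rightarrow> 'a poly^'n^'n::finite" where
  "pencil A = (\<chi> i j. [:if i = j then 1 else 0, - A $ i $ j:])"

definition fl_coeff :: "'a::idom^'n^'n \<Rightarrow> nat \<Rightarrow> 'a" where
  "fl_coeff A k = coeff (det (pencil A)) k"

definition fl_mat :: "'a::idom^'n^'n \<Rightarrow> nat \<Rightarrow> 'a^'n^'n::finite" where
  "fl_mat A k = (\<chi> i j. coeff (adjugate (pencil A) $ i $ j) k)"

lemma coeff_pencil_mult:
  "coeff ((pencil A ** M) $ i $ j) k =
     coeff (M $ i $ j) k - (\<Sum>l\<in>UNIV. case k of 0 \<Rightarrow> 0 | Suc k' \<Rightarrow> A $ i $ l * coeff (M $ l $ j) k')"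
proof -
  have "coeff ((pencil A ** M) $ i $ j) k =
      (\<Sum>l\<in>UNIV. (if i = l then coeff (M $ l $ j) k else 0) -
        (case k of 0 \<Rightarrow> 0 | Suc k' \<Rightarrow> A $ i $ l * coeff (M $ l $ j) k'))"
    unfolding matrix_matrix_mult_def pencil_def
    by (simp add: coeff_sum coeff_pCons split: nat.splits) (auto intro!: sum.cong split: nat.splits)
  then show ?thesis by (simp add: sum_subtractf)
qed

lemma coeff_pencil_adjugate:
  "coeff ((pencil A ** adjugate (pencil A)) $ i $ j) k = (if i = j then fl_coeff A k else 0)"
  by (simp add: mult_adjugate mat_def fl_coeff_def)

text \<open>Comparison of the coefficients of s^(k+1) in (1 - s A) adj(1 - s A) = det(1 - s
  A).\<close>

lemma fl_mat_Suc:
  "fl_mat A (Suc k) $ i $ j = (A ** fl_mat A k) $ i $ j + (if i = j then fl_coeff A (Suc k) else 0)"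
  using coeff_pencil_adjugate[of A i j "Suc k"] unfolding coeff_pencil_mult
  by (simp add: matrix_matrix_mult_def fl_mat_def algebra_simps split: if_splits)

lemma fl_coeff_0 [simp]: "fl_coeff (A :: 'a::idom^'n^'n::finite) 0 = 1"
proof -
  have "fl_coeff A 0 = det (mat 1 :: 'a^'n^'n)"
    unfolding fl_coeff_def det_def
    by (simp add: poly_0_coeff_0[symmetric] poly_sum poly_prod pencil_def mat_def) (simp add: of_int_poly)?
  then show ?thesis by simp
qed

lemma fl_mat_0: "fl_mat A 0 = mat 1"
  using coeff_pencil_adjugate[of A _ _ 0] unfolding coeff_pencil_mult
  by (simp add: fl_mat_def vec_eq_iff mat_def)

text \<open>Jacobi's formula for det(1 - s A); the matrix 1 - s A has derivative - A.\<close>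

lemma fl_coeff_Suc: "of_nat (Suc k) * fl_coeff A (Suc k) = - trace (A ** fl_mat A k)"
proof -
  have "of_nat (Suc k) * fl_coeff A (Suc k) = coeff (pderiv (det (pencil A))) k"
    by (simp add: coeff_pderiv fl_coeff_def)
  also have "\<dots> = (\<Sum>i\<in>UNIV. \<Sum>j\<in>UNIV. coeff (pderiv (pencil A $ i $ j) * adjugate (pencil A) $ j $ i) k)"
    by (simp add: pderiv_det det_replace_row coeff_sum)
  also have "\<dots> = - trace (A ** fl_mat A k)"
    by (simp add: pencil_def pderiv_pCons trace_def matrix_matrix_mult_def fl_mat_def sum_negf)
  finally show ?thesis .
qed

text \<open>A cofactor of the pencil has one constant row and otherwise entries of degree at most 1,
  so its degree is below \<open>CARD('n)\<close>. Together with the recursion this is the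
  Cayley-Hamilton theorem.\<close>

theorem fl_mat_CARD: "fl_mat (A :: 'a::idom^'n^'n::finite) CARD('n) = 0"
proof -
  have "degree (adjugate (pencil A) $ j $ i) < CARD('n)" for i j
  proof -
    let ?M = "replace_row i (axis j 1) (pencil A)"
    have d: "degree (?M $ k $ l) \<le> (if k = i then 0 else 1)" for k l
      by (simp add: replace_row_def axis_def pencil_def)
    have "degree (\<Prod>k\<in>UNIV. ?M $ k $ p k) \<le> CARD('n) - 1" for p
    proof -
      have "degree (\<Prod>k\<in>UNIV. ?M $ k $ p k) \<le> (\<Sum>k\<in>UNIV. degree (?M $ k $ p k))"
        by (rule order.trans[OF degree_prod_sum_le]) (auto simp: o_def)
      also have "\<dots> \<le> (\<Sum>k\<in>UNIV. if k = i then 0 else 1)"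
        by (intro sum_mono d)
      also have "\<dots> = (\<Sum>k\<in>UNIV - {i}. 1)"
        by (subst sum.remove[of _ i]) (auto intro!: sum.cong)
      finally show ?thesis by simp
    qed
    then have "degree (det ?M) \<le> CARD('n) - 1"
      unfolding det_def
      by (intro degree_sum_le) (auto intro: order.trans[OF degree_mult_le])
    moreover have "CARD('n) > 0" by simp
    ultimately have "degree (det ?M) < CARD('n)" by linarith
    then show ?thesis by (simp add: adjugate_def)
  qed
  then show ?thesis by (simp add: fl_mat_def vec_eq_iff coeff_eq_0)
qed

text \<open>The two recursions combined. In characteristic 0 the factor is nonzero for
  \<open>k < CARD('n)\<close>, so the coefficient can be recovered from the matrix.\<close>

lemma trace_fl_mat:
  fixes A :: "'a::idom^'n^'n::finite"
  shows "trace (fl_mat A k) = (of_nat CARD('n) - of_nat k) * fl_coeff A k"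
proof (cases k)
  case 0
  then show ?thesis by (simp add: fl_mat_0 trace_I)
next
  case (Suc m)
  have "trace (fl_mat A k) = trace (A ** fl_mat A m) + of_nat CARD('n) * fl_coeff A k"
    unfolding trace_def Suc fl_mat_Suc by (simp add: sum.distrib)
  also have "trace (A ** fl_mat A m) = - (of_nat k * fl_coeff A k)"
    using fl_coeff_Suc[of m A] Suc by simp
  finally show ?thesis by (simp add: algebra_simps)
qed

subsection \<open>Hyponormal Toeplitz operators\<close>

lemma conj_transpose_Linf_mat: "\<Phi> \<in> Linf_mat \<Longrightarrow> (\<lambda>z. conj_transpose (\<Phi> z)) \<in> Linf_mat"
  by (auto simp: Linf_mat_def conj_transpose_def intro: Linf_cnj)

lemma L2_inner_matrix:
  assumes "\<Phi> \<in> Linf_mat" "f \<in> L2" "g \<in> L2"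
  shows "L2_inner (\<lambda>z. \<Phi> z *v f z) g = L2_inner f (\<lambda>z. conj_transpose (\<Phi> z) *v g z)"
  by (simp add: L2_inner_cip cip_matrix_left)

lemma L2_inner_proj_H2_left:
  assumes "f \<in> L2" "g \<in> H2"
  shows "L2_inner (proj_H2 f) g = L2_inner f g"
  using proj_H2_orth[OF assms] L2_inner_diff_left[OF assms(1) H2_L2[OF proj_H2_in[OF assms(1)]] H2_L2[OF assms(2)]]
  by simp

lemma L2_inner_proj_H2_right:
  assumes "f \<in> L2" "g \<in> H2"
  shows "L2_inner g (proj_H2 f) = L2_inner g f"
  using L2_inner_proj_H2_left[OF assms] by (metis L2_inner_cnj)

lemma proj_H2_ident:
  assumes "f \<in> H2" shows "AE z in circle. proj_H2 f z = f z"
proof -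
  have f: "f \<in> L2" and p: "proj_H2 f \<in> H2" using assms by (auto simp: H2_L2 proj_H2_in)
  have "L2_inner (\<lambda>z. f z - proj_H2 f z) (\<lambda>z. f z - proj_H2 f z) = 0"
    by (intro proj_H2_orth f H2_diff assms p)
  then have "L2_sq (\<lambda>z. f z - proj_H2 f z) = 0" unfolding L2_inner_self by simp
  then have "AE z in circle. f z - proj_H2 f z = 0"
    using L2_zero_iff[OF L2_diff[OF f H2_L2[OF p]]] by blast
  then show ?thesis by eventually_elim simp
qed

lemma H2_orthogonal_unique:
  assumes x: "x \<in> H2" and y: "y \<in> H2" and eq: "\<And>h. h \<in> H2 \<Longrightarrow> L2_inner x h = L2_inner y h"
  shows "AE z in circle. x z = y z"
proof -
  have xL: "x \<in> L2" and yL: "y \<in> L2" using x y by (auto simp: H2_L2)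
  have d: "(\<lambda>z. x z - y z) \<in> H2" by (intro H2_diff x y)
  have "L2_inner (\<lambda>z. x z - y z) (\<lambda>z. x z - y z) = 0"
    using eq[OF d] by (simp only: L2_inner_diff_left[OF xL yL H2_L2[OF d]]) simp
  then have "L2_sq (\<lambda>z. x z - y z) = 0" unfolding L2_inner_self by simp
  then have "AE z in circle. x z - y z = 0"
    using L2_zero_iff[OF L2_diff[OF xL yL]] by blast
  then show ?thesis by eventually_elim simp
qed

text \<open>\<open>toeplitz\<close> and \<open>H2_adjoint\<close> involve choices of
  representatives. Pairing an operator with an explicit candidate for its adjoint avoids reasoning
  about the chosen one; linearity then follows up to null sets
  (\<open>adjoint_pair_linear\<close>).\<close>

definition adjoint_pair ::
    "((complex \<Rightarrow> complex^'n) \<Rightarrow> (complex \<Rightarrow> complex^'n)) \<Rightarrow>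
     ((complex \<Rightarrow> complex^'n) \<Rightarrow> (complex \<Rightarrow> complex^'n)) \<Rightarrow> bool" where
  "adjoint_pair A A' \<longleftrightarrow> (\<forall>f\<in>H2. A f \<in> H2) \<and> (\<forall>f\<in>H2. A' f \<in> H2) \<and>
     (\<forall>f\<in>H2. \<forall>g\<in>H2. L2_inner (A f) g = L2_inner f (A' g))"

lemma adjoint_pairD:
  assumes "adjoint_pair A A'"
  shows "f \<in> H2 \<Longrightarrow> A f \<in> H2" "f \<in> H2 \<Longrightarrow> A' f \<in> H2"
    "f \<in> H2 \<Longrightarrow> g \<in> H2 \<Longrightarrow> L2_inner (A f) g = L2_inner f (A' g)"
  using assms by (auto simp: adjoint_pair_def)

lemma adjoint_pair_sym: "adjoint_pair A A' \<Longrightarrow> adjoint_pair A' A"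
  unfolding adjoint_pair_def by (metis L2_inner_cnj)

lemma adjoint_pair_square: "adjoint_pair A A' \<Longrightarrow> adjoint_pair (A ^^ 2) (A' ^^ 2)"
  unfolding adjoint_pair_def numeral_2_eq_2 by simp

lemma toeplitz_H2: "\<Phi> \<in> Linf_mat \<Longrightarrow> f \<in> H2 \<Longrightarrow> toeplitz \<Phi> f \<in> H2"
  unfolding toeplitz_def by (intro proj_H2_in L2_Linf_mat_mult H2_L2)

lemma adjoint_pair_toeplitz:
  assumes "\<Phi> \<in> Linf_mat"
  shows "adjoint_pair (toeplitz \<Phi>) (toeplitz (\<lambda>z. conj_transpose (\<Phi> z)))"
  unfolding adjoint_pair_def
proof (intro conjI ballI)
  note ct = conj_transpose_Linf_mat[OF assms]
  fix f g :: "complex \<Rightarrow> complex^'a" assume f: "f \<in> H2" and g: "g \<in> H2"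
  have "L2_inner (toeplitz \<Phi> f) g = L2_inner (\<lambda>z. \<Phi> z *v f z) g"
    unfolding toeplitz_def by (rule L2_inner_proj_H2_left[OF L2_Linf_mat_mult[OF assms H2_L2[OF f]] g])
  also have "\<dots> = L2_inner f (\<lambda>z. conj_transpose (\<Phi> z) *v g z)"
    by (rule L2_inner_matrix[OF assms H2_L2[OF f] H2_L2[OF g]])
  also have "\<dots> = L2_inner f (toeplitz (\<lambda>z. conj_transpose (\<Phi> z)) g)"
    unfolding toeplitz_def by (rule L2_inner_proj_H2_right[OF L2_Linf_mat_mult[OF ct H2_L2[OF g]] f, symmetric])
  finally show "L2_inner (toeplitz \<Phi> f) g = L2_inner f (toeplitz (\<lambda>z. conj_transpose (\<Phi> z)) g)" .
qed (use assms conj_transpose_Linf_mat in \<open>auto intro!: toeplitz_H2\<close>)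

lemma H2_adjoint:
  assumes A: "adjoint_pair A A'" and g: "g \<in> H2"
  shows "H2_adjoint A g \<in> H2" "AE z in circle. H2_adjoint A g z = A' g z"
    "f \<in> H2 \<Longrightarrow> L2_inner (A f) g = L2_inner f (H2_adjoint A g)"
proof -
  have "\<exists>h. h \<in> H2 \<and> (\<forall>f\<in>H2. L2_inner (A f) g = L2_inner f h)"
    using A g unfolding adjoint_pair_def by blast
  from someI_ex[OF this, folded H2_adjoint_def]
  show in_H2: "H2_adjoint A g \<in> H2"
    and adj: "\<And>f. f \<in> H2 \<Longrightarrow> L2_inner (A f) g = L2_inner f (H2_adjoint A g)" by auto
  show "AE z in circle. H2_adjoint A g z = A' g z"
  proof (rule H2_orthogonal_unique[OF in_H2 adjoint_pairD(2)[OF A g]])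
    fix h :: "complex \<Rightarrow> complex^'a" assume h: "h \<in> H2"
    have "L2_inner h (H2_adjoint A g) = L2_inner h (A' g)"
      using adj[OF h] adjoint_pairD(3)[OF A h g] by simp
    then show "L2_inner (H2_adjoint A g) h = L2_inner (A' g) h" by (metis L2_inner_cnj)
  qed
qed

lemma self_commutator_inner:
  assumes A: "adjoint_pair A A'" and f: "f \<in> H2" and q: "q \<in> H2"
  shows "self_commutator A f \<in> H2"
    "L2_inner (self_commutator A f) q = L2_inner (A f) (A q) - L2_inner (A' f) (A' q)"
proof -
  let ?u = "H2_adjoint A (A f)" and ?w = "H2_adjoint A f"
  have Af: "A f \<in> H2" and Aq: "A q \<in> H2" and A'f: "A' f \<in> H2" and A'q: "A' q \<in> H2"
    using adjoint_pairD(1,2)[OF A] f q by auto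
  have u: "?u \<in> H2" and w: "?w \<in> H2" using H2_adjoint(1)[OF A] Af f by auto
  have Aw: "A ?w \<in> H2" using adjoint_pairD(1)[OF A w] .
  show "self_commutator A f \<in> H2"
    unfolding self_commutator_def by (intro H2_diff u Aw)
  have "L2_inner (self_commutator A f) q = L2_inner ?u q - L2_inner (A ?w) q"
    unfolding self_commutator_def by (rule L2_inner_diff_left[OF H2_L2[OF u] H2_L2[OF Aw] H2_L2[OF q]])
  also have "L2_inner ?u q = L2_inner (A f) (A q)"
    using H2_adjoint(3)[OF A Af q] by (metis L2_inner_cnj)
  also have "L2_inner (A ?w) q = L2_inner ?w (A' q)" by (rule adjoint_pairD(3)[OF A w q])
  also have "\<dots> = L2_inner (A' f) (A' q)"
    by (rule L2_inner_cong_AE[OF H2_L2[OF w] H2_L2[OF A'f] H2_L2[OF A'q] H2_L2[OF A'q] H2_adjoint(2)[OF A f]]) simp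
  finally show "L2_inner (self_commutator A f) q = L2_inner (A f) (A q) - L2_inner (A' f) (A' q)" .
qed

lemma H2_hyponormalD:
  assumes A: "adjoint_pair A A'" and h: "H2_hyponormal A" and f: "f \<in> H2"
  shows "L2_sq (A' f) \<le> L2_sq (A f)"
proof -
  have "L2_inner (self_commutator A f) f \<in> \<real>\<^sub>\<ge>\<^sub>0"
    using h f by (simp add: H2_hyponormal_def)
  then have "complex_of_real (L2_sq (A f) - L2_sq (A' f)) \<in> \<real>\<^sub>\<ge>\<^sub>0"
    using self_commutator_inner(2)[OF A f f] by (simp only: L2_inner_self of_real_diff)
  then show ?thesis by (simp only: nonneg_Reals_of_real_iff)
qed

lemma H2_normalI:
  assumes A: "adjoint_pair A A'"
    and eq: "\<And>f q. f \<in> H2 \<Longrightarrow> q \<in> H2 \<Longrightarrow> L2_inner (A f) (A q) = L2_inner (A' f) (A' q)"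
  shows "H2_normal A"
  unfolding H2_normal_def
proof
  fix f :: "complex \<Rightarrow> complex^'a" assume f: "f \<in> H2"
  show "AE z in circle. self_commutator A f z = 0"
  proof (rule H2_orthogonal_unique[OF self_commutator_inner(1)[OF A f f] H2_zero])
    fix h :: "complex \<Rightarrow> complex^'a" assume "h \<in> H2"
    then show "L2_inner (self_commutator A f) h = L2_inner (\<lambda>z. 0) h"
      using self_commutator_inner(2)[OF A f] eq[OF f] by simp
  qed
qed

text \<open>Both sides have the same pairing with every \<open>h\<close> in \<open>H2\<close>, since
  the adjoint moves the operator onto \<open>h\<close>.\<close>

lemma adjoint_pair_linear:
  assumes A: "adjoint_pair A A'" and f: "f \<in> H2" and g: "g \<in> H2"
  shows "AE z in circle. A (\<lambda>z. f z + c *s g z) z = A f z + c *s A g z"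
proof (rule H2_orthogonal_unique)
  have fg: "(\<lambda>z. f z + c *s g z) \<in> H2" by (intro H2_add H2_scale f g)
  show "A (\<lambda>z. f z + c *s g z) \<in> H2" by (rule adjoint_pairD(1)[OF A fg])
  have Af: "A f \<in> H2" and Ag: "A g \<in> H2" using adjoint_pairD(1)[OF A] f g by auto
  show "(\<lambda>z. A f z + c *s A g z) \<in> H2" by (intro H2_add H2_scale Af Ag)
  fix h :: "complex \<Rightarrow> complex^'a" assume h: "h \<in> H2"
  have A'h: "A' h \<in> L2" using adjoint_pairD(2)[OF A h] by (rule H2_L2)
  have "L2_inner (A (\<lambda>z. f z + c *s g z)) h = L2_inner (\<lambda>z. f z + c *s g z) (A' h)"
    by (rule adjoint_pairD(3)[OF A fg h])
  also have "\<dots> = L2_inner f (A' h) + c * L2_inner g (A' h)"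
    by (rule L2_inner_lin_left[OF H2_L2[OF f] H2_L2[OF g] A'h])
  also have "\<dots> = L2_inner (A f) h + c * L2_inner (A g) h"
    by (simp only: adjoint_pairD(3)[OF A f h] adjoint_pairD(3)[OF A g h])
  also have "\<dots> = L2_inner (\<lambda>z. A f z + c *s A g z) h"
    by (rule L2_inner_lin_left[OF H2_L2[OF Af] H2_L2[OF Ag] H2_L2[OF h], symmetric])
  finally show "L2_inner (A (\<lambda>z. f z + c *s g z)) h = L2_inner (\<lambda>z. A f z + c *s A g z) h" .
qed

lemma L2_sq_cong_AE:
  assumes "f \<in> L2" "g \<in> L2" "AE z in circle. f z = g z"
  shows "L2_sq f = L2_sq g"
proof (rule integral_cong_AE)
  show "AE z in circle. (norm (f z))\<^sup>2 = (norm (g z))\<^sup>2" using assms(3) by eventually_elim simp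
qed (use assms(1,2) in \<open>simp_all add: borel_measurable_integrable[OF L2_integrable_sq, simplified]\<close>)

text \<open>A positive form that vanishes at \<open>f\<close> has \<open>f\<close> in its kernel:
  along \<open>f + t q\<close> it is a nonnegative quadratic in \<open>t\<close> without constant
  term, so its linear coefficient is 0.\<close>

lemma H2_hyponormal_extremal:
  assumes A: "adjoint_pair A A'" and h: "H2_hyponormal A" and f: "f \<in> H2"
    and extr: "L2_sq (A f) = L2_sq (A' f)" and q: "q \<in> H2"
  shows "L2_inner (A q) (A f) = L2_inner (A' q) (A' f)"
proof -
  note A' = adjoint_pair_sym[OF A]
  have Af: "A f \<in> L2" and Aq: "A q \<in> L2" and A'f: "A' f \<in> L2" and A'q: "A' q \<in> L2"
    using adjoint_pairD(1,2)[OF A] f q by (auto intro: H2_L2)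
  let ?c = "L2_inner (A q) (A f) - L2_inner (A' q) (A' f)"
  have "(norm ?c)\<^sup>2 \<le> 0 * (L2_sq (A q) - L2_sq (A' q))"
  proof (rule complex_quadratic_nonneg_imp)
    fix t
    have fq: "(\<lambda>z. f z + t *s q z) \<in> H2" by (intro H2_add H2_scale f q)
    have "L2_sq (A (\<lambda>z. f z + t *s q z)) = L2_sq (\<lambda>z. A f z + t *s A q z)"
      by (rule L2_sq_cong_AE[OF H2_L2[OF adjoint_pairD(1)[OF A fq]] L2_add[OF Af L2_scale[OF Aq]] adjoint_pair_linear[OF A f q]])
    also have "\<dots> = L2_sq (A f) + 2 * Re (t * L2_inner (A q) (A f)) + (norm t)\<^sup>2 * L2_sq (A q)"
      by (rule L2_sq_expand[OF Af Aq])
    finally have 1: "L2_sq (A (\<lambda>z. f z + t *s q z)) =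
      L2_sq (A f) + 2 * Re (t * L2_inner (A q) (A f)) + (norm t)\<^sup>2 * L2_sq (A q)" .
    have "L2_sq (A' (\<lambda>z. f z + t *s q z)) = L2_sq (\<lambda>z. A' f z + t *s A' q z)"
      by (rule L2_sq_cong_AE[OF H2_L2[OF adjoint_pairD(1)[OF A' fq]] L2_add[OF A'f L2_scale[OF A'q]] adjoint_pair_linear[OF A' f q]])
    also have "\<dots> = L2_sq (A' f) + 2 * Re (t * L2_inner (A' q) (A' f)) + (norm t)\<^sup>2 * L2_sq (A' q)"
      by (rule L2_sq_expand[OF A'f A'q])
    finally have 2: "L2_sq (A' (\<lambda>z. f z + t *s q z)) =
      L2_sq (A' f) + 2 * Re (t * L2_inner (A' q) (A' f)) + (norm t)\<^sup>2 * L2_sq (A' q)" .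
    have "L2_sq (A' (\<lambda>z. f z + t *s q z)) \<le> L2_sq (A (\<lambda>z. f z + t *s q z))"
      by (rule H2_hyponormalD[OF A h fq])
    then have "0 \<le> (2 * Re (t * L2_inner (A q) (A f)) - 2 * Re (t * L2_inner (A' q) (A' f))) +
        ((norm t)\<^sup>2 * L2_sq (A q) - (norm t)\<^sup>2 * L2_sq (A' q))"
      unfolding 1 2 extr by linarith
    also have "\<dots> = 0 + 2 * Re (t * ?c) + (norm t)\<^sup>2 * (L2_sq (A q) - L2_sq (A' q))"
      by (simp add: right_diff_distrib)
    finally show "0 \<le> 0 + 2 * Re (t * ?c) + (norm t)\<^sup>2 * (L2_sq (A q) - L2_sq (A' q))" .
  next
    show "0 \<le> L2_sq (A q) - L2_sq (A' q)" using H2_hyponormalD[OF A h q] by simp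
  qed
  then show ?thesis by simp
qed

section \<open>From \<open>H2\<close> to \<open>L2\<close>: pointwise normality of the
  symbol\<close>

lemma L2_sq_add_le:
  assumes "f \<in> L2" "g \<in> L2" shows "L2_sq (\<lambda>z. f z + g z) \<le> 2 * L2_sq f + 2 * L2_sq g"
proof -
  have e1: "L2_sq (\<lambda>z. f z - (-1) *s g z) = 2 * L2_sq f + 2 * L2_sq (\<lambda>z. (-1) *s g z) -
      4 * L2_sq (\<lambda>z. (1/2) *s (f z + (-1) *s g z))"
    by (rule L2_parallelogram[OF assms(1) L2_scale[OF assms(2)]])
  have e2: "L2_sq (\<lambda>z. (-1) *s g z) = L2_sq g" by (simp add: norm_vector_smult)
  have e3: "f z - (-1) *s g z = f z + g z" for z by (simp add: vec_eq_iff)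
  have "0 \<le> L2_sq (\<lambda>z. (1/2) *s (f z + (-1) *s g z))" by simp
  then show ?thesis using e1 unfolding e2 e3 by argo
qed

text \<open>The union of the spaces z^-N \<open>H2\<close>. It is dense in \<open>L2\<close>, and a
  power of z, unimodular on the circle, moves each member into \<open>H2\<close>, where
  hyponormality applies.\<close>

definition trig_H2 :: "(complex \<Rightarrow> complex^'n) set" where
  "trig_H2 = {f \<in> L2. \<exists>N. (\<lambda>z. z ^ N *s f z) \<in> H2}"

lemma trig_H2_mono: "(\<lambda>z. z ^ N *s f z) \<in> H2 \<Longrightarrow> N \<le> M \<Longrightarrow> (\<lambda>z. z ^ M *s f z) \<in> H2"
  using H2_shift[of "\<lambda>z. z ^ N *s f z" "M - N"] by (simp flip: power_add)

lemma trig_H2_lin: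
  assumes "f \<in> trig_H2" "g \<in> trig_H2" shows "(\<lambda>z. f z + c *s g z) \<in> trig_H2"
proof -
  obtain N M where N: "(\<lambda>z. z ^ N *s f z) \<in> H2" and M: "(\<lambda>z. z ^ M *s g z) \<in> H2"
    and L: "f \<in> L2" "g \<in> L2"
    using assms by (auto simp: trig_H2_def)
  have "(\<lambda>z. z ^ max N M *s f z + c *s (z ^ max N M *s g z)) \<in> H2"
    by (intro H2_add H2_scale) (rule trig_H2_mono[OF N] trig_H2_mono[OF M], simp)+
  then have "(\<lambda>z. z ^ max N M *s (f z + c *s g z)) \<in> H2"
    by (simp add: mult.commute)
  then show ?thesis using L by (auto simp: trig_H2_def intro!: L2_add L2_scale)
qed

lemma fbasis_trig_H2: "fbasis k i \<in> trig_H2"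
proof -
  obtain N where "int N + k \<ge> 0" by (rule that[of "nat \<bar>k\<bar>"]) simp
  then have "fbasis (int N + k) i \<in> H2" by (rule fbasis_H2)
  moreover have "AE z in circle. fbasis (int N + k) i z = z ^ N *s fbasis k i z"
    using AE_circle_norm
  proof eventually_elim
    case (elim z)
    then have "z \<noteq> 0" by auto
    then have "z powi (int N + k) = z ^ N * z powi k" by (subst power_int_add) auto
    then show ?case by (simp add: fbasis_def vec_eq_iff axis_def)
  qed
  moreover have "(\<lambda>z. z ^ N *s fbasis k i z) \<in> borel_measurable borel"
    by (intro measurable_vector_smult L2_measurable fbasis_L2) simp
  ultimately have "(\<lambda>z. z ^ N *s fbasis k i z) \<in> H2" by (rule H2_cong_AE)
  then show ?thesis by (auto simp: trig_H2_def)
qed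

text \<open>The limits of \<open>trig_H2\<close> form a closed subspace containing every
  \<open>fbasis k i\<close>, so the residual of the projection onto it has no Fourier
  coefficients.\<close>

lemma trig_H2_dense:
  fixes w :: "complex \<Rightarrow> complex^'n"
  assumes w: "w \<in> L2"
  obtains t where "\<And>n::nat. t n \<in> trig_H2" "(\<lambda>n. L2_sq (\<lambda>z. t n z - w z)) \<longlonglongrightarrow> 0"
proof -
  define K :: "(complex \<Rightarrow> complex^'n) set"
    where "K = {f \<in> L2. \<forall>e>0. \<exists>t\<in>trig_H2. L2_sq (\<lambda>z. t z - f z) < e}"
  have TL: "t \<in> L2" if "t \<in> trig_H2" for t :: "complex \<Rightarrow> complex^'n" using that by (simp add: trig_H2_def)
  have TK: "t \<in> K" if "t \<in> trig_H2" for t using that TL by (force simp: K_def intro!: bexI[of _ t])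
  have "(\<lambda>z. 0) \<in> (trig_H2 :: (complex \<Rightarrow> complex^'n) set)"
    using H2_zero by (auto simp: trig_H2_def)
  note zero = TK[OF this]
  have K: "L2_subspace K"
  proof (rule L2_subspaceI)
    show "(\<lambda>z. 0) \<in> K" by (rule zero)
    show "f \<in> L2" if "f \<in> K" for f using that by (simp add: K_def)
  next
    fix f g c assume f: "f \<in> K" and g: "g \<in> K"
    have fL: "f \<in> L2" and gL: "g \<in> L2" using f g by (simp_all add: K_def)
    have "\<exists>t\<in>trig_H2. L2_sq (\<lambda>z. t z - (f z + c *s g z)) < e" if "e > 0" for e
    proof -
      \<comment> \<open>Sized so that each of the two errors, after the factor
        \<open>(norm c)\<^sup>2\<close> for the second, costs at most 2 * (e / 4); the summand 1
        covers \<open>c = 0\<close>.\<close>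
      let ?b = "4 * ((norm c)\<^sup>2 + 1)"
      have b: "?b > 0" by (simp add: add_nonneg_pos)
      obtain s where s: "s \<in> trig_H2" "L2_sq (\<lambda>z. s z - f z) < e / 4"
        using f \<open>e > 0\<close> unfolding K_def by (auto dest!: spec[of _ "e/4"])
      have "e / ?b > 0" using b \<open>e > 0\<close> by (rule divide_pos_pos[rotated])
      then obtain t where t: "t \<in> trig_H2" "L2_sq (\<lambda>z. t z - g z) < e / ?b"
        using g unfolding K_def by blast
      have sL: "s \<in> L2" and tL: "t \<in> L2" using s t TL by auto
      have "L2_sq (\<lambda>z. (s z + c *s t z) - (f z + c *s g z)) = L2_sq (\<lambda>z. (s z - f z) + c *s (t z - g z))"
        by (intro arg_cong[where f = L2_sq]) (simp add: fun_eq_iff algebra_simps)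
      also have "\<dots> \<le> 2 * L2_sq (\<lambda>z. s z - f z) + 2 * L2_sq (\<lambda>z. c *s (t z - g z))"
        by (intro L2_sq_add_le L2_scale L2_diff sL tL fL gL)
      also have "L2_sq (\<lambda>z. c *s (t z - g z)) = (norm c)\<^sup>2 * L2_sq (\<lambda>z. t z - g z)"
        by (simp add: norm_vector_smult power_mult_distrib del: vector_ssub_ldistrib)
      also have "2 * L2_sq (\<lambda>z. s z - f z) + 2 * ((norm c)\<^sup>2 * L2_sq (\<lambda>z. t z - g z)) < e"
      proof -
        have "(norm c)\<^sup>2 * L2_sq (\<lambda>z. t z - g z) \<le> ((norm c)\<^sup>2 + 1) * (e / ?b)"
          by (intro mult_mono less_imp_le[OF t(2)]) simp_all
        also have "\<dots> = e / 4" using b by (simp add: field_simps)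
        finally show ?thesis using s(2) by linarith
      qed
      finally show ?thesis by (rule bexI[OF _ trig_H2_lin[OF s(1) t(1)]])
    qed
    then show "(\<lambda>z. f z + c *s g z) \<in> K" using fL gL by (auto simp: K_def intro!: L2_add L2_scale)
  next
    fix x f assume x: "\<And>n::nat. x n \<in> K" and f: "f \<in> L2"
      and l: "(\<lambda>n. L2_sq (\<lambda>z. x n z - f z)) \<longlonglongrightarrow> 0"
    have "\<exists>t\<in>trig_H2. L2_sq (\<lambda>z. t z - f z) < e" if "e > 0" for e
    proof -
      have "eventually (\<lambda>n. L2_sq (\<lambda>z. x n z - f z) < e / 4) sequentially"
        using order_tendstoD(2)[OF l, of "e/4"] \<open>e > 0\<close> by simp
      then obtain n where n: "L2_sq (\<lambda>z. x n z - f z) < e / 4" by (auto simp: eventually_sequentially)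
      have "e / 4 > 0" using \<open>e > 0\<close> by simp
      then obtain t where t: "t \<in> trig_H2" "L2_sq (\<lambda>z. t z - x n z) < e / 4"
        using x[of n] unfolding K_def by blast
      have xL: "x n \<in> L2" using x[of n] by (simp add: K_def)
      have "L2_sq (\<lambda>z. t z - f z) = L2_sq (\<lambda>z. (t z - x n z) + (x n z - f z))" by simp
      also have "\<dots> \<le> 2 * L2_sq (\<lambda>z. t z - x n z) + 2 * L2_sq (\<lambda>z. x n z - f z)"
        by (intro L2_sq_add_le L2_diff TL t xL f)
      also have "\<dots> < e" using t n by linarith
      finally show ?thesis using t by blast
    qed
    then show "f \<in> K" using f by (simp add: K_def)
  qed
  obtain x where x: "x \<in> K" and orth: "\<And>y. y \<in> K \<Longrightarrow> L2_inner (\<lambda>z. w z - x z) y = 0"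
    by (rule L2_projection[OF K w]) (rule that)
  have xL: "x \<in> L2" using x by (simp add: K_def)
  have "AE z in circle. w z - x z = 0"
  proof (rule fourier_unique[OF L2_diff[OF w xL]])
    fix i k
    show "fourier_coeff (\<lambda>z. (w z - x z) $ i) k = 0"
      unfolding fourier_coeff_inner[OF L2_diff[OF w xL]] by (intro orth TK fbasis_trig_H2)
  qed
  then have "AE z in circle. x z = w z" by eventually_elim simp
  from L2_subspace_cong_AE[OF K x this L2_measurable[OF w]] have wK: "w \<in> K" .
  have "\<exists>t\<in>trig_H2. L2_sq (\<lambda>z. t z - w z) < 1 / real (Suc n)" for n
    using wK unfolding K_def by simp
  then obtain t where t: "\<And>n. t n \<in> trig_H2" "\<And>n. L2_sq (\<lambda>z. t n z - w z) < 1 / real (Suc n)"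
    by metis
  have "(\<lambda>n. L2_sq (\<lambda>z. t n z - w z)) \<longlonglongrightarrow> 0"
  proof (rule tendsto_sandwich[OF _ _ tendsto_const])
    show "(\<lambda>n. 1 / real (Suc n)) \<longlonglongrightarrow> 0" by (rule LIMSEQ_Suc[OF lim_1_over_n])
    show "\<forall>\<^sub>F n in sequentially. L2_sq (\<lambda>z. t n z - w z) \<le> 1 / real (Suc n)"
      using t(2) by (simp add: less_imp_le)
  qed simp
  with t(1) that show ?thesis by blast
qed

lemma tendsto_L2_sq:
  assumes x: "\<And>n::nat. x n \<in> L2" and f: "f \<in> L2" and l: "(\<lambda>n. L2_sq (\<lambda>z. x n z - f z)) \<longlonglongrightarrow> 0"
  shows "(\<lambda>n. L2_sq (x n)) \<longlonglongrightarrow> L2_sq f"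
proof -
  have "L2_sq (x n) = L2_sq f + 2 * Re (L2_inner (x n) f - L2_inner f f) + L2_sq (\<lambda>z. x n z - f z)" for n
    using L2_sq_expand[OF f L2_diff[OF x[of n] f], of 1]
    by (simp add: L2_inner_diff_left[OF x[of n] f f])
  moreover have "(\<lambda>n. L2_sq f + 2 * Re (L2_inner (x n) f - L2_inner f f) + L2_sq (\<lambda>z. x n z - f z))
      \<longlonglongrightarrow> L2_sq f + 2 * Re (L2_inner f f - L2_inner f f) + 0"
    by (intro tendsto_intros l tendsto_L2_inner[OF x f f l])
  ultimately show ?thesis by simp
qed

lemma norm_matrix_vector_le:
  fixes A :: "complex^'n^'n"
  shows "norm (A *v v) \<le> (\<Sum>i\<in>UNIV. \<Sum>j\<in>UNIV. norm (A $ i $ j)) * norm v"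
proof -
  have "norm (A *v v) \<le> (\<Sum>i\<in>UNIV. \<Sum>j\<in>UNIV. norm (A $ i $ j *s axis i (v $ j)))"
    unfolding matrix_vector_mult_axis_sum by (intro order.trans[OF norm_sum] sum_mono norm_sum)
  also have "\<dots> \<le> (\<Sum>i\<in>UNIV. \<Sum>j\<in>UNIV. norm (A $ i $ j) * norm v)"
  proof (intro sum_mono)
    fix i j
    have "norm (axis i (v $ j) :: complex^'n) = norm (v $ j)" by (rule norm_axis_complex)
    then show "norm (A $ i $ j *s axis i (v $ j)) \<le> norm (A $ i $ j) * norm v"
      by (simp add: norm_vector_smult mult_left_mono Finite_Cartesian_Product.norm_nth_le)
  qed
  finally show ?thesis by (simp add: sum_distrib_right)
qed

lemma L2_sq_matrix_bound:
  assumes \<Phi>: "\<Phi> \<in> Linf_mat"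
  obtains C where "\<And>f :: complex \<Rightarrow> complex^'n. f \<in> L2 \<Longrightarrow> L2_sq (\<lambda>z. \<Phi> z *v f z) \<le> C * L2_sq f"
proof -
  have "\<exists>C\<ge>0. AE z in circle. norm (\<Phi> z $ i $ j) \<le> C" for i j
    using \<Phi> LinfD(2) by (simp add: Linf_mat_def)
  then obtain c where c: "\<And>i j. AE z in circle. norm (\<Phi> z $ i $ j) \<le> c i j" by metis
  define C where "C = (\<Sum>i\<in>UNIV. \<Sum>j\<in>UNIV. c i j)"
  have "AE z in circle. \<forall>i\<in>UNIV. \<forall>j\<in>UNIV. norm (\<Phi> z $ i $ j) \<le> c i j"
    by (intro AE_finite_allI c) auto
  then have C: "AE z in circle. (\<Sum>i\<in>UNIV. \<Sum>j\<in>UNIV. norm (\<Phi> z $ i $ j)) \<le> C"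
    unfolding C_def by eventually_elim (intro sum_mono, simp)
  have "L2_sq (\<lambda>z. \<Phi> z *v f z) \<le> C\<^sup>2 * L2_sq f" if f: "f \<in> L2" for f :: "complex \<Rightarrow> complex^'n"
  proof -
    have "L2_sq (\<lambda>z. \<Phi> z *v f z) \<le> (LINT z|circle. C\<^sup>2 * (norm (f z))\<^sup>2)"
    proof (rule integral_mono_AE)
      show "AE z in circle. (norm (\<Phi> z *v f z))\<^sup>2 \<le> C\<^sup>2 * (norm (f z))\<^sup>2"
        using C
      proof eventually_elim
        case (elim z)
        have "norm (\<Phi> z *v f z) \<le> C * norm (f z)"
          by (rule order.trans[OF norm_matrix_vector_le]) (intro mult_right_mono elim, simp)
        then have "(norm (\<Phi> z *v f z))\<^sup>2 \<le> (C * norm (f z))\<^sup>2" by (intro power_mono) auto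
        then show ?case by (simp add: power_mult_distrib)
      qed
    qed (use L2_Linf_mat_mult[OF \<Phi> f] f in \<open>simp_all add: L2_integrable_sq\<close>)
    then show ?thesis by simp
  qed
  with that show ?thesis by blast
qed

lemma L2_sq_unimodular:
  assumes "AE z in circle. norm (u z) = 1" "u \<in> borel_measurable borel" "f \<in> L2"
  shows "L2_sq (\<lambda>z. u z *s f z) = L2_sq f"
proof (rule integral_cong_AE)
  show "AE z in circle. (norm (u z *s f z))\<^sup>2 = (norm (f z))\<^sup>2"
    using assms(1) by eventually_elim (simp add: norm_vector_smult)
qed (use assms(2) L2_measurable[OF assms(3)] in \<open>simp_all add: measurable_vector_smult\<close>)

lemma AE_norm_power_1: "AE z in circle. norm (z ^ N) = 1"
  using AE_circle_norm by eventually_elim (simp add: norm_power)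

lemma L2_sq_proj_H2:
  assumes f: "f \<in> L2" shows "L2_sq f = L2_sq (proj_H2 f) + L2_sq (\<lambda>z. f z - proj_H2 f z)"
proof -
  let ?p = "proj_H2 f"
  have p: "?p \<in> H2" and pL: "?p \<in> L2" using proj_H2_in[OF f] H2_L2 by auto
  have d: "(\<lambda>z. f z - ?p z) \<in> L2" by (intro L2_diff f pL)
  have "L2_sq (\<lambda>z. ?p z + 1 *s (f z - ?p z)) =
      L2_sq ?p + 2 * Re (1 * L2_inner (\<lambda>z. f z - ?p z) ?p) + (norm (1::complex))\<^sup>2 * L2_sq (\<lambda>z. f z - ?p z)"
    by (rule L2_sq_expand[OF pL d])
  then show ?thesis using proj_H2_orth[OF f p] by simp
qed

lemma L2_sq_proj_H2_le:
  assumes f: "f \<in> L2" shows "L2_sq (proj_H2 f) \<le> L2_sq f"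
proof -
  have "0 \<le> L2_sq (\<lambda>z. f z - proj_H2 f z)" by simp
  then show ?thesis using L2_sq_proj_H2[OF f] by linarith
qed

lemma matrix_vector_mult_smult: "A *v (c *s v) = c *s (A *v (v :: 'a::comm_ring_1^'n))"
  by (simp add: vec_eq_iff matrix_vector_mult_def sum_distrib_left mult_ac)

text \<open>The norm of \<open>ct f\<close> is found by testing against members of
  \<open>trig_H2\<close>. After a common shift both functions lie in \<open>H2\<close>; there the
  pairing is one with the adjoint Toeplitz operator, which hyponormality bounds by the Toeplitz
  operator and hence by \<Phi> f. Finally the test functions tend to \<open>ct f\<close>.\<close>

lemma hyponormal_toeplitz_symbol_trig:
  assumes \<Phi>: "\<Phi> \<in> Linf_mat" and h: "H2_hyponormal (toeplitz \<Phi>)" and f: "f \<in> trig_H2"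
  shows "L2_sq (\<lambda>z. conj_transpose (\<Phi> z) *v f z) \<le> L2_sq (\<lambda>z. \<Phi> z *v f z)"
proof -
  let ?ct = "\<lambda>z. conj_transpose (\<Phi> z)"
  let ?w = "\<lambda>z. ?ct z *v f z" and ?c = "L2_sq (\<lambda>z. \<Phi> z *v f z)"
  note ct = conj_transpose_Linf_mat[OF \<Phi>]
  note adj = adjoint_pair_toeplitz[OF \<Phi>]
  have fL: "f \<in> L2" using f by (simp add: trig_H2_def)
  have wL: "?w \<in> L2" by (rule L2_Linf_mat_mult[OF ct fL])
  have bound: "(norm (L2_inner ?w t))\<^sup>2 \<le> ?c * L2_sq t" if t: "t \<in> trig_H2" for t
  proof -
    obtain N M where N: "(\<lambda>z. z ^ N *s f z) \<in> H2" and M: "(\<lambda>z. z ^ M *s t z) \<in> H2"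
      using f t by (auto simp: trig_H2_def)
    have tL: "t \<in> L2" using t by (simp add: trig_H2_def)
    let ?K = "max N M"
    let ?F = "\<lambda>z. z ^ ?K *s f z" and ?S = "\<lambda>z. z ^ ?K *s t z"
    have F: "?F \<in> H2" and S: "?S \<in> H2" using trig_H2_mono[OF N] trig_H2_mono[OF M] by simp_all
    have wF: "(\<lambda>z. ?ct z *v ?F z) \<in> L2" and \<Phi>F: "(\<lambda>z. \<Phi> z *v ?F z) \<in> L2"
      using L2_Linf_mat_mult[OF ct H2_L2[OF F]] L2_Linf_mat_mult[OF \<Phi> H2_L2[OF F]] by auto
    have "L2_inner ?w t = L2_inner (\<lambda>z. ?ct z *v ?F z) ?S"
      unfolding L2_inner_cip
    proof (rule integral_cong_AE)
      show "AE z in circle. cip (?w z) (t z) = cip (?ct z *v ?F z) (?S z)"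
        using AE_norm_power_1[of ?K]
      proof eventually_elim
        case (elim z)
        have "cnj (z ^ ?K) * z ^ ?K = 1"
          using elim by (simp only: mult.commute[of "cnj _"] complex_norm_square[symmetric]) simp
        then have "cip (?ct z *v ?F z) (?S z) = 1 * cip (?w z) (t z)"
          by (simp only: matrix_vector_mult_smult cip_scale_left cip_scale_right mult.assoc[symmetric])
        then show ?case by simp
      qed
    qed (use wL tL wF H2_L2[OF S] in \<open>auto intro!: measurable_cip L2_measurable\<close>)
    also have "\<dots> = L2_inner (toeplitz ?ct ?F) ?S"
      unfolding toeplitz_def by (rule L2_inner_proj_H2_left[OF wF S, symmetric])
    also have "(norm \<dots>)\<^sup>2 \<le> L2_sq (toeplitz ?ct ?F) * L2_sq ?S"
      by (rule L2_Cauchy_Schwarz_sq) (use adjoint_pairD(2)[OF adj F] S H2_L2 in auto)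
    also have "\<dots> \<le> ?c * L2_sq t"
    proof (rule mult_mono)
      have "L2_sq (toeplitz ?ct ?F) \<le> L2_sq (toeplitz \<Phi> ?F)"
        by (rule H2_hyponormalD[OF adj h F])
      also have "\<dots> \<le> L2_sq (\<lambda>z. \<Phi> z *v ?F z)"
        unfolding toeplitz_def by (rule L2_sq_proj_H2_le[OF \<Phi>F])
      also have "\<dots> = L2_sq (\<lambda>z. z ^ ?K *s (\<Phi> z *v f z))"
        by (simp only: matrix_vector_mult_smult)
      also have "\<dots> = ?c"
        by (rule L2_sq_unimodular[OF AE_norm_power_1 _ L2_Linf_mat_mult[OF \<Phi> fL]]) simp
      finally show "L2_sq (toeplitz ?ct ?F) \<le> ?c" .
      show "L2_sq ?S \<le> L2_sq t"
        by (rule eq_refl, rule L2_sq_unimodular[OF AE_norm_power_1 _ tL]) simp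
    qed simp_all
    finally show ?thesis .
  qed
  obtain t where t: "\<And>n::nat. t n \<in> trig_H2" and l: "(\<lambda>n. L2_sq (\<lambda>z. t n z - ?w z)) \<longlonglongrightarrow> 0"
    by (rule trig_H2_dense[OF wL]) (rule that)
  have tL: "t n \<in> L2" for n using t[of n] by (simp add: trig_H2_def)
  have "(\<lambda>n. L2_inner (t n) ?w) \<longlonglongrightarrow> L2_inner ?w ?w" by (rule tendsto_L2_inner[OF tL wL wL l])
  then have "(\<lambda>n. (norm (L2_inner (t n) ?w))\<^sup>2) \<longlonglongrightarrow> (norm (L2_inner ?w ?w))\<^sup>2"
    by (intro tendsto_intros)
  moreover have "(\<lambda>n. ?c * L2_sq (t n)) \<longlonglongrightarrow> ?c * L2_sq ?w"
    by (intro tendsto_mult_left tendsto_L2_sq[OF tL wL l])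
  moreover have "(norm (L2_inner (t n) ?w))\<^sup>2 \<le> ?c * L2_sq (t n)" for n
  proof -
    have "norm (L2_inner (t n) ?w) = norm (L2_inner ?w (t n))" by (metis L2_inner_cnj complex_mod_cnj)
    then show ?thesis using bound[OF t] by simp
  qed
  ultimately have "(norm (L2_inner ?w ?w))\<^sup>2 \<le> ?c * L2_sq ?w"
    by (intro LIMSEQ_le) auto
  then have le: "L2_sq ?w * L2_sq ?w \<le> ?c * L2_sq ?w"
    unfolding L2_inner_self norm_of_real by (simp add: power2_eq_square)
  have gen: "a \<le> c" if "a * a \<le> c * a" "0 \<le> a" "0 \<le> c" for a c :: real
    using that by (cases "a = 0") (auto simp: mult_le_cancel_right)
  show ?thesis by (rule gen[OF le]) simp_all
qed

lemma hyponormal_toeplitz_symbol_L2: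
  assumes \<Phi>: "\<Phi> \<in> Linf_mat" and h: "H2_hyponormal (toeplitz \<Phi>)" and f: "f \<in> L2"
  shows "L2_sq (\<lambda>z. conj_transpose (\<Phi> z) *v f z) \<le> L2_sq (\<lambda>z. \<Phi> z *v f z)"
proof -
  obtain t where t: "\<And>n::nat. t n \<in> trig_H2" and l: "(\<lambda>n. L2_sq (\<lambda>z. t n z - f z)) \<longlonglongrightarrow> 0"
    by (rule trig_H2_dense[OF f]) (rule that)
  have tL: "t n \<in> L2" for n using t[of n] by (simp add: trig_H2_def)
  have lim: "(\<lambda>n. L2_sq (\<lambda>z. \<Psi> z *v t n z)) \<longlonglongrightarrow> L2_sq (\<lambda>z. \<Psi> z *v f z)" if \<Psi>: "\<Psi> \<in> Linf_mat" for \<Psi>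
  proof (rule tendsto_L2_sq[OF L2_Linf_mat_mult[OF \<Psi> tL] L2_Linf_mat_mult[OF \<Psi> f]])
    obtain C where C: "\<And>f. f \<in> L2 \<Longrightarrow> L2_sq (\<lambda>z. \<Psi> z *v f z) \<le> C * L2_sq f"
      by (rule L2_sq_matrix_bound[OF \<Psi>]) (rule that)
    show "(\<lambda>n. L2_sq (\<lambda>z. \<Psi> z *v t n z - \<Psi> z *v f z)) \<longlonglongrightarrow> 0"
    proof (rule tendsto_sandwich[OF _ _ tendsto_const])
      show "(\<lambda>n. C * L2_sq (\<lambda>z. t n z - f z)) \<longlonglongrightarrow> 0" by (rule tendsto_mult_right_zero[OF l])
      show "\<forall>\<^sub>F n in sequentially. L2_sq (\<lambda>z. \<Psi> z *v t n z - \<Psi> z *v f z) \<le> C * L2_sq (\<lambda>z. t n z - f z)"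
        using C[OF L2_diff[OF tL f]] by (simp add: matrix_vector_mult_diff_distrib)
    qed simp
  qed
  show ?thesis
    by (rule LIMSEQ_le[OF lim[OF conj_transpose_Linf_mat[OF \<Phi>]] lim[OF \<Phi>]])
      (use hyponormal_toeplitz_symbol_trig[OF \<Phi> h t] in auto)
qed

text \<open>The integrated inequality is tested on \<open>v\<close> restricted to the set
  \<open>E\<close> where the claim fails.\<close>

lemma hyponormal_toeplitz_symbol_AE:
  assumes \<Phi>: "\<Phi> \<in> Linf_mat" and h: "H2_hyponormal (toeplitz \<Phi>)"
  shows "AE z in circle. norm (conj_transpose (\<Phi> z) *v v) \<le> norm (\<Phi> z *v v)"
proof -
  have vL: "(\<lambda>z. v) \<in> L2" by (simp add: L2_def)
  note ct = conj_transpose_Linf_mat[OF \<Phi>]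
  let ?a = "\<lambda>z. (norm (\<Phi> z *v v))\<^sup>2" and ?b = "\<lambda>z. (norm (conj_transpose (\<Phi> z) *v v))\<^sup>2"
  have a: "integrable circle ?a" and b: "integrable circle ?b"
    using L2_integrable_sq[OF L2_Linf_mat_mult[OF \<Phi> vL]] L2_integrable_sq[OF L2_Linf_mat_mult[OF ct vL]] by auto
  have [measurable]: "?a \<in> borel_measurable borel" "?b \<in> borel_measurable borel" using a b by auto
  define E where "E = {z. ?a z < ?b z}"
  have E [measurable]: "E \<in> sets borel" unfolding E_def by measurable
  let ?f = "\<lambda>z. indicator E z *s v"
  have fL: "?f \<in> L2"
    by (rule L2_Linf_mult[OF _ vL]) (rule LinfI[of _ 1], auto simp: indicator_def)
  have ind: "(norm (A *v (indicator E z *s v)))\<^sup>2 = indicator E z * (norm (A *v v))\<^sup>2" for A z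
    by (auto simp: indicator_def)
  have int: "integrable circle (\<lambda>z. indicator E z * ?a z)" "integrable circle (\<lambda>z. indicator E z * ?b z)"
    using integrable_mult_indicator[of E circle, OF _ a] integrable_mult_indicator[of E circle, OF _ b] by simp_all
  have "(LINT z|circle. indicator E z * ?b z) \<le> (LINT z|circle. indicator E z * ?a z)"
    using hyponormal_toeplitz_symbol_L2[OF \<Phi> h fL] unfolding ind .
  then have "(LINT z|circle. indicator E z * (?b z - ?a z)) \<le> 0"
    using int by (simp add: right_diff_distrib)
  moreover have nn: "AE z in circle. 0 \<le> indicator E z * (?b z - ?a z)"
  proof (rule AE_I2)
    fix z
    show "0 \<le> indicator E z * (?b z - ?a z)"
    proof (cases "z \<in> E")
      case True
      then have "?a z < ?b z" by (simp only: E_def mem_Collect_eq)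
      then show ?thesis using True by (simp only: indicator_simps mult_1_left diff_ge_0_iff_ge less_imp_le)
    qed simp
  qed
  ultimately have "(LINT z|circle. indicator E z * (?b z - ?a z)) = 0"
    using integral_nonneg_AE[OF nn] by linarith
  moreover have "integrable circle (\<lambda>z. indicator E z * (?b z - ?a z))"
    using int by (simp add: right_diff_distrib)
  ultimately have "AE z in circle. indicator E z * (?b z - ?a z) = 0"
    using integral_nonneg_eq_0_iff_AE nn by blast
  then show ?thesis
  proof eventually_elim
    case (elim z)
    have "?b z \<le> ?a z"
    proof (cases "?a z < ?b z")
      case True
      then have "indicator E z = (1::real)" by (simp add: E_def)
      then show ?thesis using elim by (simp only: mult_1_left)
    qed (simp only: not_less)
    then show ?case by (rule power2_le_imp_le) simp
  qed
qed

lemma cip_axis: "cip (D *v axis j 1) (axis i 1) = D $ i $ j"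
  by (simp add: cip_def matrix_vector_mult_def axis_def if_distrib sum.delta cong: if_cong)

text \<open>Nonnegative diagonal entries with sum 0 vanish; then u = 1, -1, \<i>, -\<i> kill the
  real and imaginary parts of the other entries. The test vectors are finite in number because each
  inequality will be known only almost everywhere.\<close>

lemma hermitian_trace_zero:
  fixes D :: "complex^'n^'n"
  assumes herm: "\<And>i j. D $ j $ i = cnj (D $ i $ j)" and tr: "(\<Sum>i\<in>UNIV. D $ i $ i) = 0"
    and pos: "\<And>i j u. u \<in> {0, 1, -1, \<i>, -\<i>} \<Longrightarrow> 0 \<le> Re (cip (D *v (axis i 1 + u *s axis j 1)) (axis i 1 + u *s axis j 1))"
  shows "D = 0"
proof -
  have diag0: "D $ i $ i = 0" for i
  proof -
    have nn: "0 \<le> Re (D $ k $ k)" for k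
      using pos[of 0 k k] by (simp add: cip_axis)
    have "(\<Sum>k\<in>UNIV. Re (D $ k $ k)) = 0" using tr by (metis Re_sum zero_complex.sel(1))
    then have "Re (D $ i $ i) = 0" using nn by (simp add: sum_nonneg_eq_0_iff)
    moreover have "Im (D $ i $ i) = 0" using herm[of i i] by (metis complex_cnj_cancel_iff Reals_cnj_iff complex_is_Real_iff)
    ultimately show ?thesis by (simp add: complex_eq_iff)
  qed
  have "D $ i $ j = 0" for i j
  proof -
    have q: "0 \<le> 2 * Re (u * D $ i $ j)" if "u \<in> {0, 1, -1, \<i>, -\<i>}" for u
    proof -
      have "cip (D *v (axis i 1 + u *s axis j 1)) (axis i 1 + u *s axis j 1) =
          u * D $ i $ j + cnj (u * D $ i $ j)"
        by (simp add: matrix_vector_right_distrib matrix_vector_mult_smult cip_simps cip_axis diag0 herm[of i j])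
      then have "Re (cip (D *v (axis i 1 + u *s axis j 1)) (axis i 1 + u *s axis j 1)) = 2 * Re (u * D $ i $ j)"
        by simp
      then show ?thesis using pos[OF that, of i j] by simp
    qed
    show ?thesis using q[of 1] q[of "-1"] q[of \<i>] q[of "-\<i>"] by (simp add: complex_eq_iff)
  qed
  then show ?thesis by (simp add: vec_eq_iff)
qed

lemma matrix_matrix_vector_mult: "(A ** B) *v v = A *v (B *v (v :: complex^'n))"
  by (simp add: matrix_vector_mul_assoc)

text \<open>A commutator of matrices has trace 0, so a positive self-commutator is 0. This is where
  the inequality of hyponormality turns into an equality.\<close>

theorem hyponormal_toeplitz_normal_symbol:
  fixes \<Phi> :: "complex \<Rightarrow> complex^'n^'n"
  assumes \<Phi>: "\<Phi> \<in> Linf_mat" and h: "H2_hyponormal (toeplitz \<Phi>)"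
  shows "AE z in circle. conj_transpose (\<Phi> z) ** \<Phi> z = \<Phi> z ** conj_transpose (\<Phi> z)"
proof -
  let ?ct = "\<lambda>z. conj_transpose (\<Phi> z)"
  have "AE z in circle. \<forall>i\<in>UNIV. \<forall>j\<in>UNIV. \<forall>u\<in>{0, 1, -1, \<i>, -\<i>}.
      norm (?ct z *v (axis i 1 + u *s axis j 1 :: complex^'n)) \<le> norm (\<Phi> z *v (axis i 1 + u *s axis j 1 :: complex^'n))"
    by (intro AE_finite_allI hyponormal_toeplitz_symbol_AE[OF \<Phi> h]) auto
  then show ?thesis
  proof eventually_elim
    case (elim z)
    let ?P = "\<Phi> z" let ?Q = "?ct z"
    let ?D = "?Q ** ?P - ?P ** ?Q"
    have cipD: "cip (?D *v v) v = of_real ((norm (?P *v v))\<^sup>2 - (norm (?Q *v v))\<^sup>2)" for v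
    proof -
      have "cip (?D *v v) v = cip (?Q *v (?P *v v)) v - cip (?P *v (?Q *v v)) v"
        by (simp add: matrix_vector_mult_diff_rdistrib matrix_matrix_vector_mult cip_diff_left)
      also have "cip (?Q *v (?P *v v)) v = cip (?P *v v) (?P *v v)" by (simp add: cip_matrix_left)
      also have "cip (?P *v (?Q *v v)) v = cip (?Q *v v) (?Q *v v)" by (simp add: cip_matrix_left)
      finally show ?thesis by (simp only: cip_self of_real_diff)
    qed
    have "?D = 0"
    proof (rule hermitian_trace_zero)
      show "?D $ j $ i = cnj (?D $ i $ j)" for i j
        by (simp add: matrix_matrix_mult_def conj_transpose_def mult.commute)
      have "trace ?D = 0" by (simp add: trace_sub trace_mul_sym[of ?Q])
      then show "(\<Sum>i\<in>UNIV. ?D $ i $ i) = 0" by (simp add: trace_def)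
      fix i j u assume u: "u \<in> {0, 1, -1, \<i>, -\<i>}"
      let ?v = "axis i 1 + u *s axis j 1 :: complex^'n"
      have "norm (?Q *v ?v) \<le> norm (?P *v ?v)" using elim u by blast
      then have "(norm (?Q *v ?v))\<^sup>2 \<le> (norm (?P *v ?v))\<^sup>2" by (rule power_mono) simp
      then show "0 \<le> Re (cip (?D *v ?v) ?v)" unfolding cipD by simp
    qed
    then show ?case by simp
  qed
qed

subsection \<open>Coprimeness and inner divisors\<close>

lemma cnj_measurable: "cnj \<in> borel_measurable borel"
  by (intro borel_measurable_continuous_onI continuous_intros)

lemma cnj_measurable_circle: "cnj \<in> measurable circle borel"
  by (simp add: cnj_measurable)

lemma integral_circle_cnj:
  fixes f :: "complex \<Rightarrow> 'a::{banach, second_countable_topology}"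
  assumes "f \<in> borel_measurable borel"
  shows "(LINT z|circle. f (cnj z)) = (LINT z|circle. f z)"
  using integral_distr[OF cnj_measurable_circle assms] by (simp add: distr_circle_cnj)

lemma L2_cnj_arg:
  assumes f: "f \<in> L2" shows "(\<lambda>z. f (cnj z)) \<in> L2"
proof -
  have m: "(\<lambda>z. (norm (f z))\<^sup>2) \<in> borel_measurable borel"
    using borel_measurable_integrable[OF L2_integrable_sq[OF f]] by simp
  have "integrable (distr circle borel cnj) (\<lambda>z. (norm (f z))\<^sup>2)"
    unfolding distr_circle_cnj by (rule L2_integrable_sq[OF f])
  then have "integrable circle (\<lambda>z. (norm (f (cnj z)))\<^sup>2)"
    by (subst (asm) integrable_distr_eq[OF cnj_measurable_circle m])
  then show ?thesis
    using measurable_compose[OF cnj_measurable L2_measurable[OF f]] by (simp add: L2_def)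
qed

lemma L2_closure_subset:
  assumes K: "L2_subspace K" and S: "S \<inter> L2 \<subseteq> K" shows "L2_closure S \<subseteq> K"
proof
  fix f assume "f \<in> L2_closure S"
  then have f: "f \<in> L2" and ex: "\<And>e. e > 0 \<Longrightarrow> \<exists>g\<in>S \<inter> L2. L2_norm (\<lambda>z. f z - g z) < e"
    by (auto simp: L2_closure_def)
  have "\<exists>g\<in>S \<inter> L2. L2_norm (\<lambda>z. f z - g z) < 1 / real (Suc n)" for n by (rule ex) simp
  then obtain g where g: "\<And>n. g n \<in> S \<inter> L2" "\<And>n. L2_norm (\<lambda>z. f z - g n z) < 1 / real (Suc n)"
    by metis
  have "(\<lambda>n. L2_norm (\<lambda>z. f z - g n z)) \<longlonglongrightarrow> 0"
  proof (rule tendsto_sandwich[OF _ _ tendsto_const])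
    show "(\<lambda>n. 1 / real (Suc n)) \<longlonglongrightarrow> 0" by (rule LIMSEQ_Suc[OF lim_1_over_n])
    show "\<forall>\<^sub>F n in sequentially. L2_norm (\<lambda>z. f z - g n z) \<le> 1 / real (Suc n)"
      using g(2) by (simp add: less_imp_le)
  qed simp
  then have "(\<lambda>n. (L2_norm (\<lambda>z. f z - g n z))\<^sup>2) \<longlonglongrightarrow> 0\<^sup>2" by (rule tendsto_power)
  then have "(\<lambda>n. L2_sq (\<lambda>z. g n z - f z)) \<longlonglongrightarrow> 0"
    by (simp add: L2_norm_sq norm_minus_commute)
  then show "f \<in> K"
    using g(1) S by (intro L2_subspaceD(4)[OF K _ f]) auto
qed

lemma closed_span_subset:
  assumes K: "L2_subspace K" and S: "S \<subseteq> K" shows "closed_span S \<subseteq> K"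
proof -
  have "(\<lambda>z. \<Sum>g\<in>B. c g *s g z) \<in> K" if "finite B" "B \<subseteq> S" for B c
    using that
  proof (induction B rule: finite_induct)
    case empty
    then show ?case using L2_subspaceD(2)[OF K] by simp
  next
    case (insert g B)
    have "(\<lambda>z. c g *s g z + (\<Sum>g\<in>B. c g *s g z)) \<in> K"
      by (rule L2_subspace_add[OF K L2_subspace_scale[OF K]]) (use insert S in auto)
    then show ?case using insert by simp
  qed
  then show ?thesis unfolding closed_span_def by (intro L2_closure_subset[OF K]) auto
qed

lemma Hinf_cnj_poly_cnj: "(\<lambda>z. cnj (poly q (cnj z))) \<in> Hinf"
  by (induction q) (auto intro!: Hinf_add Hinf_mult Hinf_ident)

text \<open>Replacing z by its conjugate turns the pairing into one of p(cnj z), with coefficients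
  at indices at most 0, and z F u, with coefficients at indices at least 1.\<close>

lemma tilde_poly_orthogonal:
  fixes F :: "complex \<Rightarrow> complex^'n^'n"
  assumes F: "F \<in> Linf_mat" and u: "u \<in> L2" and Fu: "(\<lambda>z. F z *v u z) \<in> H2" and p: "p \<in> vec_polys"
  shows "L2_inner (\<lambda>z. tilde F z *v p z) (\<lambda>z. cnj z *s u (cnj z)) = 0"
proof -
  obtain q :: "'n \<Rightarrow> complex poly" where q: "p = (\<lambda>z. \<chi> i. poly (q i) z)"
    using p by (auto simp: vec_polys_def)
  define h where "h z = p (cnj z)" for z
  have hi: "(\<lambda>z. h z $ i) = (\<lambda>z. cnj (cnj (poly (q i) (cnj z))))" for i by (simp add: h_def q)
  have hLinf: "(\<lambda>z. h z $ i) \<in> Linf" for i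
    unfolding hi by (intro Linf_cnj HinfD(1) Hinf_cnj_poly_cnj)
  have h: "h \<in> L2" by (rule L2_Linf_vec[OF hLinf])
  have hc: "fourier_coeff (\<lambda>z. h z $ i) k = 0" if "k > 0" for i k
    unfolding hi using that HinfD(2)[OF Hinf_cnj_poly_cnj, of "-k" "q i"]
    by (subst fourier_coeff_cnj[OF Hinf_measurable[OF Hinf_cnj_poly_cnj]]) simp
  let ?w = "\<lambda>z. z powi 1 *s (F z *v u z)"
  have wL: "?w \<in> L2" by (intro L2_Linf_mult Linf_powi H2_L2 Fu)
  have wc: "fourier_coeff (\<lambda>z. ?w z $ i) k = 0" if "k \<le> 0" for i k
  proof -
    have "fourier_coeff (\<lambda>z. z powi 1 * (F z *v u z) $ i) k = fourier_coeff (\<lambda>z. (F z *v u z) $ i) (k - 1)"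
      by (rule fourier_coeff_shift[OF measurable_vec_nth[OF L2_measurable[OF H2_L2[OF Fu]]]])
    also have "\<dots> = 0" using Fu that by (simp add: H2_def)
    finally show ?thesis by simp
  qed
  let ?G = "\<lambda>z. cip (h z) (?w z)"
  have "L2_inner (\<lambda>z. tilde F z *v p z) (\<lambda>z. cnj z *s u (cnj z)) = (LINT z|circle. ?G (cnj z))"
    unfolding L2_inner_cip
    by (intro Bochner_Integration.integral_cong)
      (simp_all add: h_def tilde_def cip_matrix_left matrix_vector_mult_smult)
  also have "\<dots> = (LINT z|circle. ?G z)"
    by (rule integral_circle_cnj) (intro measurable_cip L2_measurable h wL)
  also have "\<dots> = L2_inner h ?w" by (simp add: L2_inner_cip)
  also have "\<dots> = 0"
  proof (rule L2_inner_disjoint_coeffs[OF h wL])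
    show "fourier_coeff (\<lambda>z. h z $ i) k = 0 \<or> fourier_coeff (\<lambda>z. ?w z $ i) k = 0" for i k
      using hc[of k i] wc[of k i] by linarith
  qed
  finally show ?thesis .
qed

lemma cip_axis_left: "cip (axis i c) w = c * cnj (w $ i)"
  by (simp add: cip_def axis_def mult_delta_left)

text \<open>The function with values cnj z u(cnj z) is orthogonal to the ranges of
  \<open>tilde F\<close> and \<open>tilde G\<close>, hence to \<open>H2\<close>. Owing to the factor
  cnj z, its pairings with z^m for m >= 0 are the conjugated coefficients of \<open>u\<close> of
  index - m - 1, which are exactly the negative ones.\<close>

theorem right_coprime_H2:
  fixes F G :: "complex \<Rightarrow> complex^'n^'n"
  assumes cop: "right_coprime F G" and F: "F \<in> Linf_mat" and G: "G \<in> Linf_mat" and u: "u \<in> L2"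
    and Fu: "(\<lambda>z. F z *v u z) \<in> H2" and Gu: "(\<lambda>z. G z *v u z) \<in> H2"
  shows "u \<in> H2"
proof -
  let ?v = "\<lambda>z. cnj z *s u (cnj z)"
  have v: "?v \<in> L2"
    by (rule L2_Linf_mult[OF Linf_cnj[OF HinfD(1)[OF Hinf_ident]] L2_cnj_arg[OF u]])
  define K where "K = {w \<in> L2. \<forall>g\<in>{?v}. L2_inner w g = 0}"
  have K: "L2_subspace K" unfolding K_def using v by (intro L2_subspace_orthogonal) simp
  have rng: "range_closure (tilde E) \<subseteq> K" if "E \<in> Linf_mat" "(\<lambda>z. E z *v u z) \<in> H2" for E :: "complex \<Rightarrow> complex^'n^'n"
    unfolding range_closure_def
    by (rule L2_closure_subset[OF K]) (use tilde_poly_orthogonal[OF that(1) u that(2)] in \<open>auto simp: K_def\<close>)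
  have "H2 \<subseteq> K"
    using cop closed_span_subset[OF K, of "range_closure (tilde F) \<union> range_closure (tilde G)"]
      rng[OF F Fu] rng[OF G Gu]
    by (simp add: right_coprime_def left_coprime_def)
  have "fourier_coeff (\<lambda>z. u z $ i) k = 0" if k: "k < 0" for i k
  proof -
    have ui: "(\<lambda>z. u z $ i) \<in> borel_measurable borel" by (intro measurable_vec_nth L2_measurable u)
    obtain m where m: "k = - int m - 1" by (rule that[of "nat (- k - 1)"]) (use k in simp)
    let ?G = "\<lambda>z. cip (fbasis (int m) i (cnj z)) (z *s u z)"
    have "fbasis (int m) i \<in> K" using \<open>H2 \<subseteq> K\<close> fbasis_H2[of "int m" i] by auto
    then have "0 = L2_inner (fbasis (int m) i) ?v" by (simp add: K_def)
    also have "\<dots> = (LINT z|circle. ?G (cnj z))" by (simp add: L2_inner_cip)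
    also have "\<dots> = (LINT z|circle. ?G z)"
      by (rule integral_circle_cnj)
        (intro measurable_cip L2_measurable L2_cnj_arg fbasis_L2 L2_Linf_mult HinfD(1)[OF Hinf_ident] u)
    also have "\<dots> = (LINT z|circle. cnj (u z $ i * z powi (- k)))"
      unfolding m
      by (intro Bochner_Integration.integral_cong)
        (simp_all add: cip_axis_left fbasis_def power_int_def nat_add_distrib mult_ac)
    also have "\<dots> = cnj (fourier_coeff (\<lambda>z. u z $ i) k)"
      unfolding fourier_coeff_def Bochner_Integration.integral_cnj ..
    finally show ?thesis by simp
  qed
  then show ?thesis using u by (simp add: H2_def)
qed

text \<open>The functions \<open>x\<close> with \<open>r\<^sup>m x\<close> in \<open>H2\<close> for all \<open>m\<close> form a shift-invariant subspace \<open>M\<close>. A wandering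
  vector \<open>J\<close>, orthogonal to \<open>z M\<close>, has constant modulus, and \<open>r J\<close> is again in \<open>M\<close>, so the negative
  coefficients of \<open>r\<close> are inner products of \<open>J\<close> with elements of \<open>z M\<close>.\<close>

theorem Hinf_if_powers_H2:
  fixes c :: "complex \<Rightarrow> complex^'n"
  assumes r: "r \<in> Linf" and pow: "\<And>m. (\<lambda>z. r z ^ m *s c z) \<in> H2" and nz: "\<not> (AE z in circle. c z = 0)"
  shows "r \<in> Hinf"
proof -
  have rm: "(\<lambda>z. r z ^ m) \<in> Linf" for m
    by (induction m) (auto intro: Linf_mult[OF r])
  define M where "M = (\<Inter>m\<in>UNIV. {x \<in> L2. (\<lambda>z. r z ^ m *s x z) \<in> (H2 :: (complex \<Rightarrow> complex^'n) set)})"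
  have M: "L2_subspace M"
    unfolding M_def by (intro L2_subspace_INT L2_subspace_preimage L2_subspace_H2 rm) simp
  have M_iff: "x \<in> M \<longleftrightarrow> x \<in> L2 \<and> (\<forall>m. (\<lambda>z. r z ^ m *s x z) \<in> H2)" for x
    by (auto simp: M_def)
  have MH: "x \<in> H2" if "x \<in> M" for x using that M_iff[of x] by (auto dest!: spec[of _ 0])
  have cM: "c \<in> M" using pow H2_L2[OF pow[of 0]] by (simp add: M_iff)
  have Mr: "(\<lambda>z. r z *s x z) \<in> M" if "x \<in> M" for x
    unfolding M_iff
  proof (intro conjI allI)
    show "(\<lambda>z. r z *s x z) \<in> L2" using that M_iff by (intro L2_Linf_mult[OF r]) auto
    fix m
    have "(\<lambda>z. r z ^ Suc m *s x z) \<in> H2" using that M_iff by blast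
    then show "(\<lambda>z. r z ^ m *s (r z *s x z)) \<in> H2" by (simp add: mult.commute)
  qed
  have Mz: "(\<lambda>z. z ^ k *s x z) \<in> M" if "x \<in> M" for x k
    unfolding M_iff
  proof (intro conjI allI)
    show "(\<lambda>z. z ^ k *s x z) \<in> L2" using that M_iff by (intro L2_Linf_mult[OF Linf_power]) auto
    fix m
    have "(\<lambda>z. r z ^ m *s x z) \<in> H2" using that M_iff by blast
    from H2_shift[OF this, of k] show "(\<lambda>z. r z ^ m *s (z ^ k *s x z)) \<in> H2" by (simp add: mult.commute)
  qed
  have cL: "(\<lambda>z. cnj z) \<in> Linf" by (rule Linf_cnj[OF HinfD(1)[OF Hinf_ident]])
  \<comment> \<open>\<open>Z\<close> is z M, phrased as a preimage so that
    \<open>L2_subspace_preimage\<close> makes it closed.\<close>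
  define Z where "Z = {x \<in> L2. (\<lambda>z. cnj z *s x z) \<in> M}"
  have Z: "L2_subspace Z" unfolding Z_def by (rule L2_subspace_preimage[OF M cL])
  have zz: "AE z in circle. cnj z * z = 1"
    using AE_circle_norm by eventually_elim (simp only: mult.commute[of "cnj _"] complex_norm_square[symmetric], simp)
  have shiftZ: "(\<lambda>z. z ^ Suc k *s x z) \<in> Z" if x: "x \<in> M" for x k
  proof -
    have L: "(\<lambda>z. z ^ Suc k *s x z) \<in> L2" by (rule H2_L2[OF MH[OF Mz[OF x]]])
    have "AE z in circle. z ^ k *s x z = cnj z *s (z ^ Suc k *s x z)"
      using zz by eventually_elim (simp add: mult.assoc[symmetric])
    then have "(\<lambda>z. cnj z *s (z ^ Suc k *s x z)) \<in> M"
      by (rule L2_subspace_cong_AE[OF M Mz[OF x]])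
        (intro L2_measurable L2_Linf_mult[OF cL] L)
    then show ?thesis using L by (simp add: Z_def)
  qed
  \<comment> \<open>Without such a \<open>J\<close> the subspaces M and z M agree, so
    \<open>c\<close> multiplied by any power of cnj z stays in \<open>H2\<close>; all coefficients
    of \<open>c\<close> then vanish.\<close>
  have "\<exists>J\<in>M. (\<forall>y\<in>Z. L2_inner J y = 0) \<and> \<not> (AE z in circle. J z = 0)"
  proof (rule ccontr)
    assume neg: "\<not> ?thesis"
    have MZ: "x \<in> Z" if x: "x \<in> M" for x
    proof -
      have xL: "x \<in> L2" using MH[OF x] by (rule H2_L2)
      obtain y where y: "y \<in> Z" and orth: "\<And>w. w \<in> Z \<Longrightarrow> L2_inner (\<lambda>z. x z - y z) w = 0"
        by (rule L2_projection[OF Z xL]) (rule that)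
      have yL: "y \<in> L2" using y by (simp add: Z_def)
      have "(\<lambda>z. z ^ 1 *s (cnj z *s y z)) \<in> M" by (rule Mz) (use y in \<open>simp add: Z_def\<close>)
      moreover have "AE z in circle. z ^ 1 *s (cnj z *s y z) = y z"
        using zz by eventually_elim (simp add: mult.commute)
      ultimately have "y \<in> M" by (rule L2_subspace_cong_AE[OF M _ _ L2_measurable[OF yL]])
      then have "(\<lambda>z. x z - y z) \<in> M" by (rule L2_subspace_diff[OF M x])
      then have "AE z in circle. x z - y z = 0" using neg orth by blast
      then have "AE z in circle. y z = x z" by eventually_elim simp
      then show ?thesis by (rule L2_subspace_cong_AE[OF Z y _ L2_measurable[OF xL]])
    qed
    have cnjM: "(\<lambda>z. cnj z ^ k *s c z) \<in> M" for k
    proof (induction k)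
      case 0
      then show ?case using cM by simp
    next
      case (Suc k)
      then have "(\<lambda>z. cnj z ^ k *s c z) \<in> Z" by (rule MZ)
      then have "(\<lambda>z. cnj z *s (cnj z ^ k *s c z)) \<in> M" by (simp only: Z_def mem_Collect_eq)
      then show ?case by simp
    qed
    have cL2: "c \<in> L2" using MH[OF cM] by (rule H2_L2)
    have "fourier_coeff (\<lambda>z. c z $ i) j = 0" for i j
    proof -
      define k where "k = nat (j + 1)"
      have cm: "(\<lambda>z. c z $ i) \<in> borel_measurable borel" by (intro measurable_vec_nth L2_measurable cL2)
      have "fourier_coeff (\<lambda>z. c z $ i) j = fourier_coeff (\<lambda>z. z powi (- int k) * c z $ i) (j - int k)"
        using fourier_coeff_shift[OF cm, of "- int k" "j - int k"] by simp
      also have "\<dots> = fourier_coeff (\<lambda>z. (cnj z ^ k *s c z) $ i) (j - int k)"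
      proof (rule fourier_coeff_cong_AE)
        show "AE z in circle. z powi (- int k) * c z $ i = (cnj z ^ k *s c z) $ i"
          using AE_circle_norm
          by eventually_elim (simp add: cnj_powi_circle[of _ "int k", symmetric])
        show "(\<lambda>z. z powi (- int k) * c z $ i) \<in> borel_measurable borel"
          by (intro borel_measurable_times powi_measurable cm)
        show "(\<lambda>z. (cnj z ^ k *s c z) $ i) \<in> borel_measurable borel"
          by (intro measurable_vec_nth L2_measurable H2_L2 MH cnjM)
      qed
      also have "\<dots> = 0"
        using MH[OF cnjM[of k]] by (simp add: H2_def k_def)
      finally show ?thesis .
    qed
    then have "AE z in circle. c z = 0" by (rule fourier_unique[OF cL2])
    then show False using nz by simp
  qed
  then obtain J where J: "J \<in> M" and orth: "\<And>y. y \<in> Z \<Longrightarrow> L2_inner J y = 0"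
    and J0: "\<not> (AE z in circle. J z = 0)" by blast
  have JL: "J \<in> L2" using MH[OF J] by (rule H2_L2)
  have orthZ: "(LINT z|circle. z ^ Suc k * cip (x z) (J z)) = 0" if x: "x \<in> M" for x k
  proof -
    have "L2_inner (\<lambda>z. z ^ Suc k *s x z) J = 0"
      using orth[OF shiftZ[OF x]] by (metis L2_inner_cnj complex_cnj_zero)
    then show ?thesis by (simp only: L2_inner_cip cip_scale_left)
  qed
  let ?s = "L2_sq J"
  have int: "integrable circle (\<lambda>z. cip (J z) (J z))" by (rule L2_cip_integrable[OF JL JL])
  have s: "(LINT z|circle. cip (J z) (J z)) = of_real ?s"
    using L2_inner_self[of J] by (simp only: L2_inner_cip)
  \<comment> \<open>For k > 0 the function z^k J lies in \<open>Z\<close> and is orthogonal to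
    \<open>J\<close>; k < 0 follows by conjugation. So the squared modulus of \<open>J\<close> has
    no coefficient except the one of index 0.\<close>
  have "null_coeffs (\<lambda>z. cip (J z) (J z) - of_real ?s)"
    unfolding null_coeffs_def
  proof (intro conjI allI)
    show "integrable circle (\<lambda>z. cip (J z) (J z) - of_real ?s)" using int by simp
    fix k :: int
    have ik: "integrable circle (\<lambda>z. cip (J z) (J z) * z powi k)" by (rule integrable_circle_mult_powi[OF int])
    have ic: "integrable circle (\<lambda>z. of_real ?s * z powi k)"
      by (rule integrable_circle_mult_powi) simp
    have "(LINT z|circle. (cip (J z) (J z) - of_real ?s) * z powi k) =
        (LINT z|circle. cip (J z) (J z) * z powi k) - of_real ?s * (LINT z|circle. z powi k)"
      using ik ic by (simp only: left_diff_distrib Bochner_Integration.integral_diff Bochner_Integration.integral_mult_right_zero)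
    also have "\<dots> = 0"
    proof -
      have pos: "(LINT z|circle. cip (J z) (J z) * z powi int (Suc n)) = 0" for n
        using orthZ[OF J, of n] by (simp only: power_int_of_nat mult.commute)
      consider "k = 0" | n where "k = int (Suc n)" | n where "k = - int (Suc n)"
        using that(1) that(2)[of "nat (k - 1)"] that(3)[of "nat (- k - 1)"] by linarith
      then show ?thesis
      proof cases
        case 1
        then show ?thesis using s by (simp add: integral_circle_powi)
      next
        case 2
        show ?thesis unfolding 2 pos integral_circle_powi by simp
      next
        case (3 n)
        have "(LINT z|circle. cip (J z) (J z) * z powi k) = (LINT z|circle. cnj (cip (J z) (J z) * z powi int (Suc n)))"
        proof (rule integral_cong_AE)
          show "AE z in circle. cip (J z) (J z) * z powi k = cnj (cip (J z) (J z) * z powi int (Suc n))"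
            using AE_circle_norm
          proof eventually_elim
            case (elim z)
            show ?case
              unfolding complex_cnj_mult cip_cnj complex_cnj_power_int cnj_powi_circle[OF elim] 3
              by (rule refl)
          qed
          show "(\<lambda>z. cip (J z) (J z) * z powi k) \<in> borel_measurable circle"
            by (rule borel_measurable_integrable[OF ik])
          show "(\<lambda>z. cnj (cip (J z) (J z) * z powi int (Suc n))) \<in> borel_measurable circle"
            by (rule measurable_cnj[OF borel_measurable_integrable[OF integrable_circle_mult_powi[OF int]]])
        qed
        also have "\<dots> = 0"
          unfolding Bochner_Integration.integral_cnj pos by simp
        finally show ?thesis using 3 by (simp add: integral_circle_powi)
      qed
    qed
    finally show "(LINT z|circle. (cip (J z) (J z) - of_real ?s) * z powi k) = 0" .
  qed
  from fourier_unique_L1[OF this]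
  have const: "AE z in circle. cip (J z) (J z) = of_real ?s" by eventually_elim simp
  have "?s \<noteq> 0" using J0 L2_zero_iff[OF JL] by simp
  have "fourier_coeff r k = 0" if "k < 0" for k
  proof -
    obtain n where n: "k = - int (Suc n)" by (rule that[of "nat (- k - 1)"]) (use \<open>k < 0\<close> in simp)
    have rJ: "(\<lambda>z. r z *s J z) \<in> M" by (rule Mr[OF J])
    have "0 = (LINT z|circle. z ^ Suc n * cip (r z *s J z) (J z))"
      by (rule orthZ[OF rJ, symmetric])
    also have "\<dots> = (LINT z|circle. of_real ?s * (r z * z powi - k))"
    proof (rule integral_cong_AE)
      show "AE z in circle. z ^ Suc n * cip (r z *s J z) (J z) = of_real ?s * (r z * z powi - k)"
        using const
      proof eventually_elim
        case (elim z)
        have "z powi - k = z ^ Suc n" unfolding n by (simp only: minus_minus power_int_of_nat)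
        then show ?case unfolding cip_scale_left elim by (simp add: mult_ac)
      qed
      show "(\<lambda>z. z ^ Suc n * cip (r z *s J z) (J z)) \<in> borel_measurable circle"
        using measurable_cip[OF L2_measurable[OF H2_L2[OF MH[OF rJ]]] L2_measurable[OF JL]] by simp
      show "(\<lambda>z. of_real ?s * (r z * z powi - k)) \<in> borel_measurable circle"
        using borel_measurable_times[OF LinfD(1)[OF r] powi_measurable[of "-k"]] by simp
    qed
    also have "\<dots> = of_real ?s * fourier_coeff r k"
      unfolding fourier_coeff_def by (rule Bochner_Integration.integral_mult_right_zero)
    finally show ?thesis using \<open>?s \<noteq> 0\<close> by simp
  qed
  then show ?thesis using r by (simp add: Hinf_def)
qed

text \<open>The recursion divides by positive integers only, so it stays inside the algebra
  \<open>Hinf\<close>.\<close>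

lemma
  fixes A :: "complex \<Rightarrow> complex^'n^'n"
  assumes A: "A \<in> Hinf_mat"
  shows fl_mat_Hinf: "(\<lambda>z. fl_mat (A z) k $ i $ j) \<in> Hinf" and fl_coeff_Hinf: "(\<lambda>z. fl_coeff (A z) k) \<in> Hinf"
proof -
  have Aij: "(\<lambda>z. A z $ i $ j) \<in> Hinf" for i j using A by (simp add: Hinf_mat_def)
  have "(\<forall>i j. (\<lambda>z. fl_mat (A z) k $ i $ j) \<in> Hinf) \<and> (\<lambda>z. fl_coeff (A z) k) \<in> Hinf"
  proof (induction k)
    case 0
    then show ?case by (simp add: fl_mat_0 mat_def)
  next
    case (Suc k)
    have AN: "(\<lambda>z. (A z ** fl_mat (A z) k) $ i $ j) \<in> Hinf" for i j
      unfolding matrix_matrix_mult_def using Suc Aij by (auto intro!: Hinf_sum Hinf_mult)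
    have "fl_coeff (A z) (Suc k) = (- 1 / of_nat (Suc k)) * (\<Sum>i\<in>UNIV. (A z ** fl_mat (A z) k) $ i $ i)" for z
      using fl_coeff_Suc[of k "A z"] by (simp add: trace_def field_simps del: of_nat_Suc)
    then have e: "(\<lambda>z. fl_coeff (A z) (Suc k)) \<in> Hinf"
      using AN by (simp only:) (intro Hinf_mult Hinf_sum Hinf_const, auto)
    moreover have "(\<lambda>z. fl_mat (A z) (Suc k) $ i $ j) \<in> Hinf" for i j
      unfolding fl_mat_Suc using AN[of i j] e by (cases "i = j") (auto intro: Hinf_add)
    ultimately show ?case by blast
  qed
  then show "(\<lambda>z. fl_mat (A z) k $ i $ j) \<in> Hinf" "(\<lambda>z. fl_coeff (A z) k) \<in> Hinf" by auto
qed

text \<open>Membership in \<open>I\<close> descends from \<open>fl_mat A CARD('n) = 0\<close> to \<open>fl_mat A 0 = 1\<close>: the trace of \<open>fl_mat A k\<close> is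
  a nonzero multiple of \<open>fl_coeff A k\<close> for \<open>k < CARD('n)\<close>, and \<open>inj\<close> then removes one factor \<open>A\<close>.\<close>

theorem fl_descent:
  fixes A :: "complex \<Rightarrow> complex^'n^'n"
  assumes A: "A \<in> Hinf_mat"
    and zero: "(\<lambda>z. 0) \<in> I"
    and add: "\<And>f g. f \<in> I \<Longrightarrow> g \<in> I \<Longrightarrow> (\<lambda>z. f z + g z) \<in> I"
    and scale: "\<And>f c. f \<in> I \<Longrightarrow> (\<lambda>z. c * f z) \<in> I"
    and inj: "\<And>v i. (\<And>i. (\<lambda>z. v z $ i) \<in> Hinf) \<Longrightarrow> (\<And>i. (\<lambda>z. (A z *v v z) $ i) \<in> I) \<Longrightarrow> (\<lambda>z. v z $ i) \<in> I"
    and last: "(\<lambda>z. fl_coeff (A z) CARD('n)) \<in> I"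
  shows "(\<lambda>z. 1) \<in> I"
proof -
  let ?n = "CARD('n)"
  have sum: "finite S \<Longrightarrow> (\<And>i. i \<in> S \<Longrightarrow> f i \<in> I) \<Longrightarrow> (\<lambda>z. \<Sum>i\<in>S. f i z) \<in> I" for S :: "'n set" and f
    by (induction S rule: finite_induct) (auto intro: add zero)
  have "k \<le> ?n \<Longrightarrow> (\<lambda>z. fl_mat (A z) (?n - k) $ i $ j) \<in> I" for k i j
  proof (induction k arbitrary: i j)
    case 0
    then show ?case using zero by (simp add: fl_mat_CARD)
  next
    case (Suc k)
    define m where "m = ?n - Suc k"
    have m: "?n - k = Suc m" "Suc m \<le> ?n" using Suc.prems by (auto simp: m_def)
    have IH: "(\<lambda>z. fl_mat (A z) (Suc m) $ i $ j) \<in> I" for i j using Suc m by simp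
    have e: "(\<lambda>z. fl_coeff (A z) (Suc m)) \<in> I"
    proof (cases "Suc m = ?n")
      case True
      then show ?thesis using last by simp
    next
      case False
      then have "of_nat ?n - of_nat (Suc m) \<noteq> (0::complex)" by (simp del: of_nat_Suc)
      then have "fl_coeff (A z) (Suc m) = (1 / (of_nat ?n - of_nat (Suc m))) * (\<Sum>i\<in>UNIV. fl_mat (A z) (Suc m) $ i $ i)" for z
        using trace_fl_mat[of "A z" "Suc m"] by (simp add: trace_def field_simps del: of_nat_Suc)
      then show ?thesis using IH by (simp only:) (intro scale sum, auto)
    qed
    \<comment> \<open>\<open>A\<close> times column \<open>j\<close> of \<open>fl_mat A m\<close> is
      column \<open>j\<close> of \<open>fl_mat A (Suc m)\<close> minus
      \<open>fl_coeff A (Suc m)\<close> times a unit vector; both terms have entries in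
      \<open>I\<close> by now.\<close>
    have "(\<lambda>z. (\<chi> l. fl_mat (A z) m $ l $ j) $ i) \<in> I"
    proof (rule inj)
      show "(\<lambda>z. (\<chi> l. fl_mat (A z) m $ l $ j) $ i) \<in> Hinf" for i using fl_mat_Hinf[OF A] by simp
      fix i
      have "(A z *v (\<chi> l. fl_mat (A z) m $ l $ j)) $ i =
          fl_mat (A z) (Suc m) $ i $ j + (if i = j then -1 else 0) * fl_coeff (A z) (Suc m)" for z
        unfolding fl_mat_Suc by (simp add: matrix_vector_mult_def matrix_matrix_mult_def)
      then show "(\<lambda>z. (A z *v (\<chi> l. fl_mat (A z) m $ l $ j)) $ i) \<in> I"
        by (simp only:) (intro add IH scale e)
    qed
    then show ?case by (simp add: m_def)
  qed
  \<comment> \<open>Both indices are the same arbitrary one, so this is a diagonal entry of the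
    identity matrix.\<close>
  from this[of ?n undefined undefined] show ?thesis by (simp add: fl_mat_0 mat_def)
qed

subsection \<open>Projections and the shift\<close>

definition vcoeff :: "(complex \<Rightarrow> complex^'n) \<Rightarrow> int \<Rightarrow> complex^'n" where
  "vcoeff f k = (\<chi> i. fourier_coeff (\<lambda>z. f z $ i) k)"

lemma vcoeff_nth: "vcoeff f k $ i = fourier_coeff (\<lambda>z. f z $ i) k"
  by (simp add: vcoeff_def)

lemma vcoeff_matrix:
  fixes f :: "complex \<Rightarrow> complex^'n"
  assumes f: "f \<in> L2" shows "vcoeff (\<lambda>z. A *v f z) k = A *v vcoeff f k"
proof -
  have i: "integrable circle (\<lambda>z. f z $ j * z powi - k)" for j
    by (rule integrable_circle_mult_powi[OF L2_component_integrable[OF f]])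
  have "fourier_coeff (\<lambda>z. \<Sum>j\<in>UNIV. A $ i $ j * f z $ j) k = (\<Sum>j\<in>UNIV. A $ i $ j * fourier_coeff (\<lambda>z. f z $ j) k)" for i
    unfolding fourier_coeff_def sum_distrib_right mult.assoc
    using i by (subst Bochner_Integration.integral_sum) auto
  then show ?thesis by (simp add: vcoeff_def vec_eq_iff matrix_vector_mult_def)
qed

lemma vcoeff_lin:
  assumes f: "f \<in> L2" and g: "g \<in> L2"
  shows "vcoeff (\<lambda>z. f z + c *s g z) k = vcoeff f k + c *s vcoeff g k"
proof -
  have fg: "(\<lambda>z. f z + c *s g z) \<in> L2" by (intro L2_add L2_scale f g)
  show ?thesis
    by (simp add: vec_eq_iff vcoeff_nth fourier_coeff_inner[OF f] fourier_coeff_inner[OF g]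
        fourier_coeff_inner[OF fg, simplified] L2_inner_lin_left[OF f g])
qed

lemma vcoeff_shift:
  assumes f: "f \<in> L2" shows "vcoeff (\<lambda>z. z ^ n *s f z) k = vcoeff f (k - int n)"
proof -
  have "fourier_coeff (\<lambda>z. z powi int n * f z $ i) k = fourier_coeff (\<lambda>z. f z $ i) (k - int n)" for i
    by (rule fourier_coeff_shift[OF measurable_vec_nth[OF L2_measurable[OF f]]])
  then show ?thesis by (simp add: vcoeff_def vec_eq_iff)
qed

lemma vcoeff_cong_AE:
  assumes "f \<in> L2" "g \<in> L2" "AE z in circle. f z = g z" shows "vcoeff f k = vcoeff g k"
proof -
  have "fourier_coeff (\<lambda>z. f z $ i) k = fourier_coeff (\<lambda>z. g z $ i) k" for i
    using assms(3) by (intro fourier_coeff_cong_AE measurable_vec_nth L2_measurable assms(1,2)) auto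
  then show ?thesis by (simp add: vcoeff_def)
qed

lemma vcoeff_H2: "f \<in> H2 \<Longrightarrow> k < 0 \<Longrightarrow> vcoeff f k = 0"
  by (simp add: vcoeff_def H2_def vec_eq_iff)

lemma vcoeff_const: "vcoeff (\<lambda>z. c) k = (if k = 0 then c else 0)"
  by (simp add: vcoeff_def vec_eq_iff fourier_coeff_def integral_circle_powi)

lemma vcoeff_unique:
  assumes "f \<in> L2" "g \<in> L2" "\<And>k. vcoeff f k = vcoeff g k"
  shows "AE z in circle. f z = g z"
proof -
  have "fourier_coeff (\<lambda>z. (f z - g z) $ i) k = 0" for i k
    using assms(3)[of k] unfolding fourier_coeff_vec_diff[OF assms(1,2)]
    by (simp add: vcoeff_def vec_eq_iff)
  from fourier_unique[OF L2_diff[OF assms(1,2)] this]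
  show ?thesis by eventually_elim simp
qed

lemma vcoeff_proj_H2:
  assumes f: "f \<in> L2" shows "vcoeff (proj_H2 f) k = (if k \<ge> 0 then vcoeff f k else 0)"
proof (cases "k \<ge> 0")
  case True
  have p: "proj_H2 f \<in> L2" by (rule H2_L2[OF proj_H2_in[OF f]])
  have "L2_inner (proj_H2 f) (fbasis k i) = L2_inner f (fbasis k i)" for i
    by (rule L2_inner_proj_H2_left[OF f fbasis_H2[OF True]])
  then show ?thesis
    using True by (simp add: vec_eq_iff vcoeff_nth fourier_coeff_inner[OF f] fourier_coeff_inner[OF p])
next
  case False
  then show ?thesis using vcoeff_H2[OF proj_H2_in[OF f]] by simp
qed

lemma const_H2: "(\<lambda>z. c) \<in> H2"
  by (auto simp: H2_def L2_def fourier_coeff_def integral_circle_powi)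

text \<open>Multiplication by z carries the coefficient of index -1, and no other, across the
  boundary to index 0.\<close>

lemma proj_H2_shift:
  assumes w: "w \<in> L2"
  shows "AE z in circle. proj_H2 (\<lambda>z. z ^ 1 *s w z) z = z ^ 1 *s proj_H2 w z + 1 *s vcoeff w (-1)"
proof (rule vcoeff_unique)
  have zw: "(\<lambda>z. z ^ 1 *s w z) \<in> L2" by (rule L2_Linf_mult[OF Linf_power w])
  have p: "proj_H2 w \<in> H2" by (rule proj_H2_in[OF w])
  have zp: "(\<lambda>z. z ^ 1 *s proj_H2 w z) \<in> L2" by (rule H2_L2[OF H2_shift[OF p]])
  have c: "(\<lambda>z. vcoeff w (-1)) \<in> L2" by (rule H2_L2[OF const_H2])
  show "proj_H2 (\<lambda>z. z ^ 1 *s w z) \<in> L2" by (rule H2_L2[OF proj_H2_in[OF zw]])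
  show "(\<lambda>z. z ^ 1 *s proj_H2 w z + 1 *s vcoeff w (-1)) \<in> L2"
    by (intro L2_add L2_scale zp c)
  fix k
  show "vcoeff (proj_H2 (\<lambda>z. z ^ 1 *s w z)) k = vcoeff (\<lambda>z. z ^ 1 *s proj_H2 w z + 1 *s vcoeff w (-1)) k"
    unfolding vcoeff_proj_H2[OF zw] vcoeff_lin[OF zp c] vcoeff_shift[OF w] vcoeff_shift[OF H2_L2[OF p]]
      vcoeff_proj_H2[OF w] vcoeff_const
    by auto
qed

lemma L2_inner_const: "L2_inner (\<lambda>z. c) (\<lambda>z. d) = cip c d"
  by (simp add: L2_inner_cip)

text \<open>z times a function in \<open>H2\<close> is orthogonal to constants, so the mixed terms
  arising from \<open>proj_H2_shift\<close> drop out.\<close>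

lemma proj_H2_shift_inner:
  assumes w: "w \<in> L2" and w': "w' \<in> L2"
  shows "L2_inner (proj_H2 (\<lambda>z. z ^ 1 *s w z)) (proj_H2 (\<lambda>z. z ^ 1 *s w' z)) =
    L2_inner (proj_H2 w) (proj_H2 w') + cip (vcoeff w (-1)) (vcoeff w' (-1))"
proof -
  let ?p = "proj_H2 w" and ?q = "proj_H2 w'" and ?c = "vcoeff w (-1)" and ?d = "vcoeff w' (-1)"
  let ?zp = "\<lambda>z. z ^ 1 *s ?p z" and ?zq = "\<lambda>z. z ^ 1 *s ?q z"
  have zw: "(\<lambda>z. z ^ 1 *s w z) \<in> L2" and zw': "(\<lambda>z. z ^ 1 *s w' z) \<in> L2"
    by (rule L2_Linf_mult[OF Linf_power w] L2_Linf_mult[OF Linf_power w'])+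
  have p: "?p \<in> H2" and q: "?q \<in> H2" using proj_H2_in w w' by auto
  have zp: "?zp \<in> L2" and zq: "?zq \<in> L2" by (rule H2_L2[OF H2_shift[OF p]] H2_L2[OF H2_shift[OF q]])+
  have c: "(\<lambda>z. ?c) \<in> L2" and d: "(\<lambda>z. ?d) \<in> L2" using H2_L2[OF const_H2] by auto
  have zpc: "(\<lambda>z. ?zp z + 1 *s ?c) \<in> L2" and zqd: "(\<lambda>z. ?zq z + 1 *s ?d) \<in> L2"
    by (intro L2_add L2_scale zp zq c d)+
  have disj: "L2_inner (\<lambda>z. z ^ 1 *s f z) (\<lambda>z. e) = 0" if f: "f \<in> H2" for f :: "complex \<Rightarrow> complex^'a" and e
  proof (rule L2_inner_disjoint_coeffs[OF H2_L2[OF H2_shift[OF f]] H2_L2[OF const_H2]])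
    fix i k
    show "fourier_coeff (\<lambda>z. (z ^ 1 *s f z) $ i) k = 0 \<or> fourier_coeff (\<lambda>z. e $ i) k = 0"
    proof (cases "k = 0")
      case True
      have "vcoeff (\<lambda>z. z ^ 1 *s f z) k = 0"
        unfolding vcoeff_shift[OF H2_L2[OF f]] using True by (intro vcoeff_H2[OF f]) simp
      then have "vcoeff (\<lambda>z. z ^ 1 *s f z) k $ i = 0" by simp
      then show ?thesis unfolding vcoeff_nth by (rule disjI1)
    next
      case False
      then have "vcoeff (\<lambda>z. e) k $ i = 0" by (simp add: vcoeff_const)
      then show ?thesis unfolding vcoeff_nth by (rule disjI2)
    qed
  qed
  have "L2_inner (proj_H2 (\<lambda>z. z ^ 1 *s w z)) (proj_H2 (\<lambda>z. z ^ 1 *s w' z)) =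
      L2_inner (\<lambda>z. ?zp z + 1 *s ?c) (\<lambda>z. ?zq z + 1 *s ?d)"
    by (rule L2_inner_cong_AE[OF H2_L2[OF proj_H2_in[OF zw]] zpc H2_L2[OF proj_H2_in[OF zw']] zqd
          proj_H2_shift[OF w] proj_H2_shift[OF w']])
  also have "\<dots> = L2_inner ?zp (\<lambda>z. ?zq z + 1 *s ?d) + 1 * L2_inner (\<lambda>z. ?c) (\<lambda>z. ?zq z + 1 *s ?d)"
    by (rule L2_inner_lin_left[OF zp c zqd])
  also have "L2_inner ?zp (\<lambda>z. ?zq z + 1 *s ?d) = cnj (L2_inner (\<lambda>z. ?zq z + 1 *s ?d) ?zp)"
    by (simp only: L2_inner_cnj)
  also have "L2_inner (\<lambda>z. ?zq z + 1 *s ?d) ?zp = L2_inner ?zq ?zp + 1 * L2_inner (\<lambda>z. ?d) ?zp"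
    by (rule L2_inner_lin_left[OF zq d zp])
  also have "L2_inner (\<lambda>z. ?d) ?zp = 0" using disj[OF p] by (metis L2_inner_cnj complex_cnj_zero)
  also have "L2_inner (\<lambda>z. ?c) (\<lambda>z. ?zq z + 1 *s ?d) = cnj (L2_inner (\<lambda>z. ?zq z + 1 *s ?d) (\<lambda>z. ?c))"
    by (simp only: L2_inner_cnj)
  also have "L2_inner (\<lambda>z. ?zq z + 1 *s ?d) (\<lambda>z. ?c) = L2_inner ?zq (\<lambda>z. ?c) + 1 * L2_inner (\<lambda>z. ?d) (\<lambda>z. ?c)"
    by (rule L2_inner_lin_left[OF zq d c])
  also have "L2_inner ?zq (\<lambda>z. ?c) = 0" by (rule disj[OF q])
  finally have "L2_inner (proj_H2 (\<lambda>z. z ^ 1 *s w z)) (proj_H2 (\<lambda>z. z ^ 1 *s w' z)) =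
      L2_inner ?zp ?zq + cip ?c ?d"
    by (simp only: mult_1_left mult_zero_right add_0_right add_0_left L2_inner_cnj L2_inner_const cip_cnj)
  also have "L2_inner ?zp ?zq = L2_inner ?p ?q"
    unfolding L2_inner_cip
  proof (rule integral_cong_AE)
    show "AE z in circle. cip (?zp z) (?zq z) = cip (?p z) (?q z)"
      using AE_norm_power_1[of 1]
    proof eventually_elim
      case (elim z)
      have "cnj (z ^ 1) * z ^ 1 = 1"
        using elim by (simp only: mult.commute[of "cnj _"] complex_norm_square[symmetric]) simp
      then have "cip (?zp z) (?zq z) = 1 * cip (?p z) (?q z)"
        by (simp only: cip_scale_left cip_scale_right mult.assoc[symmetric])
      then show ?case by simp
    qed
  qed (use L2_measurable[OF zp] L2_measurable[OF zq] L2_measurable[OF H2_L2[OF p]] L2_measurable[OF H2_L2[OF q]]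
      in \<open>simp_all add: measurable_cip\<close>)
  finally show ?thesis .
qed

lemma adjoint_pair_cong_AE:
  assumes A: "adjoint_pair A A'" and f: "f \<in> H2" and g: "g \<in> H2" and fg: "AE z in circle. f z = g z"
  shows "AE z in circle. A f z = A g z"
proof (rule H2_orthogonal_unique[OF adjoint_pairD(1)[OF A f] adjoint_pairD(1)[OF A g]])
  fix h :: "complex \<Rightarrow> complex^'a" assume h: "h \<in> H2"
  have A'h: "A' h \<in> L2" by (rule H2_L2[OF adjoint_pairD(2)[OF A h]])
  have "L2_inner f (A' h) = L2_inner g (A' h)"
    by (rule L2_inner_cong_AE[OF H2_L2[OF f] H2_L2[OF g] A'h A'h fg]) simp
  then show "L2_inner (A f) h = L2_inner (A g) h" by (simp only: adjoint_pairD(3)[OF A _ h] f g)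
qed

lemma proj_H2_cong_AE:
  assumes f: "f \<in> L2" and g: "g \<in> L2" and fg: "AE z in circle. f z = g z"
  shows "AE z in circle. proj_H2 f z = proj_H2 g z"
proof (rule vcoeff_unique[OF H2_L2[OF proj_H2_in[OF f]] H2_L2[OF proj_H2_in[OF g]]])
  show "vcoeff (proj_H2 f) k = vcoeff (proj_H2 g) k" for k
    by (simp only: vcoeff_proj_H2[OF f] vcoeff_proj_H2[OF g] vcoeff_cong_AE[OF f g fg])
qed

lemma L2_inner_proj_H2_split:
  assumes f: "f \<in> L2" and g: "g \<in> L2"
  shows "L2_inner f g = L2_inner (proj_H2 f) (proj_H2 g) + L2_inner (\<lambda>z. f z - proj_H2 f z) (\<lambda>z. g z - proj_H2 g z)"
proof -
  let ?p = "proj_H2 f" and ?q = "proj_H2 g"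
  have p: "?p \<in> H2" and q: "?q \<in> H2" using proj_H2_in f g by auto
  have x: "(\<lambda>z. f z - ?p z) \<in> L2" and y: "(\<lambda>z. g z - ?q z) \<in> L2"
    by (intro L2_diff f g H2_L2[OF p] H2_L2[OF q])+
  have "L2_inner (\<lambda>z. f z - ?p z) (\<lambda>z. g z - ?q z) = L2_inner (\<lambda>z. f z - ?p z) g - L2_inner (\<lambda>z. f z - ?p z) ?q"
    by (rule L2_inner_diff_right[OF g H2_L2[OF q] x])
  also have "L2_inner (\<lambda>z. f z - ?p z) ?q = 0" by (rule proj_H2_orth[OF f q])
  also have "L2_inner (\<lambda>z. f z - ?p z) g = L2_inner f g - L2_inner ?p g"
    by (rule L2_inner_diff_left[OF f H2_L2[OF p] g])
  also have "L2_inner ?p g = L2_inner ?p ?q" by (rule L2_inner_proj_H2_right[OF g p, symmetric])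
  finally show ?thesis by simp
qed

subsection \<open>Square-hyponormal Toeplitz operators\<close>

locale square_hyponormal =
  fixes \<Phi> \<Phi>\<^sub>1 :: "complex \<Rightarrow> complex^'n^'n" and \<theta> :: "complex \<Rightarrow> complex"
  assumes \<Phi>: "\<Phi> \<in> Linf_mat" and inner: "inner_function \<theta>" and \<Phi>1: "\<Phi>\<^sub>1 \<in> Hinf_mat"
    and factor: "AE z in circle. \<Phi> z = \<Phi>\<^sub>1 z ** mat (cnj (\<theta> z))"
    and coprime: "right_coprime (\<lambda>z. mat (\<theta> z)) \<Phi>\<^sub>1"
    and hypo: "H2_hyponormal (toeplitz \<Phi>)" and hypo2: "H2_hyponormal (toeplitz \<Phi> ^^ 2)"
begin

abbreviation ct where "ct z \<equiv> conj_transpose (\<Phi> z)"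
abbreviation T where "T \<equiv> toeplitz \<Phi>"
abbreviation T' where "T' \<equiv> toeplitz ct"

lemma ct_Linf: "ct \<in> Linf_mat"
  by (rule conj_transpose_Linf_mat[OF \<Phi>])

lemma adj: "adjoint_pair T T'"
  by (rule adjoint_pair_toeplitz[OF \<Phi>])

lemmas \<Phi>_L2 = L2_Linf_mat_mult[OF \<Phi>] and ct_L2 = L2_Linf_mat_mult[OF ct_Linf]

lemma theta_Hinf: "\<theta> \<in> Hinf" and theta_norm: "AE z in circle. norm (\<theta> z) = 1"
  using inner by (auto simp: inner_function_def)

lemma cnj_theta_Linf: "(\<lambda>z. cnj (\<theta> z)) \<in> Linf"
  by (rule Linf_cnj[OF HinfD(1)[OF theta_Hinf]])

lemma theta_cnj: "AE z in circle. cnj (\<theta> z) * \<theta> z = 1"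
  using theta_norm
  by eventually_elim (simp only: mult.commute[of "cnj _"] complex_norm_square[symmetric], simp)

lemma mat_mult_vec: "mat c *v v = c *s (v :: complex^'n)"
  by (simp add: vec_eq_iff matrix_vector_mult_def mat_def mult_delta_left)

lemma factor_vec: "AE z in circle. \<forall>v. \<Phi> z *v v = \<Phi>\<^sub>1 z *v (cnj (\<theta> z) *s v)"
  using factor by eventually_elim (simp add: matrix_matrix_vector_mult mat_mult_vec)

lemma \<Phi>1_Linf: "\<Phi>\<^sub>1 \<in> Linf_mat"
  using \<Phi>1 by (auto simp: Hinf_mat_def Linf_mat_def HinfD)

lemma coprimeD:
  assumes u: "u \<in> L2" and \<theta>u: "(\<lambda>z. \<theta> z *s u z) \<in> H2" and \<Phi>u: "(\<lambda>z. \<Phi>\<^sub>1 z *v u z) \<in> H2"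
  shows "u \<in> H2"
proof (rule right_coprime_H2[OF coprime _ \<Phi>1_Linf u _ \<Phi>u])
  have "(\<lambda>z. if i = j then \<theta> z else 0) \<in> Linf" for i j :: 'n
    using HinfD(1)[OF theta_Hinf] by (cases "i = j") auto
  then show "(\<lambda>z. mat (\<theta> z)) \<in> (Linf_mat :: (complex \<Rightarrow> complex^'n^'n) set)"
    by (simp add: Linf_mat_def mat_def)
qed (simp add: mat_mult_vec \<theta>u)

lemma commute: "AE z in circle. \<forall>v. ct z *v (\<Phi> z *v v) = \<Phi> z *v (ct z *v v)"
  using hyponormal_toeplitz_normal_symbol[OF \<Phi> hypo]
  by eventually_elim (metis matrix_matrix_vector_mult)

lemma normal_cip: "AE z in circle. \<forall>u v. cip (\<Phi> z *v u) (\<Phi> z *v v) = cip (ct z *v u) (ct z *v v)"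
  using commute by eventually_elim (simp add: cip_matrix_left)

lemma L2_inner_\<Phi>_ct:
  assumes f: "f \<in> L2" and g: "g \<in> L2"
  shows "L2_inner (\<lambda>z. \<Phi> z *v f z) (\<lambda>z. \<Phi> z *v g z) = L2_inner (\<lambda>z. ct z *v f z) (\<lambda>z. ct z *v g z)"
  unfolding L2_inner_cip
proof (rule integral_cong_AE)
  show "AE z in circle. cip (\<Phi> z *v f z) (\<Phi> z *v g z) = cip (ct z *v f z) (ct z *v g z)"
    using normal_cip by eventually_elim simp
qed (use L2_measurable[OF \<Phi>_L2[OF f]] L2_measurable[OF \<Phi>_L2[OF g]] L2_measurable[OF ct_L2[OF f]]
    L2_measurable[OF ct_L2[OF g]] in \<open>simp_all add: measurable_cip\<close>)

lemma L2_sq_\<Phi>_ct: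
  assumes f: "f \<in> L2" shows "L2_sq (\<lambda>z. \<Phi> z *v f z) = L2_sq (\<lambda>z. ct z *v f z)"
  using L2_inner_\<Phi>_ct[OF f f] unfolding L2_inner_self by (simp only: of_real_eq_iff)

lemma T_eq: "f \<in> H2 \<Longrightarrow> (\<lambda>z. \<Phi> z *v f z) \<in> H2 \<Longrightarrow> AE z in circle. T f z = \<Phi> z *v f z"
  unfolding toeplitz_def by (rule proj_H2_ident)

lemma T'_eq: "f \<in> H2 \<Longrightarrow> (\<lambda>z. ct z *v f z) \<in> H2 \<Longrightarrow> AE z in circle. T' f z = ct z *v f z"
  unfolding toeplitz_def by (rule proj_H2_ident)

text \<open>Normality of the symbol and hyponormality give norm(\<Phi> f) = norm(ct f) = norm(T' f)
  <= norm(T f), so the projection in \<open>T f\<close> loses nothing. For u = f times the conjugate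
  of \<theta>, both \<theta> u = f and \<open>\<Phi>\<^sub>1\<close> u = \<Phi> f are analytic, and
  coprimeness applies.\<close>

lemma ct_H2_imp_\<Phi>_H2:
  assumes f: "f \<in> H2" and ctf: "(\<lambda>z. ct z *v f z) \<in> H2"
  shows "(\<lambda>z. \<Phi> z *v f z) \<in> H2" "(\<lambda>z. cnj (\<theta> z) *s f z) \<in> H2"
proof -
  have fL: "f \<in> L2" using f by (rule H2_L2)
  let ?w = "\<lambda>z. \<Phi> z *v f z"
  have wL: "?w \<in> L2" by (rule \<Phi>_L2[OF fL])
  have Tf: "proj_H2 ?w \<in> H2" by (rule proj_H2_in[OF wL])
  have "L2_sq ?w = L2_sq (\<lambda>z. ct z *v f z)" by (rule L2_sq_\<Phi>_ct[OF fL])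
  also have "\<dots> = L2_sq (T' f)"
    by (rule L2_sq_cong_AE[OF ct_L2[OF fL] H2_L2[OF adjoint_pairD(2)[OF adj f]]])
      (use T'_eq[OF f ctf] in eventually_elim, simp)
  also have "\<dots> \<le> L2_sq (T f)" by (rule H2_hyponormalD[OF adj hypo f])
  finally have "L2_sq ?w \<le> L2_sq (proj_H2 ?w)" by (simp only: toeplitz_def)
  moreover have "0 \<le> L2_sq (\<lambda>z. ?w z - proj_H2 ?w z)" by simp
  ultimately have "L2_sq (\<lambda>z. ?w z - proj_H2 ?w z) = 0" using L2_sq_proj_H2[OF wL] by linarith
  then have "AE z in circle. ?w z - proj_H2 ?w z = 0"
    using L2_zero_iff[OF L2_diff[OF wL H2_L2[OF Tf]]] by blast
  then have "AE z in circle. proj_H2 ?w z = ?w z" by eventually_elim simp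
  from H2_cong_AE[OF Tf this L2_measurable[OF wL]] show wH: "?w \<in> H2" .
  let ?u = "\<lambda>z. cnj (\<theta> z) *s f z"
  have uL: "?u \<in> L2" by (rule L2_Linf_mult[OF cnj_theta_Linf fL])
  show "?u \<in> H2"
  proof (rule coprimeD[OF uL])
    have "AE z in circle. f z = \<theta> z *s ?u z"
      using theta_cnj by eventually_elim (simp add: mult.commute)
    then show "(\<lambda>z. \<theta> z *s ?u z) \<in> H2"
      by (rule H2_cong_AE[OF f]) (intro L2_measurable L2_Linf_mult[OF HinfD(1)[OF theta_Hinf]] uL)
    have "AE z in circle. ?w z = \<Phi>\<^sub>1 z *v ?u z"
      using factor_vec by eventually_elim simp
    then show "(\<lambda>z. \<Phi>\<^sub>1 z *v ?u z) \<in> H2"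
      by (rule H2_cong_AE[OF wH]) (intro L2_measurable L2_Linf_mat_mult[OF \<Phi>1_Linf] uL)
  qed
qed

text \<open>One factor \<theta> is removed at a time: \<theta>^(k+1) x and its image under
  \<open>ct\<close> lie in \<open>H2\<close>, so \<open>ct_H2_imp_\<Phi>_H2\<close> divides it by
  \<theta>.\<close>

lemma H2_if_theta_power:
  assumes x: "x \<in> L2" and ctx: "(\<lambda>z. ct z *v x z) \<in> H2" and pow: "(\<lambda>z. \<theta> z ^ k *s x z) \<in> H2"
  shows "x \<in> H2"
  using pow
proof (induction k)
  case 0
  then show ?case by simp
next
  case (Suc k)
  let ?u = "\<lambda>z. \<theta> z ^ Suc k *s x z"
  have "(\<lambda>z. \<theta> z ^ Suc k *s (ct z *v x z)) \<in> H2"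
    by (rule H2_Hinf_mult[OF Hinf_power[OF theta_Hinf] ctx])
  then have "(\<lambda>z. ct z *v ?u z) \<in> H2" by (simp only: matrix_vector_mult_smult)
  then have u: "(\<lambda>z. cnj (\<theta> z) *s ?u z) \<in> H2" by (rule ct_H2_imp_\<Phi>_H2(2)[OF Suc.prems])
  have "AE z in circle. cnj (\<theta> z) *s ?u z = \<theta> z ^ k *s x z"
    using theta_cnj by eventually_elim (simp add: mult.assoc[symmetric])
  then have "(\<lambda>z. \<theta> z ^ k *s x z) \<in> H2"
    by (rule H2_cong_AE[OF u])
      (intro L2_measurable L2_Linf_mult[OF HinfD(1)[OF Hinf_power[OF theta_Hinf]]] x)
  then show ?case by (rule Suc.IH)
qed

text \<open>The conditions make \<open>T'\<close> and its square act on \<open>f\<close> as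
  multiplication by \<open>ct\<close>; \<open>ct_H2_imp_\<Phi>_H2\<close> then yields the same for
  \<open>T\<close> and \<Phi>.\<close>

definition F where
  "F = {f \<in> H2. (\<lambda>z. ct z *v f z) \<in> H2 \<and> (\<lambda>z. ct z *v (ct z *v f z)) \<in> H2}"

abbreviation G where "G f \<equiv> (\<lambda>z. \<Phi> z *v (ct z *v f z))"

lemma G_H2: "f \<in> F \<Longrightarrow> G f \<in> H2"
  by (rule ct_H2_imp_\<Phi>_H2) (auto simp: F_def)

text \<open>\<open>G f\<close> lies in the kernel of the self-commutator of \<open>T\<close>: the form of the self-commutator of
  \<open>T\<^sup>2\<close> vanishes at \<open>f\<close>, hence so does that operator itself, and its value at \<open>f\<close> is the
  self-commutator of \<open>T\<close> at \<open>G f\<close>.\<close>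

lemma kernel_self_commutator:
  assumes f: "f \<in> F" and q: "q \<in> H2"
  shows "L2_inner (T q) (T (G f)) = L2_inner (T' q) (T' (G f))"
proof -
  note adj' = adjoint_pair_sym[OF adj] and adj2 = adjoint_pair_square[OF adj]
  let ?a = "\<lambda>z. \<Phi> z *v f z" and ?b = "\<lambda>z. ct z *v f z"
  let ?aa = "\<lambda>z. \<Phi> z *v ?a z" and ?bb = "\<lambda>z. ct z *v ?b z"
  let ?g = "G f"
  have fH: "f \<in> H2" and b: "?b \<in> H2" and bb: "?bb \<in> H2" using f by (auto simp: F_def)
  have fL: "f \<in> L2" and bL: "?b \<in> L2" using fH b by (auto intro: H2_L2)
  have a: "?a \<in> H2" by (rule ct_H2_imp_\<Phi>_H2(1)[OF fH b])
  have aL: "?a \<in> L2" using a by (rule H2_L2)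
  have g: "?g \<in> H2" by (rule G_H2[OF f])
  have ga: "AE z in circle. ?g z = ct z *v ?a z" using commute by eventually_elim simp
  have cta: "(\<lambda>z. ct z *v ?a z) \<in> H2" by (rule H2_cong_AE[OF g ga L2_measurable[OF ct_L2[OF aL]]])
  have aa: "?aa \<in> H2" by (rule ct_H2_imp_\<Phi>_H2(1)[OF a cta])
  have Tf: "T f \<in> H2" and T'f: "T' f \<in> H2" using adjoint_pairD(1,2)[OF adj fH] by auto
  have TT: "AE z in circle. (T ^^ 2) f z = ?aa z"
    using adjoint_pair_cong_AE[OF adj Tf a T_eq[OF fH a]] T_eq[OF a aa]
    unfolding numeral_2_eq_2 by eventually_elim simp
  have TT': "AE z in circle. (T' ^^ 2) f z = ?bb z"
    using adjoint_pair_cong_AE[OF adj' T'f b T'_eq[OF fH b]] T'_eq[OF b bb]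
    unfolding numeral_2_eq_2 by eventually_elim simp
  have TTL: "(T ^^ 2) f \<in> L2" and TTL': "(T' ^^ 2) f \<in> L2"
    using adjoint_pairD(1,2)[OF adj2 fH] by (auto intro: H2_L2)
  \<comment> \<open>Normality of the symbol is used twice, at \<Phi> f and at \<open>ct f\<close>;
    by commutation both chains meet in the norm of \<open>G f\<close>.\<close>
  have "L2_sq ((T ^^ 2) f) = L2_sq ?aa" by (rule L2_sq_cong_AE[OF TTL H2_L2[OF aa] TT])
  also have "\<dots> = L2_sq (\<lambda>z. ct z *v ?a z)" by (rule L2_sq_\<Phi>_ct[OF aL])
  also have "\<dots> = L2_sq ?g" using L2_sq_cong_AE[OF H2_L2[OF g] H2_L2[OF cta] ga] by (rule sym)
  also have "\<dots> = L2_sq ?bb" by (rule L2_sq_\<Phi>_ct[OF bL])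
  also have "\<dots> = L2_sq ((T' ^^ 2) f)" using L2_sq_cong_AE[OF TTL' H2_L2[OF bb] TT'] by (rule sym)
  finally have extr: "L2_inner ((T ^^ 2) q) ((T ^^ 2) f) = L2_inner ((T' ^^ 2) q) ((T' ^^ 2) f)"
    by (rule H2_hyponormal_extremal[OF adj2 hypo2 fH _ q])
  have Tq: "T q \<in> H2" and T'q: "T' q \<in> H2" using adjoint_pairD(1,2)[OF adj q] by auto
  have T2q: "T (T q) \<in> L2" and T2'q: "T' (T' q) \<in> L2"
    using adjoint_pairD(1)[OF adj Tq] adjoint_pairD(2)[OF adj T'q] by (auto intro: H2_L2)
  have gL: "?g \<in> L2" using g by (rule H2_L2)
  have "L2_inner ((T ^^ 2) q) ((T ^^ 2) f) = L2_inner (T (T q)) ?aa"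
    unfolding numeral_2_eq_2
    by (rule L2_inner_cong_AE) (use T2q TTL H2_L2[OF aa] TT in \<open>simp_all add: numeral_2_eq_2\<close>)
  \<comment> \<open>Moving one adjoint suffices: applied to \<Phi> \<Phi> f, the multiplier
    \<open>ct\<close> gives \<Phi> (G f) by commutation.\<close>
  also have "\<dots> = L2_inner (T q) (T' ?aa)" by (rule adjoint_pairD(3)[OF adj Tq aa])
  also have "\<dots> = L2_inner (T q) (T ?g)"
  proof (rule L2_inner_cong_AE[OF H2_L2[OF Tq] H2_L2[OF Tq]])
    show "T' ?aa \<in> L2" "T ?g \<in> L2" using adjoint_pairD(2)[OF adj aa] adjoint_pairD(1)[OF adj g] by (auto intro: H2_L2)
    show "AE z in circle. T' ?aa z = T ?g z"
      unfolding toeplitz_def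
    proof (rule proj_H2_cong_AE[OF ct_L2[OF H2_L2[OF aa]] \<Phi>_L2[OF gL]])
      show "AE z in circle. ct z *v ?aa z = \<Phi> z *v ?g z"
        using commute by eventually_elim simp
    qed
  qed simp
  finally have 1: "L2_inner ((T ^^ 2) q) ((T ^^ 2) f) = L2_inner (T q) (T ?g)" .
  have "L2_inner ((T' ^^ 2) q) ((T' ^^ 2) f) = L2_inner (T' (T' q)) ?bb"
    unfolding numeral_2_eq_2
    by (rule L2_inner_cong_AE) (use T2'q TTL' H2_L2[OF bb] TT' in \<open>simp_all add: numeral_2_eq_2\<close>)
  also have "\<dots> = L2_inner (T' q) (T ?bb)" by (rule adjoint_pairD(3)[OF adj' T'q bb])
  also have "\<dots> = L2_inner (T' q) (T' ?g)"
  proof (rule L2_inner_cong_AE[OF H2_L2[OF T'q] H2_L2[OF T'q]])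
    show "T ?bb \<in> L2" "T' ?g \<in> L2" using adjoint_pairD(1)[OF adj bb] adjoint_pairD(2)[OF adj g] by (auto intro: H2_L2)
    show "AE z in circle. T ?bb z = T' ?g z"
      unfolding toeplitz_def
    proof (rule proj_H2_cong_AE[OF \<Phi>_L2[OF H2_L2[OF bb]] ct_L2[OF gL]])
      show "AE z in circle. \<Phi> z *v ?bb z = ct z *v ?g z"
        using commute by eventually_elim simp
    qed
  qed simp
  finally show ?thesis using 1 extr by simp
qed

section \<open>Coefficients of index -1 and the normal case\<close>

definition \<alpha> where "\<alpha> q = vcoeff (\<lambda>z. ct z *v q z) (-1)"
text \<open>At z^n q the maps \<alpha> and \<beta> return the coefficients of index -1 - n for q, so
  on shifts they determine the whole Hankel parts of \<open>ct q\<close> and \<Phi> q.\<close>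

definition \<beta> where "\<beta> q = vcoeff (\<lambda>z. \<Phi> z *v q z) (-1)"

lemma F_shift: assumes f: "f \<in> F" shows "(\<lambda>z. z ^ k *s f z) \<in> F"
proof -
  have H: "f \<in> H2" "(\<lambda>z. ct z *v f z) \<in> H2" "(\<lambda>z. ct z *v (ct z *v f z)) \<in> H2"
    using f by (auto simp: F_def)
  show ?thesis using H[THEN H2_shift, of k] by (simp add: F_def matrix_vector_mult_smult)
qed

lemma G_shift: "G (\<lambda>z. z ^ k *s f z) = (\<lambda>z. z ^ k *s G f z)"
  by (simp add: matrix_vector_mult_smult)

lemma F_lin: assumes f: "f \<in> F" and g: "g \<in> F" shows "(\<lambda>z. f z + c *s g z) \<in> F"
proof -
  have H: "f \<in> H2" "(\<lambda>z. ct z *v f z) \<in> H2" "(\<lambda>z. ct z *v (ct z *v f z)) \<in> H2"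
    and K: "g \<in> H2" "(\<lambda>z. ct z *v g z) \<in> H2" "(\<lambda>z. ct z *v (ct z *v g z)) \<in> H2"
    using f g by (auto simp: F_def)
  show ?thesis
    using H2_add[OF H(1) H2_scale[OF K(1)]] H2_add[OF H(2) H2_scale[OF K(2)]] H2_add[OF H(3) H2_scale[OF K(3)]]
    by (simp add: F_def matrix_vector_right_distrib matrix_vector_mult_smult)
qed

lemma \<alpha>_G_lin:
  assumes f: "f \<in> F" and g: "g \<in> F"
  shows "\<alpha> (G (\<lambda>z. f z + c *s g z)) = \<alpha> (G f) + c *s \<alpha> (G g)"
proof -
  have "\<alpha> (G (\<lambda>z. f z + c *s g z)) = vcoeff (\<lambda>z. ct z *v G f z + c *s (ct z *v G g z)) (-1)"
    unfolding \<alpha>_def by (simp only: matrix_vector_right_distrib matrix_vector_mult_smult)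
  also have "\<dots> = \<alpha> (G f) + c *s \<alpha> (G g)"
    unfolding \<alpha>_def by (rule vcoeff_lin[OF ct_L2[OF H2_L2[OF G_H2[OF f]]] ct_L2[OF H2_L2[OF G_H2[OF g]]]])
  finally show ?thesis .
qed

lemma toeplitz_shift_inner:
  assumes \<Psi>: "\<Psi> \<in> Linf_mat" and q: "q \<in> H2" and g: "g \<in> H2"
  shows "L2_inner (toeplitz \<Psi> (\<lambda>z. z ^ 1 *s q z)) (toeplitz \<Psi> (\<lambda>z. z ^ 1 *s g z)) =
    L2_inner (toeplitz \<Psi> q) (toeplitz \<Psi> g) +
    cip (vcoeff (\<lambda>z. \<Psi> z *v q z) (-1)) (vcoeff (\<lambda>z. \<Psi> z *v g z) (-1))"
  unfolding toeplitz_def matrix_vector_mult_smult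
  by (rule proj_H2_shift_inner[OF L2_Linf_mat_mult[OF \<Psi> H2_L2[OF q]] L2_Linf_mat_mult[OF \<Psi> H2_L2[OF g]]])

text \<open>The kernel identity at z q and z f minus the one at q and f: by
  \<open>toeplitz_shift_inner\<close> the difference consists of the terms of index -1.\<close>

lemma cip_\<alpha>_\<beta>:
  assumes f: "f \<in> F" and q: "q \<in> H2"
  shows "cip (\<beta> q) (\<beta> (G f)) = cip (\<alpha> q) (\<alpha> (G f))"
proof -
  have g: "G f \<in> H2" by (rule G_H2[OF f])
  have "L2_inner (T (\<lambda>z. z ^ 1 *s q z)) (T (\<lambda>z. z ^ 1 *s G f z)) =
      L2_inner (T' (\<lambda>z. z ^ 1 *s q z)) (T' (\<lambda>z. z ^ 1 *s G f z))"
    using kernel_self_commutator[OF F_shift[OF f] H2_shift[OF q], of 1 1] unfolding G_shift .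
  then show ?thesis
    unfolding toeplitz_shift_inner[OF \<Phi> q g] toeplitz_shift_inner[OF ct_Linf q g] \<alpha>_def \<beta>_def
    using kernel_self_commutator[OF f q] by simp
qed

lemma normal_if_\<alpha>_onto:
  assumes onto: "\<And>v. \<exists>f\<in>F. \<alpha> (G f) = v"
  shows "H2_normal T"
proof -
  have "\<exists>f\<in>F. \<alpha> (G f) = axis j 1" for j by (rule onto)
  then obtain e where e: "\<And>j. e j \<in> F" "\<And>j. \<alpha> (G (e j)) = axis j 1" by metis
  \<comment> \<open>Row i of \<open>W\<close> is the conjugate of \<beta> (G (e i)), so
    \<open>cip_\<alpha>_\<beta>\<close> identifies component i of W \<beta> q with that of \<alpha>
    q.\<close>
  define W where "W = (\<chi> i j. cnj (\<beta> (G (e i)) $ j))"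
  have cip_axis1: "cip v (axis j 1) = v $ j" for v :: "complex^'n" and j
    by (simp add: cip_def axis_def if_distrib cong: if_cong)
  have W\<beta>: "\<alpha> q = W *v \<beta> q" if q: "q \<in> H2" for q
  proof -
    have "(W *v \<beta> q) $ j = cip (\<beta> q) (\<beta> (G (e j)))" for j
      by (simp add: W_def matrix_vector_mult_def cip_def mult.commute)
    also have "\<dots> j = \<alpha> q $ j" for j
      by (simp add: cip_\<alpha>_\<beta>[OF e(1) q] e(2) cip_axis1)
    finally show ?thesis by (simp add: vec_eq_iff)
  qed
  \<comment> \<open>The same identity at q = G (e k): the vectors \<beta> (G (e j)) are orthonormal
    because the vectors \<alpha> (G (e j)) are.\<close>
  have "W ** conj_transpose W = mat 1"
  proof -
    have "(W ** conj_transpose W) $ j $ k = cip (\<beta> (G (e k))) (\<beta> (G (e j)))" for j k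
      by (simp add: W_def matrix_matrix_mult_def conj_transpose_def cip_def mult.commute)
    also have "\<dots> j k = mat 1 $ j $ k" for j k
      by (simp add: cip_\<alpha>_\<beta>[OF e(1) G_H2[OF e(1)]] e(2) cip_axis1) (simp add: axis_def mat_def)
    finally show ?thesis by (simp add: vec_eq_iff)
  qed
  then have WW: "conj_transpose W ** W = mat 1" by (simp only: matrix_left_right_inverse)
  have W_cip: "cip (W *v u) (W *v v) = cip u v" for u v
    unfolding cip_matrix_left matrix_matrix_vector_mult[symmetric] WW by simp
  \<comment> \<open>Nonnegative coefficients vanish on both sides; each negative one is reached by a
    shift of \<open>q\<close>.\<close>
  have Q: "AE z in circle. ct z *v q z - T' q z = W *v (\<Phi> z *v q z - T q z)" if q: "q \<in> H2" for q
  proof (rule vcoeff_unique)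
    let ?x = "\<lambda>z. \<Phi> z *v q z" and ?y = "\<lambda>z. ct z *v q z"
    have xL: "?x \<in> L2" and yL: "?y \<in> L2" using \<Phi>_L2 ct_L2 H2_L2[OF q] by auto
    have TqL: "T q \<in> L2" and T'qL: "T' q \<in> L2" using adjoint_pairD(1,2)[OF adj q] by (auto intro: H2_L2)
    have dx: "(\<lambda>z. ?x z - T q z) \<in> L2" and dy: "(\<lambda>z. ?y z - T' q z) \<in> L2"
      by (intro L2_diff xL yL TqL T'qL)+
    show "(\<lambda>z. ?y z - T' q z) \<in> L2" by (rule dy)
    have "(\<lambda>z. W) \<in> Linf_mat" by (simp add: Linf_mat_def)
    then show "(\<lambda>z. W *v (?x z - T q z)) \<in> L2" by (rule L2_Linf_mat_mult[OF _ dx])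
    fix k
    have diff: "vcoeff (\<lambda>z. w z - proj_H2 w z) k = (if k \<ge> 0 then 0 else vcoeff w k)" if w: "w \<in> L2" for w :: "complex \<Rightarrow> complex^'n"
    proof -
      have "vcoeff (\<lambda>z. w z + (-1) *s proj_H2 w z) k = vcoeff w k + (-1) *s vcoeff (proj_H2 w) k"
        by (rule vcoeff_lin[OF w H2_L2[OF proj_H2_in[OF w]]])
      then show ?thesis by (simp add: vcoeff_proj_H2[OF w] vector_sneg_minus1[symmetric])
    qed
    show "vcoeff (\<lambda>z. ?y z - T' q z) k = vcoeff (\<lambda>z. W *v (?x z - T q z)) k"
    proof (cases "k \<ge> 0")
      case True
      then show ?thesis
        unfolding vcoeff_matrix[OF dx] unfolding toeplitz_def diff[OF xL] diff[OF yL] by simp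
    next
      case False
      obtain n where n: "k = - 1 - int n" by (rule that[of "nat (- k - 1)"]) (use False in simp)
      have "vcoeff ?y k = \<alpha> (\<lambda>z. z ^ n *s q z)"
        unfolding \<alpha>_def matrix_vector_mult_smult vcoeff_shift[OF yL] n ..
      also have "\<dots> = W *v \<beta> (\<lambda>z. z ^ n *s q z)" by (rule W\<beta>[OF H2_shift[OF q]])
      also have "\<beta> (\<lambda>z. z ^ n *s q z) = vcoeff ?x k"
        unfolding \<beta>_def matrix_vector_mult_smult vcoeff_shift[OF xL] n ..
      finally show ?thesis
        using False unfolding vcoeff_matrix[OF dx] unfolding toeplitz_def diff[OF xL] diff[OF yL] by simp
    qed
  qed
  show ?thesis
  proof (rule H2_normalI[OF adj])
    fix f q :: "complex \<Rightarrow> complex^'n" assume f: "f \<in> H2" and q: "q \<in> H2"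
    let ?x = "\<lambda>f z. \<Phi> z *v f z - T f z" and ?y = "\<lambda>f z. ct z *v f z - T' f z"
    have L: "?x f \<in> L2" "?y f \<in> L2" if "f \<in> H2" for f
      by (intro L2_diff \<Phi>_L2 ct_L2 H2_L2[OF that] H2_L2[OF adjoint_pairD(1)[OF adj that]]
          H2_L2[OF adjoint_pairD(2)[OF adj that]])+
    have "L2_inner (?x f) (?x q) = L2_inner (?y f) (?y q)"
      unfolding L2_inner_cip
    proof (rule integral_cong_AE)
      show "AE z in circle. cip (?x f z) (?x q z) = cip (?y f z) (?y q z)"
        using Q[OF f] Q[OF q]
      proof eventually_elim
        case (elim z)
        then show ?case by (simp only: W_cip)
      qed
    qed (use L(1)[OF f, THEN L2_measurable] L(1)[OF q, THEN L2_measurable]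
          L(2)[OF f, THEN L2_measurable] L(2)[OF q, THEN L2_measurable] in \<open>simp_all add: measurable_cip\<close>)
    \<comment> \<open>The full pairings agree by normality of the symbol and the Hankel parts
      through the unitary \<open>W\<close>, so the projected parts agree.\<close>
    note defect = this[unfolded toeplitz_def]
    have cancel: "a = a'" if "u = a + x" "v = a' + y" "u = v" "x = y" for a a' u v x y :: complex
      using that by simp
    show "L2_inner (T f) (T q) = L2_inner (T' f) (T' q)"
      unfolding toeplitz_def
      by (rule cancel[OF L2_inner_proj_H2_split[OF \<Phi>_L2[OF H2_L2[OF f]] \<Phi>_L2[OF H2_L2[OF q]]]
            L2_inner_proj_H2_split[OF ct_L2[OF H2_L2[OF f]] ct_L2[OF H2_L2[OF q]]]
            L2_inner_\<Phi>_ct[OF H2_L2[OF f] H2_L2[OF q]] defect])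
  qed
qed

end

section \<open>An annihilating row forces the conjugate of \<theta> to be analytic\<close>

context square_hyponormal
begin

text \<open>Real orthogonality provides a vector \<open>a\<close>, hence vanishing real parts for
  its conjugate \<open>p\<close>. The set of values is closed under multiplication by \<i>, so
  imaginary parts vanish too.\<close>

lemma ex_annihilator:
  assumes "\<not> (\<forall>v. \<exists>f\<in>F. \<alpha> (G f) = v)"
  obtains p where "p \<noteq> 0" "\<And>f. f \<in> F \<Longrightarrow> (\<Sum>i\<in>UNIV. p $ i * \<alpha> (G f) $ i) = 0"
proof -
  define S where "S = {\<alpha> (G f) | f. f \<in> F}"
  have zero: "(\<lambda>z. 0) \<in> F" using H2_zero by (simp add: F_def)
  have S0: "0 \<in> S"
  proof -
    have "\<alpha> (G (\<lambda>z. 0)) = 0" by (simp add: \<alpha>_def vcoeff_const)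
    then show ?thesis unfolding S_def using zero by force
  qed
  have Slin: "x + c *s y \<in> S" if xy: "x \<in> S" "y \<in> S" for x y c
  proof -
    obtain f g where f: "f \<in> F" "x = \<alpha> (G f)" and g: "g \<in> F" "y = \<alpha> (G g)"
      using xy unfolding S_def by blast
    have "x + c *s y = \<alpha> (G (\<lambda>z. f z + c *s g z))"
      unfolding f(2) g(2) by (rule \<alpha>_G_lin[OF f(1) g(1), symmetric])
    then show ?thesis unfolding S_def
      by (intro CollectI exI conjI) (assumption, rule F_lin[OF f(1) g(1)])
  qed
  have Sscale: "c *s y \<in> S" if "y \<in> S" for y c using Slin[OF S0 that, of c] by simp
  have "subspace S"
  proof (rule subspaceI)
    show "0 \<in> S" by (rule S0)
    show "x + y \<in> S" if "x \<in> S" "y \<in> S" for x y using Slin[OF that, of 1] by simp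
    show "c *\<^sub>R x \<in> S" if "x \<in> S" for c x
    proof -
      have "c *\<^sub>R x = complex_of_real c *s x"
        unfolding vec_eq_iff vector_scaleR_component by (simp add: scaleR_conv_of_real)
      then show ?thesis using Sscale[OF that] by simp
    qed
  qed
  obtain v where "\<And>f. f \<in> F \<Longrightarrow> \<alpha> (G f) \<noteq> v" using assms by blast
  then have "v \<notin> S" unfolding S_def mem_Collect_eq by metis
  then have "S \<noteq> UNIV" by auto
  have span: "span S = S" using \<open>subspace S\<close> by (simp only: span_eq_iff)
  have "span S \<noteq> UNIV" unfolding span by fact
  from span_not_UNIV_orthogonal[OF this] obtain a where a: "a \<noteq> 0" "\<forall>x\<in>span S. a \<bullet> x = 0"
    by (elim exE conjE) (rule that)
  define p where "p = (\<chi> i. cnj (a $ i))"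
  have Re0: "Re (\<Sum>i\<in>UNIV. p $ i * x $ i) = 0" if "x \<in> S" for x
  proof -
    have "Re (\<Sum>i\<in>UNIV. p $ i * x $ i) = a \<bullet> x"
      by (simp add: p_def inner_vec_def inner_complex_def)
    then show ?thesis using a(2) span_base[OF that] by simp
  qed
  have "(\<Sum>i\<in>UNIV. p $ i * x $ i) = 0" if "x \<in> S" for x
  proof -
    have "(\<Sum>i\<in>UNIV. p $ i * (\<i> *s x) $ i) = \<i> * (\<Sum>i\<in>UNIV. p $ i * x $ i)"
      by (simp add: sum_distrib_left mult_ac)
    then have "Im (\<Sum>i\<in>UNIV. p $ i * x $ i) = 0" using Re0[OF Sscale[OF that, of \<i>]] by simp
    then show ?thesis using Re0[OF that] by (simp add: complex_eq_iff)
  qed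
  moreover have "p \<noteq> 0" using a(1) by (auto simp: p_def vec_eq_iff)
  ultimately show ?thesis using that unfolding S_def by blast
qed

text \<open>By contradiction, because the non-analyticity of the conjugate of \<theta> is what makes
  \<open>b\<close> nonzero, and the square of \<open>b\<close> is the common multiplier for all
  powers of the entries of the row p \<Phi>.\<close>

lemma cnj_theta_Hinf_if_annihilator:
  assumes p: "p \<noteq> 0" and ann: "\<And>f. f \<in> F \<Longrightarrow> (\<Sum>i\<in>UNIV. p $ i * \<alpha> (G f) $ i) = 0"
    and \<omega>: "\<omega> \<in> Hinf" and \<omega>0: "AE z in circle. \<omega> z \<noteq> 0"
    and B: "B \<in> Hinf_mat" and B_eq: "AE z in circle. \<forall>v. B z *v v = \<omega> z *s (ct z *v v)"
  shows "(\<lambda>z. cnj (\<theta> z)) \<in> Hinf"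
proof (rule ccontr)
  assume nonan: "\<not> ?thesis"
  obtain i0 where i0: "p $ i0 \<noteq> 0" using p by (auto simp: vec_eq_iff)
  \<comment> \<open>At this index \<open>fl_mat\<close> is the adjugate up to sign, and at the next
    one \<open>fl_coeff\<close> is the determinant up to sign.\<close>
  define n where "n = CARD('n) - 1"
  have n: "CARD('n) = Suc n" unfolding n_def using zero_less_card_finite[where 'a='n] by linarith
  define N where "N z = fl_mat (B z) n" for z
  define b where "b z = - fl_coeff (B z) (Suc n)" for z
  define \<rho> where "\<rho> i z = (\<Sum>j\<in>UNIV. p $ j * \<Phi>\<^sub>1 z $ j $ i)" for i z
  define r where "r i z = (\<Sum>j\<in>UNIV. p $ j * \<Phi> z $ j $ i)" for i z
  have FL: "(A ** fl_mat A n) *v v = (- fl_coeff A (Suc n)) *s v" for A :: "complex^'n^'n" and v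
  proof -
    have "fl_mat A (Suc n) = 0" using fl_mat_CARD[of A] by (simp only: n)
    then have "(A ** fl_mat A n) $ i $ j = mat (- fl_coeff A (Suc n)) $ i $ j" for i j
      using fl_mat_Suc[of A n i j] by (cases "i = j") (simp_all add: mat_def eq_neg_iff_add_eq_0)
    then have "A ** fl_mat A n = mat (- fl_coeff A (Suc n))" by (simp add: vec_eq_iff)
    then show ?thesis by (simp only: mat_mult_vec)
  qed
  have BN: "B z *v (N z *v v) = b z *s v" for z v
    using FL[of "B z" v] by (simp only: N_def b_def matrix_matrix_vector_mult)
  have N_Hinf: "N \<in> Hinf_mat" unfolding N_def Hinf_mat_def using fl_mat_Hinf[OF B] by simp
  have b_Hinf: "b \<in> Hinf"
    using Hinf_mult[OF Hinf_const[of "-1"] fl_coeff_Hinf[OF B, of "Suc n"]] by (simp add: b_def[abs_def])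
  have \<rho>_Hinf: "\<rho> i \<in> Hinf" for i
    unfolding \<rho>_def using \<Phi>1 by (intro Hinf_sum Hinf_mult) (auto simp: Hinf_mat_def)
  have r_Linf: "r i \<in> Linf" for i
    unfolding r_def using \<Phi> by (intro Linf_sum Linf_mult) (auto simp: Linf_mat_def)
  have rm: "(\<lambda>z. r i z ^ m) \<in> Linf" for i m
    by (induction m) (auto intro: Linf_mult[OF r_Linf])
  have r_eq: "AE z in circle. \<forall>i. r i z = cnj (\<theta> z) * \<rho> i z"
    using factor_vec
  proof eventually_elim
    case (elim z)
    have "\<Phi> z $ j $ i = cnj (\<theta> z) * \<Phi>\<^sub>1 z $ j $ i" for i j
    proof -
      have col: "(A *v axis i 1) $ j = A $ j $ i" for A :: "complex^'n^'n"
        by (simp add: matrix_vector_mult_def axis_def if_distrib cong: if_cong)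
      have "(\<Phi> z *v axis i 1) $ j = (cnj (\<theta> z) *s (\<Phi>\<^sub>1 z *v axis i 1)) $ j"
        using elim by (simp add: matrix_vector_mult_smult)
      then show ?thesis by (simp add: col)
    qed
    then show ?case by (simp add: r_def \<rho>_def sum_distrib_left mult_ac)
  qed
  have cnj_pow_Linf: "(\<lambda>z. cnj (\<theta> z) ^ m) \<in> Linf" for m
    by (induction m) (auto intro: Linf_mult[OF cnj_theta_Linf])
  have theta_pow: "AE z in circle. \<theta> z ^ m * cnj (\<theta> z) ^ m = 1" for m
    using theta_cnj by eventually_elim (simp add: power_mult_distrib[symmetric] mult.commute)

  \<comment> \<open>If \<open>b\<close> vanished, descent within the null functions would put 1
    among them. For injectivity: when \<open>ct v = 0\<close>, \<open>H2_if_theta_power\<close>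
    divides v by every power of \<theta>, and \<open>Hinf_if_powers_H2\<close> contradicts
    \<open>nonan\<close> unless v = 0.\<close>
  have b0: "\<not> (AE z in circle. b z = 0)"
  proof
    assume b0: "AE z in circle. b z = 0"
    have "(\<lambda>z. 1) \<in> {u. AE z in circle. u z = (0::complex)}"
    proof (rule fl_descent[OF B])
      show "(\<lambda>z. fl_coeff (B z) CARD('n)) \<in> {u. AE z in circle. u z = 0}"
        using b0 by (simp add: b_def n)
      fix v :: "complex \<Rightarrow> complex^'n" and i
      assume v: "\<And>i. (\<lambda>z. v z $ i) \<in> Hinf" and Bv: "\<And>i. (\<lambda>z. (B z *v v z) $ i) \<in> {u. AE z in circle. u z = 0}"
      have vH: "v \<in> H2" using v by (subst Hinf_component_iff) (auto simp: HinfD)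
      have "AE z in circle. \<forall>i\<in>UNIV. (B z *v v z) $ i = 0"
        using Bv by (intro AE_finite_allI) auto
      then have ctv: "AE z in circle. ct z *v v z = 0"
        using B_eq \<omega>0 by eventually_elim (auto simp: vec_eq_iff)
      have "AE z in circle. v z = 0"
      proof (rule ccontr)
        assume nz: "\<not> ?thesis"
        have "(\<lambda>z. cnj (\<theta> z) ^ m *s v z) \<in> H2" for m
        proof (rule H2_if_theta_power)
          show xL: "(\<lambda>z. cnj (\<theta> z) ^ m *s v z) \<in> L2" by (rule L2_Linf_mult[OF cnj_pow_Linf H2_L2[OF vH]])
          have "AE z in circle. 0 = ct z *v (cnj (\<theta> z) ^ m *s v z)"
            using ctv by eventually_elim (simp add: matrix_vector_mult_smult)
          then show "(\<lambda>z. ct z *v (cnj (\<theta> z) ^ m *s v z)) \<in> H2"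
            by (rule H2_cong_AE[OF H2_zero]) (rule L2_measurable[OF ct_L2[OF xL]])
          have "AE z in circle. v z = \<theta> z ^ m *s (cnj (\<theta> z) ^ m *s v z)"
            using theta_pow[of m] by eventually_elim simp
          then show "(\<lambda>z. \<theta> z ^ m *s (cnj (\<theta> z) ^ m *s v z)) \<in> H2"
            by (rule H2_cong_AE[OF vH])
              (intro L2_measurable L2_Linf_mult[OF HinfD(1)[OF Hinf_power[OF theta_Hinf]]] xL)
        qed
        then have "(\<lambda>z. cnj (\<theta> z)) \<in> Hinf" by (rule Hinf_if_powers_H2[OF cnj_theta_Linf _ nz])
        then show False using nonan by simp
      qed
      then have "AE z in circle. v z $ i = 0" by eventually_elim simp
      then show "(\<lambda>z. v z $ i) \<in> {u. AE z in circle. u z = 0}" by simp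
    qed auto
    then have "AE z in circle. (1::complex) = 0" by simp
    then have "(LINT z|circle. (1::complex)) = (LINT z|circle. 0)" by (intro integral_cong_AE) auto
    then show False by simp
  qed

  \<comment> \<open>Two applications of \<open>N\<close> undo two of \<open>ct\<close> at the price
    of \<omega>^2 and b^2, producing \<open>f\<close> with ct (ct f) = y e_i. The conjugate power of
    \<theta> in \<open>f\<close> is harmless: \<open>H2_if_theta_power\<close> passes analyticity
    from ct (ct f) to ct f and then to f, so \<open>f\<close> lies in \<open>F\<close>.\<close>
  have r_mult: "(\<lambda>z. r i z * y z) \<in> Hinf"
    if h: "h \<in> Hinf" and y: "y \<in> Hinf" and y_eq: "AE z in circle. y z = cnj (\<theta> z) ^ m * ((b z)\<^sup>2 * h z)" for i m h y
  proof -
    define n1 where "n1 z = N z *v axis i 1" for z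
    define n2 where "n2 z = N z *v n1 z" for z
    have n1: "n1 \<in> H2" unfolding n1_def by (rule H2_Hinf_mat_mult[OF N_Hinf const_H2])
    have n2: "n2 \<in> H2" unfolding n2_def by (rule H2_Hinf_mat_mult[OF N_Hinf n1])
    define f where "f z = (cnj (\<theta> z) ^ m * ((\<omega> z)\<^sup>2 * h z)) *s n2 z" for z
    have fL: "f \<in> L2" unfolding f_def
      by (intro L2_Linf_mult Linf_mult cnj_pow_Linf HinfD(1)[OF Hinf_power[OF \<omega>]] HinfD(1)[OF h] H2_L2[OF n2])
    have ctf: "AE z in circle. ct z *v f z = (cnj (\<theta> z) ^ m * (\<omega> z * h z * b z)) *s n1 z"
      using B_eq
    proof eventually_elim
      case (elim z)
      have "ct z *v f z = (cnj (\<theta> z) ^ m * \<omega> z * h z) *s (\<omega> z *s (ct z *v n2 z))"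
        by (simp add: f_def matrix_vector_mult_smult power2_eq_square mult_ac)
      also have "\<omega> z *s (ct z *v n2 z) = b z *s n1 z"
        using elim BN[of z "n1 z"] by (simp add: n2_def)
      finally show ?case by (simp add: mult_ac)
    qed
    have ctctf: "AE z in circle. ct z *v (ct z *v f z) = axis i (y z)"
      using B_eq ctf y_eq
    proof eventually_elim
      case (elim z)
      have "ct z *v (ct z *v f z) = (cnj (\<theta> z) ^ m * h z * b z) *s (\<omega> z *s (ct z *v n1 z))"
        unfolding elim(2) by (simp add: matrix_vector_mult_smult mult_ac)
      also have "\<omega> z *s (ct z *v n1 z) = b z *s axis i 1"
        using elim(1) BN[of z "axis i 1"] by (simp add: n1_def)
      also have "(cnj (\<theta> z) ^ m * h z * b z) *s (b z *s axis i 1) = axis i (y z)"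
        using elim(3) by (simp add: vec_eq_iff axis_def power2_eq_square mult_ac)
      finally show ?case .
    qed
    have ctfL: "(\<lambda>z. ct z *v f z) \<in> L2" by (rule ct_L2[OF fL])
    have ctctfH: "(\<lambda>z. ct z *v (ct z *v f z)) \<in> H2"
    proof (rule H2_cong_AE[OF Hinf_axis_H2[OF y]])
      show "AE z in circle. axis i (y z) = ct z *v (ct z *v f z)" using ctctf by eventually_elim simp
    qed (rule L2_measurable[OF ct_L2[OF ctfL]])
    have ctfH: "(\<lambda>z. ct z *v f z) \<in> H2"
    proof (rule H2_if_theta_power[OF ctfL ctctfH])
      have "(\<lambda>z. (\<omega> z * h z * b z) *s n1 z) \<in> H2" by (intro H2_Hinf_mult Hinf_mult \<omega> h b_Hinf n1)
      moreover have "AE z in circle. (\<omega> z * h z * b z) *s n1 z = \<theta> z ^ m *s (ct z *v f z)"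
        using ctf theta_pow[of m] by eventually_elim (simp add: mult.assoc[symmetric])
      ultimately show "(\<lambda>z. \<theta> z ^ m *s (ct z *v f z)) \<in> H2"
        by (rule H2_cong_AE)
          (intro L2_measurable L2_Linf_mult[OF HinfD(1)[OF Hinf_power[OF theta_Hinf]]] ctfL)
    qed
    have fH: "f \<in> H2"
    proof (rule H2_if_theta_power[OF fL ctfH])
      have "(\<lambda>z. ((\<omega> z)\<^sup>2 * h z) *s n2 z) \<in> H2" by (intro H2_Hinf_mult Hinf_mult Hinf_power \<omega> h n2)
      moreover have "AE z in circle. ((\<omega> z)\<^sup>2 * h z) *s n2 z = \<theta> z ^ m *s f z"
        using theta_pow[of m] by eventually_elim (simp add: f_def mult.assoc[symmetric])
      ultimately show "(\<lambda>z. \<theta> z ^ m *s f z) \<in> H2"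
        by (rule H2_cong_AE)
          (intro L2_measurable L2_Linf_mult[OF HinfD(1)[OF Hinf_power[OF theta_Hinf]]] fL)
    qed
    have f: "f \<in> F" using fH ctfH ctctfH by (simp add: F_def)
    let ?w = "\<lambda>z. ct z *v G f z"
    have wL: "?w \<in> L2" by (rule ct_L2[OF H2_L2[OF G_H2[OF f]]])
    define P :: "complex^'n^'n" where "P = (\<chi> a c. p $ c)"
    have "(\<lambda>z. P) \<in> Linf_mat" by (simp add: Linf_mat_def)
    then have PwL: "(\<lambda>z. P *v ?w z) \<in> L2" by (rule L2_Linf_mat_mult[OF _ wL])
    have P_nth: "(P *v v) $ a = (\<Sum>c\<in>UNIV. p $ c * v $ c)" for v a
      by (simp add: P_def matrix_vector_mult_def)
    \<comment> \<open>By commutation ct (G f) = \<Phi> (ct (ct f)), which is y times column i of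
      \<Phi>.\<close>
    have eq: "AE z in circle. (P *v ?w z) $ i = r i z * y z"
      using commute ctctf
    proof eventually_elim
      case (elim z)
      have "?w z = \<Phi> z *v axis i (y z)" using elim by simp
      also have "\<dots> = (\<chi> j. \<Phi> z $ j $ i * y z)"
        by (simp add: vec_eq_iff matrix_vector_mult_def axis_def if_distrib cong: if_cong)
      finally show ?case by (simp add: P_nth r_def sum_distrib_left sum_distrib_right mult_ac)
    qed
    have ryL: "(\<lambda>z. r i z * y z) \<in> Linf" by (rule Linf_mult[OF r_Linf HinfD(1)[OF y]])
    \<comment> \<open>Each negative coefficient is the one of index -1 for a shift of
      \<open>f\<close>, and shifts stay in \<open>F\<close>, where \<open>p\<close>
      annihilates.\<close>
    have "fourier_coeff (\<lambda>z. r i z * y z) k = 0" if k: "k < 0" for k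
    proof -
      obtain l where l: "k = - 1 - int l" by (rule that[of "nat (- k - 1)"]) (use \<open>k < 0\<close> in simp)
      have "fourier_coeff (\<lambda>z. r i z * y z) k = fourier_coeff (\<lambda>z. (P *v ?w z) $ i) k"
        using eq by (intro fourier_coeff_cong_AE LinfD(1)[OF ryL] measurable_vec_nth L2_measurable PwL) auto
      also have "\<dots> = (P *v vcoeff ?w k) $ i"
        by (simp only: vcoeff_nth[symmetric] vcoeff_matrix[OF wL])
      also have "vcoeff ?w k = \<alpha> (G (\<lambda>z. z ^ l *s f z))"
        unfolding \<alpha>_def G_shift matrix_vector_mult_smult vcoeff_shift[OF wL] l ..
      also have "(P *v \<dots>) $ i = 0"
        unfolding P_nth by (rule ann[OF F_shift[OF f]])
      finally show ?thesis .
    qed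
    then show ?thesis using ryL by (simp add: Hinf_def)
  qed
  \<comment> \<open>Since r is \<rho> times the conjugate of \<theta>, the choice h = \<rho>^m gives
    y = r^m b^2, and \<open>r_mult\<close> supplies the next power.\<close>
  have r_pow: "(\<lambda>z. r i z ^ m * (b z)\<^sup>2) \<in> Hinf" for i m
  proof (induction m)
    case 0
    then show ?case using Hinf_power[OF b_Hinf, of 2] by simp
  next
    case (Suc m)
    have "AE z in circle. r i z ^ m * (b z)\<^sup>2 = cnj (\<theta> z) ^ m * ((b z)\<^sup>2 * \<rho> i z ^ m)"
      using r_eq by eventually_elim (simp add: power_mult_distrib mult_ac)
    from r_mult[OF Hinf_power[OF \<rho>_Hinf] Suc this] show ?case by (simp add: mult.assoc)
  qed
  have r_Hinf: "r i \<in> Hinf" for i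
  proof (rule Hinf_if_powers_H2[OF r_Linf])
    show "(\<lambda>z. r i z ^ m *s (axis i0 ((b z)\<^sup>2) :: complex^'n)) \<in> H2" for m
    proof -
      have "r i z ^ m *s (axis i0 ((b z)\<^sup>2) :: complex^'n) = axis i0 (r i z ^ m * (b z)\<^sup>2)" for z
        by (simp add: vec_eq_iff axis_def)
      then show ?thesis using Hinf_axis_H2[OF r_pow[of i m], of i0] by simp
    qed
    show "\<not> (AE z in circle. (axis i0 ((b z)\<^sup>2) :: complex^'n) = 0)"
      using b0 by (simp add: axis_eq_0_iff)
  qed

  \<comment> \<open>Descent modulo \<theta>, within the functions whose product with the conjugate
    of \<theta> is analytic. Coprimeness gives injectivity; the row \<open>p\<close> gives the last
    coefficient.\<close>
  have "(\<lambda>z. 1) \<in> {u. (\<lambda>z. u z * cnj (\<theta> z)) \<in> Hinf}"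
  proof (rule fl_descent[OF \<Phi>1])
    show "(\<lambda>z. f z + g z) \<in> {u. (\<lambda>z. u z * cnj (\<theta> z)) \<in> Hinf}"
      if "f \<in> {u. (\<lambda>z. u z * cnj (\<theta> z)) \<in> Hinf}" "g \<in> {u. (\<lambda>z. u z * cnj (\<theta> z)) \<in> Hinf}" for f g
      using that Hinf_add by (simp add: distrib_right)
    show "(\<lambda>z. c * f z) \<in> {u. (\<lambda>z. u z * cnj (\<theta> z)) \<in> Hinf}"
      if "f \<in> {u. (\<lambda>z. u z * cnj (\<theta> z)) \<in> Hinf}" for f c
      using that Hinf_mult[OF Hinf_const[of c]] by (simp add: mult.assoc)
    fix v :: "complex \<Rightarrow> complex^'n" and i
    assume v: "\<And>i. (\<lambda>z. v z $ i) \<in> Hinf"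
      and \<Phi>v: "\<And>i. (\<lambda>z. (\<Phi>\<^sub>1 z *v v z) $ i) \<in> {u. (\<lambda>z. u z * cnj (\<theta> z)) \<in> Hinf}"
    let ?u = "\<lambda>z. cnj (\<theta> z) *s v z"
    have vH: "v \<in> H2" using v by (subst Hinf_component_iff) (auto simp: HinfD)
    have ui: "(\<lambda>z. ?u z $ i) \<in> Linf" for i
      using Linf_mult[OF cnj_theta_Linf HinfD(1)[OF v]] by simp
    have "?u \<in> H2"
    proof (rule coprimeD)
      show uL: "?u \<in> L2" by (rule L2_Linf_vec[OF ui])
      have "AE z in circle. v z = \<theta> z *s ?u z"
        using theta_cnj by eventually_elim (simp add: mult.commute)
      then show "(\<lambda>z. \<theta> z *s ?u z) \<in> H2"
        by (rule H2_cong_AE[OF vH]) (intro L2_measurable L2_Linf_mult[OF HinfD(1)[OF theta_Hinf]] uL)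
      have comp: "(\<lambda>z. (\<Phi>\<^sub>1 z *v ?u z) $ i) \<in> Hinf" for i
        using \<Phi>v[of i] by (simp add: matrix_vector_mult_smult mult.commute)
      show "(\<lambda>z. \<Phi>\<^sub>1 z *v ?u z) \<in> H2"
        using comp by (subst Hinf_component_iff) (auto simp: HinfD(1))
    qed
    then have "(\<lambda>z. ?u z $ i) \<in> Hinf" by (subst (asm) Hinf_component_iff[OF ui]) blast
    then show "(\<lambda>z. v z $ i) \<in> {u. (\<lambda>z. u z * cnj (\<theta> z)) \<in> Hinf}" by (simp add: mult.commute)
  next
    have N1: "(\<lambda>z. fl_mat (\<Phi>\<^sub>1 z) n $ l $ i0) \<in> Hinf" for l by (rule fl_mat_Hinf[OF \<Phi>1])
    \<comment> \<open>The row p \<open>\<Phi>\<^sub>1\<close> times \<open>fl_mat\<close> at n is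
      minus the last coefficient times p; entry \<open>i0\<close>, where p is nonzero, isolates that
      coefficient.\<close>
    have "(\<lambda>z. (- 1 / p $ i0) * (\<Sum>l\<in>UNIV. r l z * fl_mat (\<Phi>\<^sub>1 z) n $ l $ i0)) \<in> Hinf"
      by (intro Hinf_mult Hinf_const Hinf_sum r_Hinf N1) simp
    moreover have "AE z in circle. (- 1 / p $ i0) * (\<Sum>l\<in>UNIV. r l z * fl_mat (\<Phi>\<^sub>1 z) n $ l $ i0) =
        fl_coeff (\<Phi>\<^sub>1 z) CARD('n) * cnj (\<theta> z)"
      using r_eq
    proof eventually_elim
      case (elim z)
      let ?e = "fl_coeff (\<Phi>\<^sub>1 z) (Suc n)"
      have "(\<Sum>l\<in>UNIV. \<rho> l z * fl_mat (\<Phi>\<^sub>1 z) n $ l $ i0) =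
          (\<Sum>l\<in>UNIV. \<Sum>j\<in>UNIV. p $ j * (\<Phi>\<^sub>1 z $ j $ l * fl_mat (\<Phi>\<^sub>1 z) n $ l $ i0))"
        by (simp add: \<rho>_def sum_distrib_right mult.assoc)
      also have "\<dots> = (\<Sum>j\<in>UNIV. \<Sum>l\<in>UNIV. p $ j * (\<Phi>\<^sub>1 z $ j $ l * fl_mat (\<Phi>\<^sub>1 z) n $ l $ i0))"
        by (rule sum.swap)
      also have "\<dots> = (\<Sum>j\<in>UNIV. p $ j * (\<Phi>\<^sub>1 z ** fl_mat (\<Phi>\<^sub>1 z) n) $ j $ i0)"
        by (simp add: matrix_matrix_mult_def sum_distrib_left)
      also have "\<dots> = (\<Sum>j\<in>UNIV. p $ j * ((\<Phi>\<^sub>1 z ** fl_mat (\<Phi>\<^sub>1 z) n) *v axis i0 1) $ j)"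
      proof (intro sum.cong refl arg_cong2[where f = "(*)"])
        show "(A $ j $ i0) = (A *v axis i0 1) $ j" for A :: "complex^'n^'n" and j
          by (simp add: matrix_vector_mult_def axis_def if_distrib cong: if_cong)
      qed
      also have "\<dots> = - (p $ i0 * ?e)"
        unfolding FL by (simp add: axis_def if_distrib cong: if_cong)
      finally have \<rho>: "(\<Sum>l\<in>UNIV. \<rho> l z * fl_mat (\<Phi>\<^sub>1 z) n $ l $ i0) = - (p $ i0 * ?e)" .
      have "(\<Sum>l\<in>UNIV. r l z * fl_mat (\<Phi>\<^sub>1 z) n $ l $ i0) =
          cnj (\<theta> z) * (\<Sum>l\<in>UNIV. \<rho> l z * fl_mat (\<Phi>\<^sub>1 z) n $ l $ i0)"
        using elim by (simp add: sum_distrib_left mult.assoc)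
      then show ?case using i0 by (simp add: \<rho> n)
    qed
    moreover have "(\<lambda>z. fl_coeff (\<Phi>\<^sub>1 z) CARD('n) * cnj (\<theta> z)) \<in> borel_measurable borel"
      by (rule LinfD(1)[OF Linf_mult[OF HinfD(1)[OF fl_coeff_Hinf[OF \<Phi>1]] cnj_theta_Linf]])
    ultimately show "(\<lambda>z. fl_coeff (\<Phi>\<^sub>1 z) CARD('n)) \<in> {u. (\<lambda>z. u z * cnj (\<theta> z)) \<in> Hinf}"
      unfolding mem_Collect_eq by (rule Hinf_cong_AE)
  qed simp
  then show False using nonan by simp
qed

lemma \<Phi>_Hinf_if_cnj_theta_Hinf:
  assumes "(\<lambda>z. cnj (\<theta> z)) \<in> Hinf" shows "\<Phi> \<in> Hinf_mat"
  unfolding Hinf_mat_def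
proof (intro CollectI allI)
  fix i j
  have "(\<lambda>z. \<Phi>\<^sub>1 z $ i $ j * cnj (\<theta> z)) \<in> Hinf"
    using \<Phi>1 assms by (auto simp: Hinf_mat_def intro: Hinf_mult)
  moreover have "AE z in circle. \<Phi>\<^sub>1 z $ i $ j * cnj (\<theta> z) = \<Phi> z $ i $ j"
    using factor
    by eventually_elim (simp add: matrix_matrix_mult_def mat_def mult_delta_right)
  moreover have "(\<lambda>z. \<Phi> z $ i $ j) \<in> borel_measurable borel"
    using \<Phi> LinfD(1) by (auto simp: Linf_mat_def)
  ultimately show "(\<lambda>z. \<Phi> z $ i $ j) \<in> Hinf" by (rule Hinf_cong_AE)
qed

end

text \<open>The product of the denominators of all entries clears every entry at once; an entry of
  \<open>B\<close> keeps the factors other than its own denominator.\<close>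

lemma bounded_type_common_denominator:
  fixes F :: "complex \<Rightarrow> complex^'n^'n"
  assumes "bounded_type_mat F"
  obtains \<omega> B where "\<omega> \<in> Hinf" "AE z in circle. \<omega> z \<noteq> 0" "B \<in> Hinf_mat"
    "AE z in circle. \<forall>v. B z *v v = \<omega> z *s (F z *v v)"
proof -
  define Q where "Q i j a b \<longleftrightarrow> a \<in> Hinf \<and> b \<in> Hinf \<and>
    (AE z in circle. b z \<noteq> 0 \<and> F z $ i $ j = a z / b z)" for i j a b
  have "\<exists>a b. Q i j a b" for i j
    using assms unfolding bounded_type_mat_def bounded_type_def Q_def by blast
  then obtain a b where Q: "\<And>i j. Q i j (a i j) (b i j)" by metis
  have ab: "a i j \<in> Hinf" "b i j \<in> Hinf" "AE z in circle. b i j z \<noteq> 0 \<and> F z $ i $ j = a i j z / b i j z" for i j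
    using Q[of i j] unfolding Q_def by blast+
  define c where "c ij z = b (fst ij) (snd ij) z" for ij z
  define \<omega> where "\<omega> z = (\<Prod>ij\<in>UNIV. c ij z)" for z
  define B :: "complex \<Rightarrow> complex^'n^'n"
    where "B z = (\<chi> i j. a i j z * (\<Prod>kl\<in>UNIV - {(i, j)}. c kl z))" for z
  have ae: "AE z in circle. \<forall>i\<in>UNIV. \<forall>j\<in>UNIV. b i j z \<noteq> 0 \<and> F z $ i $ j = a i j z / b i j z"
    by (intro AE_finite_allI ab) auto
  have c: "c ij \<in> Hinf" for ij unfolding c_def by (rule ab)
  show ?thesis
  proof (rule that)
    show "\<omega> \<in> Hinf" unfolding \<omega>_def by (intro Hinf_prod c) simp
    show "AE z in circle. \<omega> z \<noteq> 0" using ae by eventually_elim (simp add: \<omega>_def c_def)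
    have "(\<lambda>z. a i j z * (\<Prod>kl\<in>UNIV - {(i, j)}. c kl z)) \<in> Hinf" for i j
      by (intro Hinf_mult Hinf_prod c ab) simp
    then show "B \<in> Hinf_mat" by (simp add: Hinf_mat_def B_def)
    show "AE z in circle. \<forall>v. B z *v v = \<omega> z *s (F z *v v)"
      using ae
    proof eventually_elim
      case (elim z)
      have "B z $ i $ j = \<omega> z * F z $ i $ j" for i j
      proof -
        have "\<omega> z = b i j z * (\<Prod>kl\<in>UNIV - {(i, j)}. c kl z)"
          unfolding \<omega>_def by (subst prod.remove[of _ "(i, j)"]) (simp_all add: c_def)
        then show ?thesis using elim by (simp add: B_def)
      qed
      then show ?case by (simp add: vec_eq_iff matrix_vector_mult_def sum_distrib_left mult.assoc)
    qed
  qed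
qed

theorem theorem2:
  fixes \<Phi> \<Phi>\<^sub>1 :: "complex \<Rightarrow> complex^'n^'n"
    and \<theta> :: "complex \<Rightarrow> complex"
  assumes "\<Phi> \<in> Linf_mat"
    and "bounded_type_mat \<Phi>"
    and "bounded_type_mat (\<lambda>z. conj_transpose (\<Phi> z))"
    and "inner_function \<theta>"
    and "\<Phi>\<^sub>1 \<in> Hinf_mat"
    and "AE z in circle. \<Phi> z = \<Phi>\<^sub>1 z ** mat (cnj (\<theta> z))"
    and "right_coprime (\<lambda>z. mat (\<theta> z)) \<Phi>\<^sub>1"
    and "H2_hyponormal (toeplitz \<Phi>)"
    and "H2_hyponormal (toeplitz \<Phi> ^^ 2)"
  shows "H2_normal (toeplitz \<Phi>) \<or> \<Phi> \<in> Hinf_mat"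
proof -
  interpret square_hyponormal \<Phi> \<Phi>\<^sub>1 \<theta>
    by (rule square_hyponormal.intro) (fact assms)+
  show ?thesis
  proof (cases "\<forall>v. \<exists>f\<in>F. \<alpha> (G f) = v")
    case True
    then show ?thesis using normal_if_\<alpha>_onto by blast
  next
    case False
    obtain p where p: "p \<noteq> 0" "\<And>f. f \<in> F \<Longrightarrow> (\<Sum>i\<in>UNIV. p $ i * \<alpha> (G f) $ i) = 0"
      by (rule ex_annihilator[OF False]) (rule that)
    \<comment> \<open>The denominator is taken for the adjoint symbol, since that is the factor to
      be inverted.\<close>
    obtain \<omega> B where "\<omega> \<in> Hinf" "AE z in circle. \<omega> z \<noteq> 0" "B \<in> Hinf_mat"
      "AE z in circle. \<forall>v. B z *v v = \<omega> z *s (conj_transpose (\<Phi> z) *v v)"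
      by (rule bounded_type_common_denominator[OF assms(3)]) (rule that)
    then have "(\<lambda>z. cnj (\<theta> z)) \<in> Hinf"
      by (intro cnj_theta_Hinf_if_annihilator[OF p])
    then show ?thesis by (intro disjI2 \<Phi>_Hinf_if_cnj_theta_Hinf)
  qed
qed

end
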